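(* (1) Let $C:f=0$ be a singular, reduced plane curve of degree $d\geq 3$ in $\mathbb{P}^2$. Then $$mdr(f) \leq d-1, \quad mdr_e(f) \leq 2(d-2)\quad\text{and}\quad ct(f)\leq 3(d-2).$$ Moreover, if $\tau(C)=1$, all these inequalities are equalities. (2) Let $\mathcal{A}:f=0$ be an arrangement of $d\geq 2$ distinct lines in $\mathbb{P}^2$. Then $$mdr(f)=mdr_e(f) \leq d-2 \quad\text{and}\quad ct(f) \leq 2(d-2).$$ Moreover, both of these inequalities are equalities for a generic arrangement.
   Context: $S=\mathbb{C}[x,y,z]$ with its standard grading, $\mathbb{P}^2$ the complex projective plane, $f\in S_d$. $M(f)=S/(f_x,f_y,f_z)$ is the Milnor algebra. $AR(f)$ is the graded $S$-module of triples $(a,b,c)\in S^3$ with $af_x+bf_y+cf_z=0$. $mdr(f)$ is the smallest $r\ge0$ such that $AR(f)$ contains a nonzero triple with $a,b,c\in S_r$. $mdr_e(f)$ is the smallest $r$ such that there is a triple $(a,b,c)\in AR(f)$ with $a,b,c\in S_r$ not belonging to the $S$-submodule generated by the Koszul relations $(f_y,-f_x,0)$, $(f_z,0,-f_x)$, $(0,f_z,-f_y)$. The coincidence threshold is $$ct(f)=\max \{q:\dim M(f)_k=\dim M(f_s)_k \text{ for all } k \leq q\},$$ where $f_s\in S_d$ is any homogeneous polynomial of the same degree $d$ such that $f_s=0$ is a smooth curve. $\tau(C)$ is the total Tjurina number of $C$ (sum of the Tjurina numbers of its singular points). A line arrangement is generic if it has only double points (no three lines concurrent). *)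

theory Defs
  imports
    Complex_Main
    "HOL-Library.Extended_Nat"
    "HOL-Computational_Algebra.Computational_Algebra"
begin

text \<open>
  The ring \<open>S = \<complex>[x,y,z]\<close> is represented as \<open>\<complex>[x][y][z]\<close>: the coefficient of
  \<open>x^i y^j z^k\<close> in \<open>f\<close> is \<open>coeff (coeff (coeff f k) j) i\<close>.
\<close>

type_synonym ternary = "complex poly poly poly"

definition const3 :: "complex \<Rightarrow> ternary" where
  "const3 c = [:[:[:c:]:]:]"

definition forms :: "nat \<Rightarrow> ternary set" where
  "forms d = {f. \<forall>i j k. coeff (coeff (coeff f k) j) i \<noteq> 0 \<longrightarrow> i + j + k = d}"

definition dx :: "ternary \<Rightarrow> ternary" where
  "dx f = map_poly (map_poly pderiv) f"

definition dy :: "ternary \<Rightarrow> ternary" where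
  "dy f = map_poly pderiv f"

definition dz :: "ternary \<Rightarrow> ternary" where
  "dz f = pderiv f"

text \<open>Substitution of a triple of elements of a \<open>\<complex>\<close>-algebra with structure map \<open>e\<close>.\<close>

definition subst3 :: "(complex \<Rightarrow> 'a::comm_ring_1) \<Rightarrow> ternary \<Rightarrow> 'a \<times> 'a \<times> 'a \<Rightarrow> 'a" where
  "subst3 e f = (\<lambda>(a, b, c).
     poly (map_poly (\<lambda>q. poly (map_poly (\<lambda>r. poly (map_poly e r) a) q) b) f) c)"

abbreviation eval3 :: "ternary \<Rightarrow> complex \<times> complex \<times> complex \<Rightarrow> complex" where
  "eval3 \<equiv> subst3 (\<lambda>c. c)"

text \<open>
  Dimension of the complex vector space \<open>V / (V \<inter> W)\<close>, where scalars act on the ambient ring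
  through \<open>e\<close>: the largest number of elements of \<open>V\<close> whose classes are linearly independent
  (\<open>\<infinity>\<close> if there is no bound). The condition on \<open>B\<close> also makes these classes distinct.
\<close>

definition quot_dim :: "(complex \<Rightarrow> 'a::comm_ring_1) \<Rightarrow> 'a set \<Rightarrow> 'a set \<Rightarrow> enat" where
  "quot_dim e V W = Sup {enat (card B) | B. finite B \<and> B \<subseteq> V \<and>
     (\<forall>c. (\<Sum>b\<in>B. e (c b) * b) \<in> W \<longrightarrow> (\<forall>b\<in>B. c b = 0))}"

definition jacobian_ideal :: "ternary \<Rightarrow> ternary set" where
  "jacobian_ideal f = {a * dx f + b * dy f + c * dz f | a b c. True}"

text \<open>\<open>dim M(f)_k\<close>, where \<open>M(f)_k = S_k / (S_k \<inter> (f_x, f_y, f_z))\<close>.\<close>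

definition milnor_dim :: "ternary \<Rightarrow> nat \<Rightarrow> enat" where
  "milnor_dim f k = quot_dim const3 (forms k) (jacobian_ideal f)"

definition AR :: "ternary \<Rightarrow> (ternary \<times> ternary \<times> ternary) set" where
  "AR f = {(a, b, c). a * dx f + b * dy f + c * dz f = 0}"

text \<open>The submodule of \<open>S\<^sup>3\<close> generated by \<open>(f_y, -f_x, 0)\<close>, \<open>(f_z, 0, -f_x)\<close>, \<open>(0, f_z, -f_y)\<close>.\<close>

definition koszul :: "ternary \<Rightarrow> (ternary \<times> ternary \<times> ternary) set" where
  "koszul f = {(u * dy f + v * dz f, - u * dx f + w * dz f, - v * dx f - w * dy f) | u v w. True}"

text \<open>
  The values of \<open>mdr\<close>, \<open>mdr_e\<close> and \<open>ct\<close> are extended naturals, so that an infimum over the empty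
  set and a supremum over an unbounded set are \<open>\<infinity>\<close>; on \<open>enat\<close>, \<open>Inf\<close> of a nonempty set is its
  minimum and \<open>Sup\<close> of a nonempty bounded set of finite numbers is its maximum.
\<close>

definition mdr :: "ternary \<Rightarrow> enat" where
  "mdr f = Inf {enat r | r. \<exists>a\<in>forms r. \<exists>b\<in>forms r. \<exists>c\<in>forms r.
     (a, b, c) \<in> AR f \<and> (a, b, c) \<noteq> (0, 0, 0)}"

definition mdr_e :: "ternary \<Rightarrow> enat" where
  "mdr_e f = Inf {enat r | r. \<exists>a\<in>forms r. \<exists>b\<in>forms r. \<exists>c\<in>forms r.
     (a, b, c) \<in> AR f \<and> (a, b, c) \<notin> koszul f}"

text \<open>The first argument is the smooth form \<open>f\<^sub>s\<close> of the same degree with which \<open>f\<close> is compared.\<close>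

definition ct :: "ternary \<Rightarrow> ternary \<Rightarrow> enat" where
  "ct fs f = Sup {enat q | q. \<forall>k\<le>q. milnor_dim f k = milnor_dim fs k}"

text \<open>
  Every point of \<open>\<bbbP>\<^sup>2\<close> is represented by its unique vector of homogeneous coordinates whose first
  nonzero entry is \<open>1\<close>.
\<close>

definition P2 :: "(complex \<times> complex \<times> complex) set" where
  "P2 = {(1, b, c) | b c. True} \<union> {(0, 1, c) | c. True} \<union> {(0, 0, 1)}"

definition zeros :: "ternary \<Rightarrow> (complex \<times> complex \<times> complex) set" where
  "zeros f = {p \<in> P2. eval3 f p = 0}"

definition sing :: "ternary \<Rightarrow> (complex \<times> complex \<times> complex) set" where
  "sing f = {p \<in> zeros f. eval3 (dx f) p = 0 \<and> eval3 (dy f) p = 0 \<and> eval3 (dz f) p = 0}"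

definition smooth_form :: "nat \<Rightarrow> ternary \<Rightarrow> bool" where
  "smooth_form d f \<longleftrightarrow> f \<in> forms d \<and> f \<noteq> 0 \<and> sing f = {}"

text \<open>
  Power series in two local coordinates \<open>u\<close>, \<open>v\<close> live in \<open>\<complex>[[u]][[v]]\<close>, the coefficient of
  \<open>u^i v^j\<close> in \<open>g\<close> being \<open>g $ j $ i\<close>; the convergent ones are those with geometrically bounded
  coefficients.
\<close>

type_synonym binary_fps = "complex fps fps"

definition const2 :: "complex \<Rightarrow> binary_fps" where
  "const2 c = fps_const (fps_const c)"

definition du :: "binary_fps \<Rightarrow> binary_fps" where
  "du g = Abs_fps (\<lambda>j. fps_deriv (g $ j))"

definition dv :: "binary_fps \<Rightarrow> binary_fps" where
  "dv g = fps_deriv g"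

definition convergent_series :: "binary_fps set" where
  "convergent_series = {g. \<exists>C R::real. \<forall>i j. norm (g $ j $ i) \<le> C * R ^ (i + j)}"

text \<open>
  Local equation of \<open>f = 0\<close> at a point of \<open>P2\<close>: dehomogenise at the coordinate that is normalised
  to \<open>1\<close>, and translate the point to the origin of the affine chart.
\<close>

definition local_eq :: "ternary \<Rightarrow> complex \<times> complex \<times> complex \<Rightarrow> binary_fps" where
  "local_eq f = (\<lambda>(a, b, c). let u = fps_const fps_X; v = fps_X in
     subst3 const2 f
       (if a \<noteq> 0 then (1, const2 b + u, const2 c + v)
        else if b \<noteq> 0 then (u, 1, const2 c + v)
        else (u, v, 1)))"

text \<open>\<open>dim \<complex>{u,v} / (g, g_u, g_v)\<close> for a local equation \<open>g\<close> of the curve at \<open>p\<close>.\<close>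

definition tjurina :: "ternary \<Rightarrow> complex \<times> complex \<times> complex \<Rightarrow> enat" where
  "tjurina f p = (let g = local_eq f p in
     quot_dim const2 convergent_series
       {a * g + b * du g + c * dv g | a b c.
          a \<in> convergent_series \<and> b \<in> convergent_series \<and> c \<in> convergent_series})"

text \<open>The sum is finite for a reduced curve, which has only finitely many singular points.\<close>

definition total_tjurina :: "ternary \<Rightarrow> enat" where
  "total_tjurina f = (\<Sum>p\<in>sing f. tjurina f p)"

text \<open>
  \<open>d\<close> distinct lines \<open>l 0 = 0, \<dots>, l (d - 1) = 0\<close>; the arrangement is the curve defined by the
  product of the \<open>l i\<close>.
\<close>

definition line_arrangement :: "nat \<Rightarrow> (nat \<Rightarrow> ternary) \<Rightarrow> bool" where
  "line_arrangement d l \<longleftrightarrow>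
     (\<forall>i<d. l i \<in> forms 1 \<and> l i \<noteq> 0) \<and> inj_on (\<lambda>i. zeros (l i)) {..<d}"

definition generic_arrangement :: "nat \<Rightarrow> (nat \<Rightarrow> ternary) \<Rightarrow> bool" where
  "generic_arrangement d l \<longleftrightarrow> line_arrangement d l \<and>
     (\<forall>i<d. \<forall>j<d. \<forall>k<d. i \<noteq> j \<and> j \<noteq> k \<and> i \<noteq> k \<longrightarrow>
        zeros (l i) \<inter> zeros (l j) \<inter> zeros (l k) = {})"

end

theory Submission
  imports Defs "HOL-Computational_Algebra.Field_as_Ring" "HOL-Library.Product_Plus"
begin

text \<open>
  Let \<open>F = (P, Q, R)\<close> be the triple of partial derivatives of a form \<open>f\<close> of degree \<open>d\<close>, of degree
  \<open>e = d - 1\<close>, and let \<open>I\<close> be the ideal that it generates in \<open>S = \<complex>[x,y,z]\<close>. Up to signs the Koszul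
  relations are the cross products \<open>U \<times> F\<close>. All three invariants are read off from the comparison of
  the syzygies of \<open>F\<close> with the Koszul relations, and two facts govern this comparison when \<open>P\<close>, \<open>Q\<close>,
  \<open>R\<close> have no common factor, which holds for squarefree \<open>f\<close> by Euler's formula
  (\<open>coprime3_partials\<close>).

  First, \<open>U \<times> F = 0\<close> only if \<open>U\<close> is a multiple of \<open>F\<close>, so the dimension of the space of Koszul
  relations of degree \<open>n\<close> depends on \<open>d\<close> and \<open>n\<close> alone. By rank and nullity,
  \<open>dim M(f)\<^sub>k = dim M(f\<^sub>s)\<^sub>k\<close> for a form \<open>f\<^sub>s\<close> all of whose syzygies are Koszul exactly if all
  syzygies of \<open>f\<close> of degree \<open>k - e\<close> are Koszul. Hence \<open>ct(f) = mdr\<^sub>e(f) + d - 2\<close> (\<open>ct_eq\<close>), and only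
  \<open>mdr\<close> and \<open>mdr\<^sub>e\<close> remain to be studied.

  Second, the Koszul relations are saturated: if \<open>a\<sigma>\<close> and \<open>b\<sigma>\<close> are Koszul for two linear forms
  whose common zero is not a zero of \<open>I\<close>, then \<open>\<sigma>\<close> is Koszul (\<open>kos_saturated\<close>). As \<open>I\<sigma>\<close> is Koszul
  for every syzygy \<open>\<sigma>\<close>, a projective Nullstellensatz (\<open>nullstellensatz\<close>) shows that a smooth form has
  only Koszul syzygies. The Nullstellensatz itself is elementary: eliminating \<open>z\<close> puts a product of
  linear forms in \<open>x\<close>, \<open>y\<close> into \<open>I\<close>, so one may restrict to a line, where a form is again a product of
  linear forms, so one may restrict to a point.

  If \<open>p\<close> is a singular point and \<open>a\<close>, \<open>b\<close> are linear forms that span its ideal, write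
  \<open>F = a A + b B\<close>. The cross product \<open>A \<times> B\<close> is a syzygy of degree \<open>2 (d - 2)\<close> which is not Koszul
  (\<open>singular_point_syzygy\<close>). This gives the bounds for singular curves. If \<open>\<tau> = 1\<close>, then \<open>p\<close> is
  the only singular point and the linear parts of the local partial derivatives span the cotangent
  space, so \<open>a\<close> and \<open>b\<close> lie in the saturation of \<open>I\<close>. Therefore \<open>a\<sigma>\<close> and \<open>b\<sigma>\<close> are Koszul for
  every syzygy \<open>\<sigma>\<close>, and the obstruction to dividing by \<open>a\<close> is a form \<open>h\<close> with \<open>h F\<close> of degree
  \<open>deg \<sigma> + 2 - e\<close>. It vanishes if \<open>deg \<sigma> < 2 (d - 2)\<close> (\<open>node_syzygies_koszul\<close>).

  For a line arrangement, the derivative in the direction of the point where two lines meet kills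
  both of them, and a multiple of the Euler field corrects it to a syzygy of degree \<open>d - 2\<close>. In the
  generic case a syzygy \<open>\<delta>\<close> of degree \<open>r < d - 2\<close> is a vector field tangent to all lines, so
  \<open>\<delta> \<times> (x, y, z)\<close>, of degree \<open>r + 1\<close>, vanishes at the \<open>d - 1\<close> double points of every line, hence on
  every line, hence identically. Then \<open>\<delta>\<close> is a multiple of the Euler field, which forces \<open>\<delta> = 0\<close>.
\<close>

section \<open>Homomorphisms and derivations on ternary polynomials\<close>


definition unital_hom :: "('a::comm_ring_1 \<Rightarrow> 'b::comm_ring_1) \<Rightarrow> bool" where
  "unital_hom e \<longleftrightarrow> e 1 = 1 \<and> (\<forall>x y. e (x + y) = e x + e y) \<and> (\<forall>x y. e (x * y) = e x * e y)"

lemma unital_homD: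
  assumes "unital_hom e"
  shows "e 0 = 0" "e 1 = 1" "e (x + y) = e x + e y" "e (x * y) = e x * e y"
    "e (- x) = - e x" "e (x - y) = e x - e y" "e (x ^ n) = e x ^ n"
proof -
  show add: "\<And>x y. e (x + y) = e x + e y" and mult: "\<And>x y. e (x * y) = e x * e y" and one: "e 1 = 1"
    using assms by (auto simp: unital_hom_def)
  show z: "e 0 = 0" using add[of 0 0] by simp
  show m: "e (- x) = - e x" for x using add[of x "- x"] z by (simp add: eq_neg_iff_add_eq_0 add.commute)
  show "e (x - y) = e x - e y" using add[of x "- y"] m by simp
  show "e (x ^ n) = e x ^ n" by (induction n) (simp_all add: one mult)
qed

lemma unital_hom_comp: "unital_hom e \<Longrightarrow> unital_hom h \<Longrightarrow> unital_hom (\<lambda>x. h (e x))"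
  by (auto simp: unital_hom_def)

lemma unital_hom_id: "unital_hom (\<lambda>x. x)"
  by (auto simp: unital_hom_def)

lemma unital_hom_const_fps: "unital_hom fps_const"
  by (auto simp: unital_hom_def)

lemma eval_pCons:
  assumes "unital_hom e"
  shows "poly (map_poly e (pCons c p)) a = e c + a * poly (map_poly e p) a"
  by (simp add: map_poly_pCons unital_homD(1)[OF assms])

lemma unital_hom_eval:
  assumes e: "unital_hom e"
  shows "unital_hom (\<lambda>p. poly (map_poly e p) a)"
proof -
  note [simp] = eval_pCons[OF e] unital_homD[OF e]
  let ?h = "\<lambda>p. poly (map_poly e p) a"
  have add: "?h (p + q) = ?h p + ?h q" for p q
    by (induction p q rule: poly_induct2) (simp_all add: algebra_simps)
  have smult: "?h (smult c q) = e c * ?h q" for c q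
    by (induction q) (simp_all add: algebra_simps)
  have mult: "?h (p * q) = ?h p * ?h q" for p q
    by (induction p) (simp_all add: add smult algebra_simps)
  show ?thesis
    using eval_pCons[OF e, of 1 0] by (simp add: unital_hom_def add mult one_pCons del: eval_pCons)
qed

definition varX :: ternary where "varX = [:[:[:0, 1:]:]:]"
definition varY :: ternary where "varY = [:[:0, 1:]:]"
definition varZ :: ternary where "varZ = [:0, 1:]"

lemma ternary_pCons: "pCons a f = [:a:] + varZ * f"
  by (simp add: varZ_def)

lemma ternary_pCons2: "[:pCons a f:] = [:[:a:]:] + varY * [:f:]"
  by (simp add: varY_def)

lemma ternary_pCons3: "[:[:pCons a f:]:] = const3 a + varX * [:[:f:]:]"
  by (simp add: varX_def const3_def)

lemma ternary_horner_induct [case_names const X Y Z add]: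
  assumes c: "\<And>c. P (const3 c)" and X: "\<And>f. P f \<Longrightarrow> P (varX * f)" and Y: "\<And>f. P f \<Longrightarrow> P (varY * f)"
    and Z: "\<And>f. P f \<Longrightarrow> P (varZ * f)" and add: "\<And>f g. P f \<Longrightarrow> P g \<Longrightarrow> P (f + g)"
  shows "P f"
proof -
  have 0: "P 0" using c[of 0] by (simp add: const3_def)
  have 1: "P [:[:a:]:]" for a
    by (induction a) (simp add: 0, subst ternary_pCons3, intro add c X)
  have 2: "P [:a:]" for a
    by (induction a) (simp add: 0, subst ternary_pCons2, intro add 1 Y)
  show ?thesis
    by (induction f) (simp add: 0, subst ternary_pCons, intro add 2 Z)
qed

text \<open>
  As a \<open>\<complex>\<close>-algebra, \<open>S\<close> is generated by the three variables. Statements about homomorphisms or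
  derivations therefore need to be checked on constants and variables only.
\<close>

lemma ternary_induct [case_names const X Y Z add mult]:
  assumes "\<And>c. P (const3 c)" "P varX" "P varY" "P varZ"
    and "\<And>f g. P f \<Longrightarrow> P g \<Longrightarrow> P (f + g)" "\<And>f g. P f \<Longrightarrow> P g \<Longrightarrow> P (f * g)"
  shows "P f"
  by (induction f rule: ternary_horner_induct) (simp_all add: assms)

lemma unital_hom_subst3: "unital_hom e \<Longrightarrow> unital_hom (\<lambda>f. subst3 e f p)"
  unfolding subst3_def by (cases p) (simp add: unital_hom_eval)

lemma unital_hom_const3: "unital_hom const3"
  by (auto simp: unital_hom_def const3_def one_pCons)

lemma subst3_gens:
  assumes e: "unital_hom e"
  shows "subst3 e (const3 c) (x, y, z) = e c"
    and "subst3 e varX (x, y, z) = x" "subst3 e varY (x, y, z) = y" "subst3 e varZ (x, y, z) = z"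
proof -
  note h1 = unital_hom_eval[OF e, of x]
  note h2 = unital_hom_eval[OF h1, of y]
  note [simp] = eval_pCons[OF e] eval_pCons[OF h1] eval_pCons[OF h2] unital_homD[OF e]
    unital_homD[OF h1] unital_homD[OF h2]
  show "subst3 e (const3 c) (x, y, z) = e c"
    and "subst3 e varX (x, y, z) = x" "subst3 e varY (x, y, z) = y" "subst3 e varZ (x, y, z) = z"
    by (simp_all add: subst3_def const3_def varX_def varY_def varZ_def)
qed

lemmas subst3_simps = unital_homD[OF unital_hom_subst3] subst3_gens

lemma unital_hom_ternary_unique:
  assumes "unital_hom g" "unital_hom h" "\<And>c. g (const3 c) = h (const3 c)"
    "g varX = h varX" "g varY = h varY" "g varZ = h varZ"
  shows "g f = h f"
  by (induction f rule: ternary_induct) (simp_all add: assms unital_homD[OF assms(1)] unital_homD[OF assms(2)])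

lemma subst3_const3_id: "subst3 const3 f (varX, varY, varZ) = f"
  by (rule unital_hom_ternary_unique) (simp_all add: unital_hom_subst3 unital_hom_id unital_hom_const3 subst3_gens)

lemma hom_subst3:
  assumes "unital_hom e" "unital_hom h"
  shows "h (subst3 e f (a, b, c)) = subst3 (\<lambda>x. h (e x)) f (h a, h b, h c)"
  by (rule unital_hom_ternary_unique)
     (simp_all add: unital_hom_comp[OF unital_hom_subst3 assms(2)] assms unital_hom_subst3 unital_hom_comp subst3_gens)

definition deriv_op :: "('a::comm_ring_1 \<Rightarrow> 'a) \<Rightarrow> bool" where
  "deriv_op D \<longleftrightarrow> (\<forall>f g. D (f + g) = D f + D g) \<and> (\<forall>f g. D (f * g) = D f * g + f * D g)"

lemma deriv_opD:
  assumes "deriv_op D"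
  shows "D (f + g) = D f + D g" "D (f * g) = D f * g + f * D g" "D 0 = 0" "D 1 = 0"
proof -
  show add: "\<And>f g. D (f + g) = D f + D g" and mult: "\<And>f g. D (f * g) = D f * g + f * D g"
    using assms by (auto simp: deriv_op_def)
  show "D 0 = 0" using add[of 0 0] by simp
  show "D 1 = 0" using mult[of 1 1] by simp
qed

lemma deriv_op_pderiv: "deriv_op (pderiv :: 'a::idom poly \<Rightarrow> _)"
  by (simp add: deriv_op_def pderiv_add pderiv_mult algebra_simps)

text \<open>
  Applying a derivation of the coefficient ring coefficientwise is a derivation of the polynomial
  ring, which covers \<open>\<partial>/\<partial>x\<close> and \<open>\<partial>/\<partial>y\<close> in the iterated representation of \<open>S\<close>.
\<close>

lemma deriv_op_map_poly:
  assumes D: "deriv_op D"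
  shows "deriv_op (map_poly D)"
proof -
  note [simp] = deriv_opD[OF D]
  have sum: "D (\<Sum>i\<in>A. F i) = (\<Sum>i\<in>A. D (F i))" for F :: "nat \<Rightarrow> _" and A
    by (induction A rule: infinite_finite_induct) auto
  show ?thesis
    unfolding deriv_op_def
    by (auto simp: poly_eq_iff coeff_map_poly coeff_mult sum sum.distrib)
qed

lemma deriv_op_dx: "deriv_op dx" and deriv_op_dy: "deriv_op dy" and deriv_op_dz: "deriv_op dz"
  using deriv_op_map_poly[OF deriv_op_map_poly[OF deriv_op_pderiv]]
    deriv_op_map_poly[OF deriv_op_pderiv] deriv_op_pderiv
  unfolding dx_def[abs_def] dy_def[abs_def] dz_def[abs_def] by blast+

lemmas d_simps = deriv_opD[OF deriv_op_dx] deriv_opD[OF deriv_op_dy] deriv_opD[OF deriv_op_dz]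

lemma d_gens [simp]:
  "dx (const3 c) = 0" "dy (const3 c) = 0" "dz (const3 c) = 0"
  "dx varX = 1" "dy varX = 0" "dz varX = 0"
  "dx varY = 0" "dy varY = 1" "dz varY = 0"
  "dx varZ = 0" "dy varZ = 0" "dz varZ = 1"
  by (simp_all add: dx_def dy_def dz_def const3_def varX_def varY_def varZ_def map_poly_pCons pderiv_pCons one_pCons)

lemma chain_rule:
  assumes e: "unital_hom e" and D: "deriv_op D" and De: "\<And>c. D (e c) = 0"
  shows "D (subst3 e f (a, b, c)) = subst3 e (dx f) (a, b, c) * D a
     + subst3 e (dy f) (a, b, c) * D b + subst3 e (dz f) (a, b, c) * D c"
  by (induction f rule: ternary_induct)
     (simp_all add: subst3_simps[OF e] deriv_opD[OF D] De d_simps algebra_simps)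

section \<open>Grading\<close>

text \<open>
  \<open>grade f\<close> is \<open>f(tx, ty, tz)\<close> as a polynomial in \<open>t\<close> over \<open>S\<close>. Its coefficients are the homogeneous
  components of \<open>f\<close>, and since it is a ring homomorphism into \<open>S[t]\<close>, the multiplicativity of the
  grading is the multiplication rule for polynomials in \<open>t\<close>.
\<close>

definition grade :: "ternary \<Rightarrow> ternary poly" where
  "grade f = subst3 (\<lambda>c. [:const3 c:]) f ([:0, varX:], [:0, varY:], [:0, varZ:])"

abbreviation hcomp :: "nat \<Rightarrow> ternary \<Rightarrow> ternary" where "hcomp n f \<equiv> coeff (grade f) n"

lemma grade_scalar: "unital_hom (\<lambda>c. [:const3 c:])"
  by (auto simp: unital_hom_def const3_def one_pCons)

lemma unital_hom_grade: "unital_hom grade"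
  unfolding grade_def[abs_def] by (rule unital_hom_subst3[OF grade_scalar])

lemma grade_gens:
  "grade (const3 c) = [:const3 c:]" "grade varX = [:0, varX:]" "grade varY = [:0, varY:]" "grade varZ = [:0, varZ:]"
  unfolding grade_def by (simp_all add: subst3_gens[OF grade_scalar])

lemmas grade_hom = unital_homD[OF unital_hom_grade] grade_gens

abbreviation coeff3 :: "ternary \<Rightarrow> nat \<Rightarrow> nat \<Rightarrow> nat \<Rightarrow> complex" where
  "coeff3 f i j k \<equiv> coeff (coeff (coeff f k) j) i"

lemma coeff3_var_mult:
  "coeff3 (varX * f) i j k = (if i = 0 then 0 else coeff3 f (i - 1) j k)"
  "coeff3 (varY * f) i j k = (if j = 0 then 0 else coeff3 f i (j - 1) k)"
  "coeff3 (varZ * f) i j k = (if k = 0 then 0 else coeff3 f i j (k - 1))"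
  by (cases i; cases j; cases k; simp add: varX_def varY_def varZ_def coeff_pCons)+

lemma coeff3_const: "coeff3 (const3 c) i j k = (if i = 0 \<and> j = 0 \<and> k = 0 then c else 0)"
  by (auto simp: const3_def coeff_pCons split: nat.splits)

lemma coeff3_eqI: "(\<And>i j k. coeff3 f i j k = coeff3 g i j k) \<Longrightarrow> f = g"
  by (auto simp: poly_eq_iff)

lemma coeff3_hcomp: "coeff3 (hcomp n f) i j k = (if i + j + k = n then coeff3 f i j k else 0)"
proof -
  define G where "G f \<longleftrightarrow> (\<forall>n i j k. coeff3 (hcomp n f) i j k = (if i + j + k = n then coeff3 f i j k else 0))" for f
  have c: "G (const3 c)" for c
    by (auto simp: G_def grade_hom coeff3_const coeff_pCons split: nat.splits)
  have add: "G (f + g)" if "G f" "G g" for f g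
    using that by (simp add: G_def grade_hom)
  have hX: "hcomp n (varX * f) = (if n = 0 then 0 else varX * hcomp (n - 1) f)"
    and hY: "hcomp n (varY * f) = (if n = 0 then 0 else varY * hcomp (n - 1) f)"
    and hZ: "hcomp n (varZ * f) = (if n = 0 then 0 else varZ * hcomp (n - 1) f)" for n f
    by (auto simp: grade_hom coeff_pCons split: nat.splits)
  have X: "G (varX * f)" if "G f" for f
    using that by (auto simp: G_def hX coeff3_var_mult)
  have Y: "G (varY * f)" if "G f" for f
    using that by (auto simp: G_def hY coeff3_var_mult)
  have Z: "G (varZ * f)" if "G f" for f
    using that by (auto simp: G_def hZ coeff3_var_mult)
  have "G f" by (induction f rule: ternary_horner_induct) (intro c X Y Z add; assumption)+
  then show ?thesis by (simp add: G_def)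
qed

lemma hcomp_in_forms: "hcomp n f \<in> forms n"
  by (auto simp: forms_def coeff3_hcomp)

lemma forms_iff_grade: "f \<in> forms d \<longleftrightarrow> grade f = monom f d"
proof
  assume "f \<in> forms d"
  then have "hcomp n f = (if n = d then f else 0)" for n
    by (intro coeff3_eqI) (auto simp: coeff3_hcomp forms_def)
  then show "grade f = monom f d"
    by (auto simp: poly_eq_iff)
next
  assume "grade f = monom f d"
  then have "hcomp d f = f" by simp
  then show "f \<in> forms d" using hcomp_in_forms[of f d] by simp
qed

lemma hcomp_form: "f \<in> forms d \<Longrightarrow> hcomp n f = (if n = d then f else 0)"
  by (auto simp: forms_iff_grade)

lemma poly_grade_1: "poly (grade f) 1 = f"
proof -
  have *: "unital_hom (\<lambda>f. poly (grade f) 1)"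
    by (auto simp: unital_hom_def grade_hom)
  show ?thesis
    by (rule unital_hom_ternary_unique[OF * unital_hom_id]) (simp_all add: grade_hom)
qed

lemma sum_hcomp: "f = (\<Sum>n\<le>degree (grade f). hcomp n f)"
  using poly_grade_1[of f] by (simp add: poly_altdef)

lemma forms_0 [simp]: "0 \<in> forms n" by (simp add: forms_def)

lemma forms_add: "f \<in> forms n \<Longrightarrow> g \<in> forms n \<Longrightarrow> f + g \<in> forms n"
  by (simp add: forms_iff_grade grade_hom add_monom)

lemma forms_uminus: "f \<in> forms n \<Longrightarrow> - f \<in> forms n"
  by (simp add: forms_iff_grade grade_hom minus_monom)

lemma forms_diff: "f \<in> forms n \<Longrightarrow> g \<in> forms n \<Longrightarrow> f - g \<in> forms n"
  by (simp add: forms_iff_grade grade_hom diff_monom)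

lemma forms_mult: "f \<in> forms m \<Longrightarrow> g \<in> forms n \<Longrightarrow> f * g \<in> forms (m + n)"
  by (simp add: forms_iff_grade grade_hom mult_monom)

lemma forms_const3: "const3 c \<in> forms 0"
  by (simp add: forms_iff_grade grade_hom monom_0)

lemma forms_cmult: "f \<in> forms n \<Longrightarrow> const3 c * f \<in> forms n"
  using forms_mult[OF forms_const3] by simp

lemma forms_vars: "varX \<in> forms 1" "varY \<in> forms 1" "varZ \<in> forms 1"
  by (simp_all add: forms_iff_grade grade_hom monom_altdef)

lemma forms_power: "f \<in> forms n \<Longrightarrow> f ^ m \<in> forms (n * m)"
  by (simp add: forms_iff_grade grade_hom monom_power)

lemma hcomp_mult_form:
  assumes "g \<in> forms e"
  shows "hcomp n (h * g) = (if n < e then 0 else hcomp (n - e) h * g)"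
  using assms by (subst (1 2) mult.commute) (simp add: forms_iff_grade grade_hom coeff_monom_mult)

lemma forms_0_iff: "f \<in> forms 0 \<longleftrightarrow> (\<exists>c. f = const3 c)"
proof
  assume "f \<in> forms 0"
  then have "f = const3 (coeff3 f 0 0 0)"
    by (intro coeff3_eqI) (auto simp: forms_def coeff3_const)
  then show "\<exists>c. f = const3 c" by blast
qed (auto simp: forms_const3)


lemma coeff3_d:
  "coeff3 (dx f) i j k = of_nat (Suc i) * coeff3 f (Suc i) j k"
  "coeff3 (dy f) i j k = of_nat (Suc j) * coeff3 f i (Suc j) k"
  "coeff3 (dz f) i j k = of_nat (Suc k) * coeff3 f i j (Suc k)"
proof -
  show "coeff3 (dx f) i j k = of_nat (Suc i) * coeff3 f (Suc i) j k"
    by (simp add: dx_def coeff_map_poly coeff_pderiv)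
  show "coeff3 (dy f) i j k = of_nat (Suc j) * coeff3 f i (Suc j) k"
    by (simp add: dy_def coeff_map_poly coeff_pderiv of_nat_poly del: of_nat_Suc)
  show "coeff3 (dz f) i j k = of_nat (Suc k) * coeff3 f i j (Suc k)"
    by (simp add: dz_def coeff_pderiv of_nat_poly del: of_nat_Suc)
qed

lemma forms_d:
  assumes "f \<in> forms d"
  shows "dx f \<in> forms (d - 1)" "dy f \<in> forms (d - 1)" "dz f \<in> forms (d - 1)"
  using assms unfolding forms_def by (force simp: coeff3_d simp del: of_nat_Suc)+

lemma coeff3_const_mult: "coeff3 (const3 c * f) i j k = c * coeff3 f i j k"
  by (simp add: const3_def)

lemma euler:
  assumes "f \<in> forms d"
  shows "varX * dx f + varY * dy f + varZ * dz f = const3 (of_nat d) * f"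
proof (rule coeff3_eqI)
  fix i j k
  have "of_nat i * coeff3 f i j k + of_nat j * coeff3 f i j k + of_nat k * coeff3 f i j k
    = of_nat d * coeff3 f i j k"
    using assms by (cases "coeff3 f i j k = 0") (auto simp: forms_def simp flip: distrib_right of_nat_add)
  moreover have "coeff3 (varX * dx f) i j k = of_nat i * coeff3 f i j k"
    by (cases i) (simp_all add: coeff3_var_mult coeff3_d)
  moreover have "coeff3 (varY * dy f) i j k = of_nat j * coeff3 f i j k"
    by (cases j) (simp_all add: coeff3_var_mult coeff3_d)
  moreover have "coeff3 (varZ * dz f) i j k = of_nat k * coeff3 f i j k"
    by (cases k) (simp_all add: coeff3_var_mult coeff3_d)
  ultimately show "coeff3 (varX * dx f + varY * dy f + varZ * dz f) i j k = coeff3 (const3 (of_nat d) * f) i j k"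
    by (simp add: coeff3_const_mult)
qed

text \<open>
  Both sides are homomorphisms in \<open>f\<close> if the right-hand side is read as the evaluation of \<open>grade f\<close>
  at \<open>t\<close>.
\<close>

lemma subst3_scale:
  assumes e: "unital_hom e" and f: "f \<in> forms d"
  shows "subst3 e f (t * a, t * b, t * c) = t ^ d * subst3 e f (a, b, c)"
proof -
  note h1 = unital_hom_subst3[OF e, of "(a, b, c)"]
  note h2 = unital_hom_comp[OF unital_hom_grade unital_hom_eval[OF h1, of t]]
  have "subst3 e f (t * a, t * b, t * c) = poly (map_poly (\<lambda>g. subst3 e g (a, b, c)) (grade f)) t"
    by (rule unital_hom_ternary_unique[OF unital_hom_subst3[OF e] h2])
       (simp_all add: grade_hom subst3_gens[OF e] eval_pCons[OF h1] unital_homD[OF h1] mult.commute)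
  also have "\<dots> = t ^ d * subst3 e f (a, b, c)"
    using f by (simp add: forms_iff_grade map_poly_monom unital_homD[OF h1] poly_monom mult.commute)
  finally show ?thesis .
qed

lemmas eval_simps = subst3_simps[OF unital_hom_id]
lemmas const3_hom = unital_homD[OF unital_hom_const3]

lemma const3_eq_iff [simp]: "const3 a = const3 b \<longleftrightarrow> a = b"
  by (simp add: const3_def)

lemma const3_eq_0_iff [simp]: "const3 a = 0 \<longleftrightarrow> a = 0"
  by (simp add: const3_def)

lemma const3_inverse: "a \<noteq> 0 \<Longrightarrow> const3 (inverse a) * (const3 a * f) = f"
  by (simp add: const3_hom(2) mult.assoc[symmetric] const3_hom(4)[symmetric])

text \<open>
  Sort the monomials by the first of the variables \<open>z\<close>, \<open>y\<close>, \<open>x\<close> that divides them.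
\<close>

lemma forms_pos_decomp:
  assumes "f \<in> forms (Suc n)"
  obtains f1 f2 f3 where "f1 \<in> forms n" "f2 \<in> forms n" "f3 \<in> forms n"
    "f = varX * f1 + varY * f2 + varZ * f3"
proof -
  obtain a f3 where f: "f = pCons a f3" by (cases f)
  obtain b f2 where a: "a = pCons b f2" by (cases a)
  obtain c f1 where b: "b = pCons c f1" by (cases b)
  have eq: "f = const3 c + varX * [:[:f1:]:] + varY * [:f2:] + varZ * f3"
    unfolding f a b by (subst ternary_pCons, subst ternary_pCons2, subst ternary_pCons3) simp
  have zero: "coeff3 f i j k = 0" if "i + j + k \<noteq> Suc n" for i j k
    using assms that by (auto simp: forms_def)
  have c: "c = 0" using zero[of 0 0 0] by (simp add: f a b)
  have "coeff3 [:[:f1:]:] i j k = (if j = 0 \<and> k = 0 then coeff3 f (Suc i) j k else 0)" for i j k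
    by (auto simp: f a b coeff_pCons split: nat.splits)
  then have 1: "[:[:f1:]:] \<in> forms n" using zero unfolding forms_def by (auto split: if_splits) (metis add_Suc add_Suc_right add_0_right nat.inject)+
  have "coeff3 [:f2:] i j k = (if k = 0 then coeff3 f i (Suc j) k else 0)" for i j k
    by (auto simp: f a b coeff_pCons split: nat.splits)
  then have 2: "[:f2:] \<in> forms n" using zero unfolding forms_def by (auto split: if_splits) (metis add_Suc add_Suc_right add_0_right nat.inject)+
  have "coeff3 f3 i j k = coeff3 f i j (Suc k)" for i j k by (simp add: f)
  then have 3: "f3 \<in> forms n" using zero unfolding forms_def by auto (metis add_Suc_right nat.inject)
  show ?thesis using that[OF 1 2 3] eq c by (simp add: const3_hom(1))
qed

lemma forms_induct [consumes 1, case_names const step]: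
  assumes "f \<in> forms n" and "\<And>c. P 0 (const3 c)"
    and "\<And>n f1 f2 f3. P n f1 \<Longrightarrow> P n f2 \<Longrightarrow> P n f3 \<Longrightarrow> P (Suc n) (varX * f1 + varY * f2 + varZ * f3)"
  shows "P n f"
  using assms(1)
proof (induction n arbitrary: f)
  case 0
  then show ?case using assms(2) by (auto simp: forms_0_iff)
next
  case (Suc n)
  from Suc.prems obtain f1 f2 f3 where "f1 \<in> forms n" "f2 \<in> forms n" "f3 \<in> forms n"
    "f = varX * f1 + varY * f2 + varZ * f3" by (rule forms_pos_decomp)
  then show ?case using assms(3) Suc.IH by blast
qed

section \<open>Ideals\<close>

definition is_ideal :: "'a::comm_ring_1 set \<Rightarrow> bool" where
  "is_ideal J \<longleftrightarrow> 0 \<in> J \<and> (\<forall>a\<in>J. \<forall>b\<in>J. a + b \<in> J) \<and> (\<forall>r. \<forall>a\<in>J. r * a \<in> J)"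

definition adjoin :: "'a::comm_ring_1 set \<Rightarrow> 'a \<Rightarrow> 'a set" where
  "adjoin J a = {j + r * a | j r. j \<in> J}"

definition ideal_radical :: "'a::comm_ring_1 set \<Rightarrow> 'a set" where
  "ideal_radical J = {a. \<exists>n. a ^ n \<in> J}"

lemma is_idealD:
  assumes "is_ideal J"
  shows "0 \<in> J" "a \<in> J \<Longrightarrow> b \<in> J \<Longrightarrow> a + b \<in> J" "a \<in> J \<Longrightarrow> r * a \<in> J" "a \<in> J \<Longrightarrow> a * r \<in> J"
    "a \<in> J \<Longrightarrow> - a \<in> J" "a \<in> J \<Longrightarrow> b \<in> J \<Longrightarrow> a - b \<in> J"
proof -
  show 1: "0 \<in> J" "a \<in> J \<Longrightarrow> b \<in> J \<Longrightarrow> a + b \<in> J" and 2: "a \<in> J \<Longrightarrow> r * a \<in> J" for a b r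
    using assms by (auto simp: is_ideal_def)
  show "a \<in> J \<Longrightarrow> a * r \<in> J" using 2 by (simp add: mult.commute)
  show 3: "a \<in> J \<Longrightarrow> - a \<in> J" for a using 2[of a "-1"] by simp
  show "a \<in> J \<Longrightarrow> b \<in> J \<Longrightarrow> a - b \<in> J" using 1(2)[of a "- b"] 3[of b] by simp
qed

lemma ideal_sum: "is_ideal J \<Longrightarrow> (\<And>i. i \<in> A \<Longrightarrow> F i \<in> J) \<Longrightarrow> sum F A \<in> J"
  by (induction A rule: infinite_finite_induct) (auto simp: is_idealD)

lemma is_ideal_adjoin:
  assumes "is_ideal J"
  shows "is_ideal (adjoin J a)"
  unfolding is_ideal_def
proof (intro conjI ballI allI)
  show "0 \<in> adjoin J a"
    unfolding adjoin_def using is_idealD(1)[OF assms] by (intro CollectI exI[of _ 0]) auto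
next
  fix x y assume "x \<in> adjoin J a" "y \<in> adjoin J a"
  then obtain j r j' r' where "x = j + r * a" "y = j' + r' * a" "j \<in> J" "j' \<in> J" by (auto simp: adjoin_def)
  then show "x + y \<in> adjoin J a"
    unfolding adjoin_def using is_idealD(2)[OF assms]
    by (intro CollectI exI[of _ "j + j'"] exI[of _ "r + r'"]) (auto simp: algebra_simps)
next
  fix s x assume "x \<in> adjoin J a"
  then obtain j r where "x = j + r * a" "j \<in> J" by (auto simp: adjoin_def)
  then show "s * x \<in> adjoin J a"
    unfolding adjoin_def using is_idealD(3)[OF assms]
    by (intro CollectI exI[of _ "s * j"] exI[of _ "s * r"]) (auto simp: algebra_simps)
qed

lemma adjoinI: "is_ideal J \<Longrightarrow> j \<in> J \<Longrightarrow> j + r * a \<in> adjoin J a"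
  by (auto simp: adjoin_def)

lemma adjoin_superset: "j \<in> J \<Longrightarrow> j \<in> adjoin J a"
  unfolding adjoin_def by (intro CollectI exI[of _ j] exI[of _ 0]) auto

lemma adjoin_self: "is_ideal J \<Longrightarrow> a \<in> adjoin J a"
  unfolding adjoin_def using is_idealD(1) by (intro CollectI exI[of _ 0] exI[of _ 1]) auto

lemma adjoin_absorb: "is_ideal J \<Longrightarrow> a \<in> J \<Longrightarrow> adjoin J a = J"
  by (auto simp: adjoin_superset) (auto simp: adjoin_def is_idealD)

lemma ideal_radical_mono: "J \<subseteq> K \<Longrightarrow> ideal_radical J \<subseteq> ideal_radical K"
  by (auto simp: ideal_radical_def)

text \<open>
  Radicals see products as intersections: this reduces a radical membership modulo a product to the
  memberships modulo its factors, and is what lets the Nullstellensatz descend from the plane to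
  lines and from lines to points.
\<close>

lemma ideal_radical_adjoin_mult:
  assumes J: "is_ideal J" and "h \<in> ideal_radical (adjoin J a)" "h \<in> ideal_radical (adjoin J b)"
  shows "h \<in> ideal_radical (adjoin J (a * b))"
proof -
  from assms obtain m n j r k s where *: "h ^ m = j + r * a" "h ^ n = k + s * b" "j \<in> J" "k \<in> J"
    by (auto simp: ideal_radical_def adjoin_def)
  have "h ^ (m + n) = (j * k + (j * s * b + r * a * k)) + (r * s) * (a * b)"
    by (simp add: power_add * algebra_simps)
  moreover have "j * k + (j * s * b + r * a * k) \<in> J"
    using * J by (intro is_idealD) auto
  ultimately have "h ^ (m + n) \<in> adjoin J (a * b)" using adjoinI[OF J] by simp
  then show ?thesis by (auto simp: ideal_radical_def)
qed

lemma ideal_radical_adjoin_prod_list: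
  assumes J: "is_ideal J" and "h \<in> ideal_radical (adjoin J a)"
    and "\<And>x. x \<in> set xs \<Longrightarrow> h \<in> ideal_radical (adjoin J (F x))"
  shows "h \<in> ideal_radical (adjoin J (a * (\<Prod>x\<leftarrow>xs. F x)))"
  using assms(3)
proof (induction xs)
  case (Cons x xs)
  have "h \<in> ideal_radical (adjoin J (F x * (a * (\<Prod>x\<leftarrow>xs. F x))))"
    by (rule ideal_radical_adjoin_mult[OF J]) (use Cons in auto)
  then show ?case by (simp add: ac_simps)
qed (simp add: assms)

lemma subst3_cong_ideal:
  assumes J: "is_ideal J" and e: "unital_hom e" and "a - a' \<in> J" "b - b' \<in> J" "c - c' \<in> J"
  shows "subst3 e f (a, b, c) - subst3 e f (a', b', c') \<in> J"
proof (induction f rule: ternary_induct)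
  case (add f g)
  have "subst3 e (f + g) (a, b, c) - subst3 e (f + g) (a', b', c')
    = (subst3 e f (a, b, c) - subst3 e f (a', b', c')) + (subst3 e g (a, b, c) - subst3 e g (a', b', c'))"
    by (simp add: subst3_simps[OF e])
  then show ?case using add is_idealD[OF J] by metis
next
  case (mult f g)
  have "subst3 e (f * g) (a, b, c) - subst3 e (f * g) (a', b', c')
    = (subst3 e f (a, b, c) - subst3 e f (a', b', c')) * subst3 e g (a, b, c)
      + subst3 e f (a', b', c') * (subst3 e g (a, b, c) - subst3 e g (a', b', c'))"
    by (simp add: subst3_simps[OF e] algebra_simps)
  then show ?case using mult is_idealD[OF J] by metis
qed (use assms in \<open>auto simp: subst3_simps[OF e] is_idealD\<close>)

definition gen2 :: "'a::comm_ring_1 \<Rightarrow> 'a \<Rightarrow> 'a set" where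
  "gen2 a b = {r * a + s * b | r s. True}"

lemma is_ideal_0: "is_ideal {0}" by (auto simp: is_ideal_def)

lemma gen2_adjoin: "gen2 a b = adjoin (adjoin {0} a) b"
  by (auto simp: gen2_def adjoin_def)

lemma is_ideal_gen2: "is_ideal (gen2 a b)"
  unfolding gen2_adjoin by (intro is_ideal_adjoin is_ideal_0)

section \<open>Linear forms and points\<close>

type_synonym vec3 = "complex \<times> complex \<times> complex"

definition dot :: "vec3 \<Rightarrow> vec3 \<Rightarrow> complex" where
  "dot = (\<lambda>(a, b, c) (x, y, z). a * x + b * y + c * z)"

definition cross :: "vec3 \<Rightarrow> vec3 \<Rightarrow> vec3" where
  "cross = (\<lambda>(a, b, c) (x, y, z). (b * z - c * y, c * x - a * z, a * y - b * x))"

definition lin :: "vec3 \<Rightarrow> ternary" where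
  "lin = (\<lambda>(a, b, c). const3 a * varX + const3 b * varY + const3 c * varZ)"

lemma eval_lin: "eval3 (lin v) p = dot v p"
  by (cases v; cases p) (simp add: lin_def dot_def eval_simps)

lemma lin_form: "lin v \<in> forms 1"
  using forms_cmult[OF forms_vars(1)] forms_cmult[OF forms_vars(2)] forms_cmult[OF forms_vars(3)]
  by (cases v) (auto simp: lin_def intro!: forms_add)

lemma lin_eq_0_iff [simp]: "lin v = 0 \<longleftrightarrow> v = (0, 0, 0)"
proof
  assume *: "lin v = 0"
  have "dot v p = 0" for p using eval_lin[of v p] * by (cases p) (simp add: eval_simps)
  from this[of "(1, 0, 0)"] this[of "(0, 1, 0)"] this[of "(0, 0, 1)"] show "v = (0, 0, 0)"
    by (cases v) (simp add: dot_def)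
qed (simp add: lin_def const3_hom)

lemma forms_1_iff: "f \<in> forms 1 \<longleftrightarrow> (\<exists>v. f = lin v)"
proof
  assume "f \<in> forms 1"
  then obtain f1 f2 f3 where "f1 \<in> forms 0" "f2 \<in> forms 0" "f3 \<in> forms 0"
    "f = varX * f1 + varY * f2 + varZ * f3" using forms_pos_decomp[of f 0] by (metis One_nat_def)
  then obtain a b c where "f = lin (a, b, c)" by (auto simp: forms_0_iff lin_def mult.commute)
  then show "\<exists>v. f = lin v" by blast
qed (use lin_form in auto)

lemma ex_dot_1:
  assumes "p \<noteq> (0, 0, 0)"
  shows "\<exists>c. dot c p = 1"
proof -
  obtain x y z where p: "p = (x, y, z)" by (metis prod.collapse)
  then have "x \<noteq> 0 \<or> y \<noteq> 0 \<or> z \<noteq> 0" using assms by simp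
  then have "dot (inverse x, 0, 0) p = 1 \<or> dot (0, inverse y, 0) p = 1 \<or> dot (0, 0, inverse z) p = 1"
    by (auto simp: dot_def p)
  then show ?thesis by blast
qed

text \<open>
  Cramer's rule in the basis \<open>a\<close>, \<open>b\<close>, \<open>c\<close>, whose determinant \<open>c \<bullet> (a \<times> b)\<close> is normalised to 1.
\<close>

lemma lin_cramer:
  assumes c: "dot c (cross a b) = 1"
  shows "lin v = const3 (dot v (cross b c)) * lin a + const3 (dot v (cross c a)) * lin b
    + const3 (dot v (cross a b)) * lin c"
proof -
  obtain a1 a2 a3 b1 b2 b3 c1 c2 c3 v1 v2 v3 where [simp]: "a = (a1, a2, a3)" "b = (b1, b2, b3)"
    "c = (c1, c2, c3)" "v = (v1, v2, v3)" by (metis prod.collapse)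
  define r s d where rsd: "r = dot v (cross b c)" "s = dot v (cross c a)" "d = dot v (cross a b)"
  have "v1 * dot c (cross a b) = r * a1 + s * b1 + d * c1"
    by (simp add: rsd dot_def cross_def algebra_simps)
  moreover have "v2 * dot c (cross a b) = r * a2 + s * b2 + d * c2"
    by (simp add: rsd dot_def cross_def algebra_simps)
  moreover have "v3 * dot c (cross a b) = r * a3 + s * b3 + d * c3"
    by (simp add: rsd dot_def cross_def algebra_simps)
  ultimately have "v1 = r * a1 + s * b1 + d * c1" "v2 = r * a2 + s * b2 + d * c2"
    "v3 = r * a3 + s * b3 + d * c3" by (simp_all only: c mult_1_right)
  then have "lin v = const3 r * lin a + const3 s * lin b + const3 d * lin c"
    by (simp add: lin_def const3_hom algebra_simps)
  then show ?thesis by (simp only: rsd)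
qed

lemma lin_mod_gen2:
  assumes c: "dot c (cross a b) = 1"
  shows "lin v - const3 (dot v (cross a b)) * lin c \<in> gen2 (lin a) (lin b)"
  unfolding gen2_def lin_cramer[OF c, of v] by auto

lemma var_lin: "varX = lin (1, 0, 0)" "varY = lin (0, 1, 0)" "varZ = lin (0, 0, 1)"
  by (simp_all add: lin_def const3_hom)

text \<open>
  The forms \<open>lin a\<close> and \<open>lin b\<close> cut out the point \<open>p = a \<times> b\<close>. Modulo them each variable is its value
  at \<open>p\<close> times \<open>lin c\<close>, so a form of degree \<open>n\<close> is its value at \<open>p\<close> times \<open>(lin c)^n\<close>.
\<close>

lemma form_mod_point:
  assumes c: "dot c (cross a b) = 1" and f: "f \<in> forms n"
  shows "f - const3 (eval3 f (cross a b)) * lin c ^ n \<in> gen2 (lin a) (lin b)"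
proof -
  obtain p1 p2 p3 where p: "cross a b = (p1, p2, p3)" by (metis prod.collapse)
  have "subst3 const3 f (varX, varY, varZ) - subst3 const3 f (lin c * const3 p1, lin c * const3 p2, lin c * const3 p3)
    \<in> gen2 (lin a) (lin b)"
    using lin_mod_gen2[OF c, of "(1, 0, 0)"] lin_mod_gen2[OF c, of "(0, 1, 0)"] lin_mod_gen2[OF c, of "(0, 0, 1)"]
    by (intro subst3_cong_ideal is_ideal_gen2 unital_hom_const3) (simp_all add: var_lin p dot_def mult.commute)
  also have "subst3 const3 f (lin c * const3 p1, lin c * const3 p2, lin c * const3 p3)
    = lin c ^ n * subst3 const3 f (const3 p1, const3 p2, const3 p3)"
    by (rule subst3_scale[OF unital_hom_const3 f])
  also have "subst3 const3 f (const3 p1, const3 p2, const3 p3) = const3 (eval3 f (p1, p2, p3))"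
    by (rule hom_subst3[OF unital_hom_id unital_hom_const3, symmetric])
  finally show ?thesis by (simp add: subst3_const3_id p mult.commute)
qed

lemma form_vanishes_gen2:
  assumes "cross a b \<noteq> (0, 0, 0)" "f \<in> forms n" "eval3 f (cross a b) = 0"
  shows "f \<in> gen2 (lin a) (lin b)"
  using form_mod_point[of _ a b f n] ex_dot_1[OF assms(1)] assms(2,3) by (auto simp: const3_hom)

lemma dot_cross_self: "dot a (cross a b) = 0" "dot b (cross a b) = 0"
  by (cases a; cases b; simp add: dot_def cross_def algebra_simps)+

lemma cross_eq_0_imp_multiple:
  assumes "cross a b = (0, 0, 0)" "a \<noteq> (0, 0, 0)"
  shows "\<exists>k. lin b = const3 k * lin a"
proof -
  obtain a1 a2 a3 b1 b2 b3 where v: "a = (a1, a2, a3)" "b = (b1, b2, b3)" by (metis prod.collapse)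
  have e: "a2 * b3 = a3 * b2" "a3 * b1 = a1 * b3" "a1 * b2 = a2 * b1"
    using assms by (auto simp: cross_def v)
  obtain k where "b1 = k * a1" "b2 = k * a2" "b3 = k * a3"
  proof (cases "a1 = 0")
    case False
    then show ?thesis using e by (intro that[of "b1 / a1"]) (auto simp: field_simps)
  next
    case 1: True
    show ?thesis
    proof (cases "a2 = 0")
      case False
      then show ?thesis using e 1 by (intro that[of "b2 / a2"]) (auto simp: field_simps)
    next
      case True
      then show ?thesis using e 1 assms(2) v by (intro that[of "b3 / a3"]) (auto simp: field_simps)
    qed
  qed
  then show ?thesis by (auto simp: lin_def v const3_hom algebra_simps intro!: exI[of _ k])
qed


section \<open>Factorisation on a line\<close>

lemma nonzero_constant_unit: "f \<in> forms 0 \<Longrightarrow> f \<noteq> 0 \<Longrightarrow> f dvd 1"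
proof -
  assume "f \<in> forms 0" "f \<noteq> 0"
  then obtain c where "f = const3 c" "c \<noteq> 0" by (auto simp: forms_0_iff)
  then have "1 = f * const3 (inverse c)" by (simp flip: const3_hom(4)) (simp add: const3_hom)
  then show ?thesis by (rule dvdI)
qed

lemma degree_grade_0: "degree (grade f) = 0 \<Longrightarrow> f \<in> forms 0"
  using sum_hcomp[of f] hcomp_in_forms[of f 0] by simp

text \<open>
  In a factorisation of a linear form the degrees in \<open>t\<close> of the images under \<open>grade\<close> add up to 1, so
  one factor is a constant.
\<close>

lemma prime_lin:
  assumes "v \<noteq> (0, 0, 0)"
  shows "prime_elem (lin v)"
proof -
  have "irreducible (lin v)"
  proof (rule irreducibleI)
    show "lin v \<noteq> 0" using assms by simp
    show "\<not> lin v dvd 1"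
    proof
      assume "lin v dvd 1"
      then obtain g where "1 = lin v * g" by (rule dvdE)
      then have "eval3 (lin v) (0,0,0) * eval3 g (0,0,0) = 1" by (metis eval_simps(2,4))
      then show False by (cases v) (simp add: eval_lin dot_def)
    qed
    fix a b assume ab: "lin v = a * b"
    then have nz: "a \<noteq> 0" "b \<noteq> 0" using assms by (metis lin_eq_0_iff mult_zero_left mult_zero_right)+
    then have gnz: "grade a \<noteq> 0" "grade b \<noteq> 0" using poly_grade_1 by (metis poly_0)+
    have "monom (lin v) 1 = grade a * grade b"
      using lin_form[of v] ab by (metis forms_iff_grade grade_hom(4))
    then have "degree (grade a) + degree (grade b) = 1"
      using degree_mult_eq[OF gnz] assms by (metis degree_monom_eq lin_eq_0_iff)
    then have "degree (grade a) = 0 \<or> degree (grade b) = 0" by linarith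
    then show "a dvd 1 \<or> b dvd 1"
      using degree_grade_0 nonzero_constant_unit nz by blast
  qed
  then show ?thesis by (simp add: prime_elem_iff_irreducible)
qed

lemma lin_dvd_lin:
  assumes "lin a dvd lin b"
  shows "cross a b = (0, 0, 0)"
proof -
  obtain g where g: "lin b = lin a * g" using assms by (rule dvdE)
  have "dot b (cross a w) = 0" for w
    using arg_cong[OF g, of "\<lambda>f. eval3 f (cross a w)"]
    by (cases "cross a w") (metis dot_cross_self(1) eval_lin eval_simps(4) mult_zero_left)
  from this[of "(1,0,0)"] this[of "(0,1,0)"] this[of "(0,0,1)"] show ?thesis
    by (cases a; cases b) (simp add: dot_def cross_def algebra_simps)
qed

text \<open>
  The homogenisation of \<open>p\<close> to degree \<open>n\<close>, evaluated at \<open>(s, t)\<close>. The degree is an argument because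
  it may exceed that of \<open>p\<close>, in which case \<open>t\<close> divides the result.
\<close>

definition binary_form :: "nat \<Rightarrow> complex poly \<Rightarrow> ternary \<Rightarrow> ternary \<Rightarrow> ternary" where
  "binary_form n p s t = (\<Sum>i\<le>n. const3 (coeff p i) * s ^ i * t ^ (n - i))"

lemma binary_form_add: "binary_form n (p + q) s t = binary_form n p s t + binary_form n q s t"
  by (simp add: binary_form_def const3_hom algebra_simps sum.distrib)

lemma binary_form_linear_mult:
  assumes "degree p \<le> n"
  shows "binary_form (Suc n) ([:\<beta>, \<alpha>:] * p) s t = (const3 \<alpha> * s + const3 \<beta> * t) * binary_form n p s t"
proof -
  have 1: "binary_form (Suc n) (smult \<beta> p) s t = const3 \<beta> * t * binary_form n p s t"
    using assms coeff_eq_0[of p "Suc n"]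
    by (simp add: binary_form_def const3_hom sum_distrib_left Suc_diff_le algebra_simps)
  have 2: "binary_form (Suc n) (pCons 0 (smult \<alpha> p)) s t = const3 \<alpha> * s * binary_form n p s t"
    unfolding binary_form_def
    by (subst sum.atMost_Suc_shift) (simp add: const3_hom sum_distrib_left algebra_simps)
  have "[:\<beta>, \<alpha>:] * p = smult \<beta> p + pCons 0 (smult \<alpha> p)" by simp
  then show ?thesis by (simp only: binary_form_add 1 2) (simp add: algebra_simps)
qed

text \<open>
  The homogenised fundamental theorem of algebra: split off a root of \<open>p\<close>, or the factor \<open>t\<close>, the
  root at infinity, when \<open>p\<close> has degree less than \<open>n\<close>.
\<close>

lemma binary_form_factor:
  assumes "degree p \<le> n" "p \<noteq> 0"
  shows "\<exists>c ps. c \<noteq> 0 \<and> length ps = n \<and> (0, 0) \<notin> set ps \<and>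
    binary_form n p s t = const3 c * (\<Prod>(\<alpha>, \<beta>)\<leftarrow>ps. const3 \<alpha> * s + const3 \<beta> * t)"
  using assms
proof (induction n arbitrary: p)
  case 0
  then obtain c where "p = [:c:]" "c \<noteq> 0" by (metis degree_eq_zeroE le_zero_eq pCons_0_0)
  then show ?case by (intro exI[of _ c] exI[of _ "[]"]) (simp add: binary_form_def)
next
  case (Suc n)
  obtain \<alpha> \<beta> q where q: "p = [:\<beta>, \<alpha>:] * q" "degree q \<le> n" "(\<alpha>, \<beta>) \<noteq> (0, 0)"
  proof (cases "degree p \<le> n")
    case True
    then show ?thesis by (intro that[of 1 0 p]) auto
  next
    case False
    then obtain r where "poly p r = 0"
      using fundamental_theorem_of_algebra[of p] by (metis constant_degree le0)
    then obtain q where q: "p = [:- r, 1:] * q" by (metis poly_eq_0_iff_dvd dvdE)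
    then have "q \<noteq> 0" using Suc by auto
    then have "degree p = Suc (degree q)" unfolding q by (subst degree_mult_eq) auto
    then show ?thesis using Suc q by (intro that[of "- r" 1 q]) auto
  qed
  then have "q \<noteq> 0" using Suc.prems by auto
  from Suc.IH[OF q(2) this] obtain c ps where "c \<noteq> 0" "length ps = n" "(0, 0) \<notin> set ps"
    "binary_form n q s t = const3 c * (\<Prod>(\<alpha>, \<beta>)\<leftarrow>ps. const3 \<alpha> * s + const3 \<beta> * t)" by auto
  then show ?case using q binary_form_linear_mult[OF q(2), of \<beta> \<alpha> s t]
    by (intro exI[of _ c] exI[of _ "(\<alpha>, \<beta>) # ps"]) auto
qed

lemma ex_cross_nonzero:
  assumes "a \<noteq> (0, 0, 0)"
  shows "\<exists>b. cross a b \<noteq> (0, 0, 0)"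
proof -
  obtain x y z where a: "a = (x, y, z)" by (metis prod.collapse)
  have "cross a (1, 0, 0) = (0, z, - y)" "cross a (0, 1, 0) = (- z, 0, x)" by (simp_all add: cross_def a)
  then show ?thesis using assms a by (metis neg_equal_0_iff_equal prod.inject)
qed

lemma form_binary_mod_lin:
  assumes c: "dot c (cross a b) = 1" and w: "w \<in> forms n"
  shows "\<exists>p. degree p \<le> n \<and> lin a dvd w - binary_form n p (lin b) (lin c)"
  using w
proof (induction rule: forms_induct)
  case (const k)
  then show ?case by (intro exI[of _ "[:k:]"]) (simp add: binary_form_def)
next
  case (step n f1 f2 f3)
  obtain r1 r2 r3 b1 b2 b3 c1 c2 c3 where
    vars: "varX = r1 * lin a + const3 b1 * lin b + const3 c1 * lin c"
      "varY = r2 * lin a + const3 b2 * lin b + const3 c2 * lin c"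
      "varZ = r3 * lin a + const3 b3 * lin b + const3 c3 * lin c"
    unfolding var_lin using lin_cramer[OF c] by blast
  from step obtain p1 p2 p3 where deg: "degree p1 \<le> n" "degree p2 \<le> n" "degree p3 \<le> n"
    and dvd: "lin a dvd f1 - binary_form n p1 (lin b) (lin c)"
    "lin a dvd f2 - binary_form n p2 (lin b) (lin c)" "lin a dvd f3 - binary_form n p3 (lin b) (lin c)"
    by blast
  let ?q = "[:c1, b1:] * p1 + [:c2, b2:] * p2 + [:c3, b3:] * p3"
  have deg': "degree ([:y, x:] * p) \<le> Suc n" if "degree p \<le> n" for x y and p :: "complex poly"
    using degree_mult_le[of "[:y, x:]" p] that by (auto split: if_splits)
  have *: "lin a dvd (r * lin a + x) * f - x * g" if "lin a dvd f - g" for r x f g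
  proof -
    have "(r * lin a + x) * f - x * g = lin a * (r * f) + x * (f - g)" by (simp add: algebra_simps)
    then show ?thesis using that by simp
  qed
  have "lin a dvd (varX * f1 - (const3 b1 * lin b + const3 c1 * lin c) * binary_form n p1 (lin b) (lin c))
    + (varY * f2 - (const3 b2 * lin b + const3 c2 * lin c) * binary_form n p2 (lin b) (lin c))
    + (varZ * f3 - (const3 b3 * lin b + const3 c3 * lin c) * binary_form n p3 (lin b) (lin c))"
    using *[OF dvd(1)] *[OF dvd(2)] *[OF dvd(3)] unfolding vars add.assoc by (intro dvd_add)
  then have "lin a dvd varX * f1 + varY * f2 + varZ * f3 - binary_form (Suc n) ?q (lin b) (lin c)"
    by (simp only: binary_form_add binary_form_linear_mult deg) (simp add: algebra_simps)
  moreover have "degree ?q \<le> Suc n"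
    by (intro degree_add_le deg' deg)
  ultimately show ?case by blast
qed

text \<open>
  Restricted to a line, a form is a binary form in two linear coordinates of the line. Unless it
  vanishes there, it is a product of linear forms, each with exactly one zero on the line.
\<close>

lemma form_factor_mod_lin:
  assumes a: "a \<noteq> (0, 0, 0)" and w: "w \<in> forms n" and "\<not> lin a dvd w"
  obtains k vs where "k \<noteq> 0" "length vs = n" "\<And>v. v \<in> set vs \<Longrightarrow> cross a v \<noteq> (0, 0, 0)"
    "lin a dvd w - const3 k * (\<Prod>v\<leftarrow>vs. lin v)"
proof -
  obtain b where "cross a b \<noteq> (0, 0, 0)" using ex_cross_nonzero[OF a] by blast
  then obtain c where c: "dot c (cross a b) = 1" using ex_dot_1 by blast
  obtain p where p: "degree p \<le> n" "lin a dvd w - binary_form n p (lin b) (lin c)"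
    using form_binary_mod_lin[OF c w] by blast
  have "p \<noteq> 0" using p(2) assms(3) by (auto simp: binary_form_def const3_hom)
  then obtain k ps where ps: "k \<noteq> 0" "length ps = n" "(0, 0) \<notin> set ps"
    "binary_form n p (lin b) (lin c) = const3 k * (\<Prod>(\<alpha>, \<beta>)\<leftarrow>ps. const3 \<alpha> * lin b + const3 \<beta> * lin c)"
    using binary_form_factor[OF p(1)] by meson
  obtain b1 b2 b3 c1 c2 c3 where bc: "b = (b1, b2, b3)" "c = (c1, c2, c3)" by (metis prod.collapse)
  define comb where "comb = (\<lambda>(\<alpha>, \<beta>). (\<alpha> * b1 + \<beta> * c1, \<alpha> * b2 + \<beta> * c2, \<alpha> * b3 + \<beta> * c3))"
  have lin_comb: "lin (comb (\<alpha>, \<beta>)) = const3 \<alpha> * lin b + const3 \<beta> * lin c" for \<alpha> \<beta>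
    by (simp add: comb_def lin_def bc const3_hom algebra_simps)
  have cross_comb: "cross a (comb x) \<noteq> (0, 0, 0)" if "x \<noteq> (0, 0)" for x
  proof
    assume 0: "cross a (comb x) = (0, 0, 0)"
    obtain \<alpha> \<beta> where x: "x = (\<alpha>, \<beta>)" by (cases x)
    have "dot c (cross a (comb x)) = \<alpha> * dot c (cross a b)" "dot b (cross a (comb x)) = - \<beta> * dot c (cross a b)"
      by (cases a; simp add: x comb_def bc dot_def cross_def algebra_simps)+
    moreover have "dot u (0, 0, 0) = 0" for u by (cases u) (simp add: dot_def)
    ultimately show False using that c 0 unfolding x by simp
  qed
  show ?thesis
  proof (rule that[of k "map comb ps"])
    have "(\<Prod>(\<alpha>, \<beta>)\<leftarrow>ps. const3 \<alpha> * lin b + const3 \<beta> * lin c) = (\<Prod>v\<leftarrow>map comb ps. lin v)"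
      by (induction ps) (auto simp: lin_comb)
    then show "lin a dvd w - const3 k * (\<Prod>v\<leftarrow>map comb ps. lin v)"
      using p(2) ps(4) by simp
    show "cross a v \<noteq> (0, 0, 0)" if "v \<in> set (map comb ps)" for v
      using that cross_comb ps(3) by (metis imageE set_map)
  qed (use ps in auto)
qed

lemma eval_zero_of_dvd: "g dvd f \<Longrightarrow> eval3 g p = 0 \<Longrightarrow> eval3 f p = 0"
  by (cases p) (auto simp: eval_simps elim!: dvdE)

lemma eval_prod_list: "eval3 (\<Prod>x\<leftarrow>xs. F x) p = (\<Prod>x\<leftarrow>xs. eval3 (F x) p)"
  by (cases p; induction xs) (auto simp: eval_simps)

lemma form_has_zero:
  assumes "f \<in> forms n" "n > 0"
  shows "\<exists>p. p \<noteq> (0, 0, 0) \<and> eval3 f p = 0"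
proof (cases "lin (0, 0, 1) dvd f")
  case True
  then show ?thesis using eval_zero_of_dvd[of _ f "(1, 0, 0)"]
    by (intro exI[of _ "(1, 0, 0)"]) (auto simp: eval_lin dot_def)
next
  case False
  have "(0, 0, 1) \<noteq> (0, 0, 0 :: complex)" by simp
  from form_factor_mod_lin[OF this assms(1) False]
  obtain k vs where vs: "length vs = n" "\<And>v. v \<in> set vs \<Longrightarrow> cross (0, 0, 1) v \<noteq> (0, 0, 0)"
    "lin (0, 0, 1) dvd f - const3 k * (\<Prod>v\<leftarrow>vs. lin v)"
    by blast
  then obtain v where v: "v \<in> set vs" using assms(2) by (cases vs) auto
  let ?p = "cross (0, 0, 1) v"
  obtain x y z where p: "?p = (x, y, z)" by (metis prod.collapse)
  have "eval3 (f - const3 k * (\<Prod>v\<leftarrow>vs. lin v)) ?p = 0"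
    using vs(3) by (rule eval_zero_of_dvd) (simp add: eval_lin dot_cross_self)
  moreover have "eval3 (\<Prod>v\<leftarrow>vs. lin v) ?p = 0"
    unfolding eval_prod_list eval_lin using v dot_cross_self(2)[of v "(0, 0, 1)"]
    by (auto simp: prod_list_zero_iff intro!: image_eqI[of _ _ v])
  ultimately have "eval3 f ?p = 0" unfolding p by (simp add: eval_simps)
  then show ?thesis using vs(2)[OF v] by blast
qed


section \<open>Triples without common factor\<close>

definition coprime3 :: "'a::comm_semiring_1 \<Rightarrow> 'a \<Rightarrow> 'a \<Rightarrow> bool" where
  "coprime3 a b c \<longleftrightarrow> (\<forall>d. d dvd a \<longrightarrow> d dvd b \<longrightarrow> d dvd c \<longrightarrow> d dvd 1)"

definition gen3 :: "'a::comm_ring_1 \<Rightarrow> 'a \<Rightarrow> 'a \<Rightarrow> 'a set" where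
  "gen3 P Q R = {a * P + b * Q + c * R | a b c. True}"

lemma is_ideal_gen3: "is_ideal (gen3 P Q R)"
proof -
  have "gen3 P Q R = adjoin (gen2 P Q) R" by (auto simp: gen3_def gen2_def adjoin_def)
  then show ?thesis using is_ideal_adjoin is_ideal_gen2 by metis
qed

lemma gen3_gens: "P \<in> gen3 P Q R" "Q \<in> gen3 P Q R" "R \<in> gen3 P Q R"
proof -
  have "P = 1 * P + 0 * Q + 0 * R" "Q = 0 * P + 1 * Q + 0 * R" "R = 0 * P + 0 * Q + 1 * R" by simp_all
  then show "P \<in> gen3 P Q R" "Q \<in> gen3 P Q R" "R \<in> gen3 P Q R" unfolding gen3_def by blast+
qed

text \<open>
  The component of highest degree of a common factor divides each of the three forms, because leading
  coefficients multiply in \<open>S[t]\<close>. It is a form of positive degree, so it has a zero.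
\<close>

lemma common_zero_of_common_factor:
  assumes "P \<in> forms e" "Q \<in> forms e" "R \<in> forms e" "P \<noteq> 0 \<or> Q \<noteq> 0 \<or> R \<noteq> 0" "\<not> coprime3 P Q R"
  shows "\<exists>p. p \<noteq> (0, 0, 0) \<and> eval3 P p = 0 \<and> eval3 Q p = 0 \<and> eval3 R p = 0"
proof -
  obtain d where d: "d dvd P" "d dvd Q" "d dvd R" "\<not> d dvd 1"
    using assms(5) by (auto simp: coprime3_def)
  then have "d \<noteq> 0" using assms(4) by auto
  define g where "g = lead_coeff (grade d)"
  define n where "n = degree (grade d)"
  have "n > 0" using nonzero_constant_unit[OF degree_grade_0 \<open>d \<noteq> 0\<close>] d(4) by (auto simp: n_def)
  have g: "g \<in> forms n" by (simp add: g_def n_def hcomp_in_forms)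
  have gdvd: "g dvd F" if "d dvd F" "F \<in> forms e" for F
  proof -
    obtain q where "F = d * q" using \<open>d dvd F\<close> by (rule dvdE)
    then have "monom F e = grade d * grade q" using that(2) by (simp add: forms_iff_grade grade_hom)
    from arg_cong[OF this, of lead_coeff] have "lead_coeff (monom F e) = g * lead_coeff (grade q)"
      by (simp add: lead_coeff_mult g_def)
    then show ?thesis by (cases "F = 0") (auto simp: degree_monom_eq)
  qed
  obtain p where "p \<noteq> (0, 0, 0)" "eval3 g p = 0" using form_has_zero[OF g \<open>n > 0\<close>] by blast
  then show ?thesis using gdvd d assms(1-3) eval_zero_of_dvd by metis
qed

lemma prime_elem_divisor:
  fixes a :: "'a::factorial_semiring"
  assumes "a \<noteq> 0" "\<not> a dvd 1"
  obtains p where "prime_elem p" "p dvd a"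
  using prime_divisor_exists[OF assms] by (auto simp: prime_def)

text \<open>
  A prime \<open>\<pi>\<close> that divides all partial derivatives divides \<open>f\<close> by Euler's formula, say \<open>f = \<pi> h\<close>. As
  \<open>f\<close> is squarefree, the product rule makes \<open>\<pi>\<close> divide its own partial derivatives, which is
  impossible for degree reasons unless \<open>\<pi>\<close> is constant.
\<close>

lemma coprime3_partials:
  assumes f: "f \<in> forms d" "d > 0" "f \<noteq> 0" "squarefree f"
  shows "coprime3 (dx f) (dy f) (dz f)"
  unfolding coprime3_def
proof (intro allI impI, rule ccontr)
  fix D assume D: "D dvd dx f" "D dvd dy f" "D dvd dz f" "\<not> D dvd 1"
  have fE: "f = const3 (inverse (of_nat d)) * (varX * dx f + varY * dy f + varZ * dz f)"
    using f by (simp add: euler[OF f(1)] const3_inverse)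
  have "D \<noteq> 0"
  proof
    assume "D = 0"
    then show False using D fE f(3) by simp
  qed
  then obtain \<pi> where \<pi>: "prime_elem \<pi>" "\<pi> dvd D" using D(4) by (rule prime_elem_divisor)
  then have dvd: "\<pi> dvd dx f" "\<pi> dvd dy f" "\<pi> dvd dz f" using D by (metis dvd_trans)+
  have "\<pi> dvd f" by (subst fE) (intro dvd_mult dvd_add dvd)
  then obtain h where h: "f = \<pi> * h" by (rule dvdE)
  have nh: "\<not> \<pi> dvd h"
  proof
    assume "\<pi> dvd h"
    then have "\<pi> ^ 2 dvd f" by (auto simp: h power2_eq_square)
    then have "\<pi> dvd 1" using f(4) by (rule squarefreeD[rotated])
    then show False using \<pi>(1) by (auto simp: prime_elem_def)
  qed
  have *: "\<pi> dvd D \<pi>" if "deriv_op D" "\<pi> dvd D f" for D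
  proof -
    have "D f - \<pi> * D h = D \<pi> * h" by (simp add: h deriv_opD[OF that(1)])
    then have "\<pi> dvd D \<pi> * h" using that(2) by (metis dvd_diff dvd_triv_left)
    then show ?thesis using prime_elem_dvd_mult_iff[OF \<pi>(1)] nh by blast
  qed
  have "\<pi> \<noteq> 0" using \<pi>(1) by auto
  have zero: "pderiv p = 0" if "p dvd pderiv p" for p :: "'a::{idom,semiring_char_0} poly"
  proof (rule ccontr)
    assume "pderiv p \<noteq> 0"
    with that have "degree p \<le> degree (pderiv p)" by (rule dvd_imp_degree_le)
    then have "degree p = 0" by (simp add: degree_pderiv)
    then show False using \<open>pderiv p \<noteq> 0\<close> by (simp add: pderiv_eq_0_iff)
  qed
  have "pderiv \<pi> = 0" using *[OF deriv_op_dz dvd(3)] zero unfolding dz_def by blast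
  then obtain \<rho> where \<rho>: "\<pi> = [:\<rho>:]" by (metis pderiv_iszero)
  have "[:\<rho>:] dvd [:pderiv \<rho>:]" using *[OF deriv_op_dy dvd(2)] by (simp add: \<rho> dy_def map_poly_pCons)
  then have "pderiv \<rho> = 0" using zero by (simp add: const_poly_dvd_const_poly_iff)
  then obtain \<sigma> where \<sigma>: "\<rho> = [:\<sigma>:]" by (metis pderiv_iszero)
  have "[:[:\<sigma>:]:] dvd [:[:pderiv \<sigma>:]:]" using *[OF deriv_op_dx dvd(1)]
    by (simp add: \<rho> \<sigma> dx_def map_poly_pCons)
  then have "pderiv \<sigma> = 0" using zero by (simp add: const_poly_dvd_const_poly_iff)
  then obtain c where "\<sigma> = [:c:]" by (metis pderiv_iszero)
  then have "\<pi> = const3 c" by (simp add: \<rho> \<sigma> const3_def)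
  then have "\<pi> dvd 1" using nonzero_constant_unit[of \<pi>] \<open>\<pi> \<noteq> 0\<close> by (simp add: forms_const3)
  then show False using \<pi>(1) by (auto simp: prime_elem_def)
qed

text \<open>
  If for instance \<open>P\<close> is nonzero, it divides \<open>a P\<close>, \<open>a Q\<close> and \<open>a R\<close>, hence \<open>a\<close> times their greatest
  common divisor.
\<close>

lemma coprime3_proportional:
  fixes P Q R a b c :: "'a::semiring_gcd"
  assumes cop: "coprime3 P Q R" and eq: "P * b = Q * a" "P * c = R * a" "Q * c = R * b"
  shows "\<exists>h. a = h * P \<and> b = h * Q \<and> c = h * R"
proof -
  have dvd: "X dvd a" if "X dvd a * P" "X dvd a * Q" "X dvd a * R" for X a :: 'a
  proof -
    have "gcd (gcd P Q) R dvd 1" using cop unfolding coprime3_def by (meson dvd_trans gcd_dvd1 gcd_dvd2)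
    have "X dvd a * gcd P Q" using gcd_greatest[OF that(1,2)] by (simp add: gcd_mult_left)
    from gcd_greatest[OF this that(3)] have "X dvd a * gcd (gcd P Q) R" by (simp add: gcd_mult_left)
    then show ?thesis using \<open>gcd (gcd P Q) R dvd 1\<close> by (simp add: dvd_mult_unit_iff)
  qed
  have "P \<noteq> 0 \<or> Q \<noteq> 0 \<or> R \<noteq> 0" using cop unfolding coprime3_def by (metis dvd_0_right not_is_unit_0)
  then consider "P \<noteq> 0" | "Q \<noteq> 0" | "R \<noteq> 0" by blast
  then show ?thesis
  proof cases
    case 1
    have "P dvd a * P" "P dvd a * Q" "P dvd a * R" using eq by (metis dvd_triv_left dvd_triv_right mult.commute)+
    then obtain h where h: "a = P * h" using dvd by blast
    then have "P * b = P * (h * Q)" "P * c = P * (h * R)" using eq by (simp_all add: ac_simps)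
    then show ?thesis using 1 h by (intro exI[of _ h]) (simp add: mult.commute)
  next
    case 2
    have "Q dvd b * P" "Q dvd b * Q" "Q dvd b * R" using eq by (metis dvd_triv_left dvd_triv_right mult.commute)+
    then obtain h where h: "b = Q * h" using dvd by blast
    then have "Q * a = Q * (h * P)" "Q * c = Q * (h * R)" using eq by (simp_all add: ac_simps)
    then show ?thesis using 2 h by (intro exI[of _ h]) (simp add: mult.commute)
  next
    case 3
    have "R dvd c * P" "R dvd c * Q" "R dvd c * R" using eq by (metis dvd_triv_left dvd_triv_right mult.commute)+
    then obtain h where h: "c = R * h" using dvd by blast
    then have "R * a = R * (h * P)" "R * b = R * (h * Q)" using eq by (simp_all add: ac_simps)
    then show ?thesis using 3 h by (intro exI[of _ h]) (simp add: mult.commute)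
  qed
qed

section \<open>A projective Nullstellensatz\<close>

lemma prime_factor_pos_degree:
  fixes g :: "'a::{factorial_ring_gcd,semiring_gcd_mult_normalize} poly"
  shows "g \<noteq> 0 \<Longrightarrow> degree g > 0 \<Longrightarrow> \<exists>\<pi>. prime_elem \<pi> \<and> \<pi> dvd g \<and> degree \<pi> > 0"
proof (induction g rule: prime_divisors_induct)
  case (unit x)
  then show ?case by (auto simp: is_unit_iff_degree is_unit_poly_iff)
next
  case (factor p x)
  then have "p \<noteq> 0" "x \<noteq> 0" by auto
  then have "degree (p * x) = degree p + degree x" by (rule degree_mult_eq)
  then consider "degree p > 0" | "degree x > 0" using factor by linarith
  then show ?case
  proof cases
    case 1
    then show ?thesis using factor by (intro exI[of _ p]) (auto simp: prime_def)
  next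
    case 2
    then show ?thesis using factor.IH \<open>x \<noteq> 0\<close> dvd_mult by blast
  qed
qed simp

text \<open>
  Gauss's lemma in the form of a minimal degree argument. An element \<open>g\<close> of least degree in the ideal
  divides every element up to a nonzero constant factor, by pseudo-division. A prime factor of \<open>g\<close> of
  positive degree cannot divide these constants, so it would divide the three generators.
\<close>

lemma elimination:
  fixes P Q R :: "'a::{factorial_ring_gcd,semiring_gcd_mult_normalize} poly"
  assumes cop: "coprime3 P Q R"
  shows "\<exists>r. r \<noteq> 0 \<and> [:r:] \<in> gen3 P Q R"
proof -
  let ?I = "gen3 P Q R"
  have "\<not> (0::'a poly) dvd 1" by simp
  then have "P \<noteq> 0 \<or> Q \<noteq> 0 \<or> R \<noteq> 0" using cop unfolding coprime3_def by (metis dvd_0_right)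
  then have "\<exists>g. g \<in> ?I \<and> g \<noteq> 0" using gen3_gens[where P = P and Q = Q and R = R]  by blast
  then obtain g where g: "g \<in> ?I" "g \<noteq> 0" and min: "\<And>h. h \<in> ?I \<Longrightarrow> h \<noteq> 0 \<Longrightarrow> degree g \<le> degree h"
    using ex_has_least_nat[of "\<lambda>g. g \<in> ?I \<and> g \<noteq> 0" _ degree] by blast
  have div: "\<exists>a. a \<noteq> 0 \<and> g dvd smult a F" if "F \<in> ?I" for F
  proof -
    obtain a q where aq: "a \<noteq> 0" "smult a F = g * q + pseudo_mod F g"
      and deg: "pseudo_mod F g = 0 \<or> degree (pseudo_mod F g) < degree g"
      using pseudo_mod[OF g(2), of F] by blast
    have "pseudo_mod F g = [:a:] * F - q * g" using aq(2) by (simp add: algebra_simps)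
    then have "pseudo_mod F g \<in> ?I" using is_idealD[OF is_ideal_gen3] g(1) that by metis
    then have "pseudo_mod F g = 0" using min deg by fastforce
    then show ?thesis using aq by auto
  qed
  have "degree g = 0"
  proof (rule ccontr)
    assume "degree g \<noteq> 0"
    then obtain \<pi> where \<pi>: "prime_elem \<pi>" "\<pi> dvd g" "degree \<pi> > 0"
      using prime_factor_pos_degree[OF g(2)] by auto
    have "\<pi> dvd F" if F: "F \<in> ?I" for F
    proof -
      obtain a where a: "a \<noteq> 0" "g dvd smult a F" using div[OF F] by blast
      then have "\<pi> dvd [:a:] * F" using \<pi>(2) dvd_trans by auto
      moreover have "\<not> \<pi> dvd [:a:]" using \<pi>(3) a(1) dvd_imp_degree_le[of \<pi> "[:a:]"] by auto
      ultimately show ?thesis using prime_elem_dvd_mult_iff[OF \<pi>(1)] by blast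
    qed
    then have "\<pi> dvd 1" using cop gen3_gens[where P = P and Q = Q and R = R] by (auto simp: coprime3_def)
    then show False using \<pi>(1) by (auto simp: prime_elem_def)
  qed
  then show ?thesis using g by (metis degree_eq_zeroE pCons_0_0)
qed

lemma hcomp_gen3:
  assumes "P \<in> forms e" "Q \<in> forms e" "R \<in> forms e" "g \<in> gen3 P Q R"
  shows "hcomp n g \<in> gen3 P Q R"
proof -
  obtain a b c where g: "g = a * P + b * Q + c * R" using assms(4) by (auto simp: gen3_def)
  have "hcomp n g = (if n < e then 0 else hcomp (n - e) a * P + hcomp (n - e) b * Q + hcomp (n - e) c * R)"
    using assms by (simp add: g grade_hom(3) hcomp_mult_form)
  then show ?thesis using is_idealD(1)[OF is_ideal_gen3, of P Q R] by (auto simp: gen3_def)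
qed

text \<open>
  Elimination of \<open>z\<close> yields a nonzero element of \<open>\<complex>[x,y]\<close> in the ideal. One of its homogeneous components
  is a nonzero binary form, and binary forms split into linear factors.
\<close>

lemma elimination_form:
  assumes "P \<in> forms e" "Q \<in> forms e" "R \<in> forms e" and cop: "coprime3 P Q R"
  shows "\<exists>k vs. k \<noteq> 0 \<and> (0, 0, 0) \<notin> set vs \<and> const3 k * (\<Prod>v\<leftarrow>vs. lin v) \<in> gen3 P Q R"
proof -
  obtain r where r: "r \<noteq> 0" "[:r:] \<in> gen3 P Q R" using elimination[OF cop] by blast
  obtain n where n: "hcomp n [:r:] \<noteq> 0"
  proof (rule ccontr)
    assume "\<not> thesis"
    then have "hcomp n [:r:] = 0" for n using that by blast
    then have "[:r:] = 0" using sum_hcomp[of "[:r:]"] by simp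
    then show False using r(1) by simp
  qed
  define w where "w = hcomp n [:r:]"
  have w: "w \<in> forms n" "w \<noteq> 0" "w \<in> gen3 P Q R"
    using n r hcomp_in_forms hcomp_gen3[OF assms(1-3)] by (auto simp: w_def)
  \<comment> \<open>Setting \<open>z = 0\<close> fixes \<open>w\<close> and turns its factorisation modulo \<open>z\<close> into an equation.\<close>
  define z0 :: "ternary \<Rightarrow> ternary" where "z0 f = [:coeff f 0:]" for f
  have z0_w: "z0 w = w"
    unfolding z0_def by (rule coeff3_eqI) (auto simp: w_def coeff3_hcomp coeff_pCons split: nat.splits)
  have hom: "unital_hom z0"
    by (auto simp: unital_hom_def z0_def coeff_mult one_pCons)
  have z0_lin: "z0 (lin (x, y, z)) = lin (x, y, 0)" for x y z
    by (simp add: z0_def lin_def const3_def varX_def varY_def varZ_def)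
  have "\<not> lin (0, 0, 1) dvd w"
  proof
    assume "lin (0, 0, 1) dvd w"
    then obtain q where "w = lin (0, 0, 1) * q" by (rule dvdE)
    then have "z0 w = lin (0, 0, 0) * z0 q" by (simp add: unital_homD[OF hom] z0_lin)
    then show False using z0_w w(2) by simp
  qed
  from form_factor_mod_lin[OF _ w(1) this] obtain k vs where vs: "k \<noteq> 0"
    "\<And>v. v \<in> set vs \<Longrightarrow> cross (0, 0, 1) v \<noteq> (0, 0, 0)" "lin (0, 0, 1) dvd w - const3 k * (\<Prod>v\<leftarrow>vs. lin v)"
    by (metis prod.inject zero_neq_one)
  define pr :: "vec3 \<Rightarrow> vec3" where "pr = (\<lambda>(x, y, z). (x, y, 0))"
  obtain q where "w - const3 k * (\<Prod>v\<leftarrow>vs. lin v) = lin (0, 0, 1) * q" using vs(3) by (rule dvdE)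
  then have "z0 (w - const3 k * (\<Prod>v\<leftarrow>vs. lin v)) = 0"
    by (simp add: unital_homD[OF hom] z0_lin)
  moreover have "z0 (\<Prod>v\<leftarrow>vs. lin v) = (\<Prod>v\<leftarrow>map pr vs. lin v)"
    by (induction vs) (auto simp: unital_homD[OF hom] z0_lin pr_def)
  moreover have "z0 (const3 k) = const3 k" by (simp add: z0_def const3_def)
  ultimately have "w = const3 k * (\<Prod>v\<leftarrow>map pr vs. lin v)"
    by (simp add: unital_homD[OF hom] z0_w)
  moreover have "(0, 0, 0) \<notin> set (map pr vs)"
  proof
    assume "(0, 0, 0) \<in> set (map pr vs)"
    then obtain z where "(0, 0, z) \<in> set vs" by (auto simp: pr_def)
    from vs(2)[OF this] show False by (simp add: cross_def)
  qed
  ultimately show ?thesis using vs(1) w(3) by blast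
qed

lemma ideal_radical_adjoin_const:
  assumes "is_ideal J" "k \<noteq> 0"
  shows "h \<in> ideal_radical (adjoin J (const3 k))"
proof -
  have "const3 (inverse k) * (const3 k * h) \<in> adjoin J (const3 k)"
    using assms by (intro is_idealD(3,4) is_ideal_adjoin adjoin_self)
  then have "h ^ 1 \<in> adjoin J (const3 k)" using assms(2) by (simp add: const3_inverse)
  then show ?thesis unfolding ideal_radical_def by blast
qed

text \<open>
  By \<open>elimination_form\<close> and \<open>ideal_radical_adjoin_prod_list\<close> it suffices to prove the claim after adding
  a linear form \<open>lin a\<close> to the ideal. One of the generators does not vanish on this line, and its
  factorisation there reduces the claim to the ideals \<open>I + (lin a, lin b)\<close> of points.
\<close>

lemma nullstellensatz:
  assumes F: "P \<in> forms e" "Q \<in> forms e" "R \<in> forms e" and cop: "coprime3 P Q R"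
    and h: "h \<in> forms m" "m > 0"
    and van: "\<And>p. p \<noteq> (0, 0, 0) \<Longrightarrow> eval3 P p = 0 \<Longrightarrow> eval3 Q p = 0 \<Longrightarrow> eval3 R p = 0 \<Longrightarrow> eval3 h p = 0"
  shows "h \<in> ideal_radical (gen3 P Q R)"
proof -
  let ?I = "gen3 P Q R"
  \<comment> \<open>If \<open>h\<close> does not vanish at the point, neither does some generator \<open>G\<close>; powers of \<open>h\<close> and \<open>G\<close>
      of equal degree are proportional modulo the ideal of the point.\<close>
  have point: "h \<in> ideal_radical (adjoin (adjoin ?I (lin a)) (lin b))" (is "h \<in> ideal_radical ?J")
    if ab: "cross a b \<noteq> (0, 0, 0)" for a b
  proof -
    obtain q1 q2 q3 where q: "cross a b = (q1, q2, q3)" by (metis prod.collapse)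
    have J: "is_ideal ?J" by (intro is_ideal_adjoin is_ideal_gen3)
    have "lin a \<in> ?J" "lin b \<in> ?J"
      by (auto intro: adjoin_superset adjoin_self is_ideal_adjoin is_ideal_gen3)
    then have gen: "gen2 (lin a) (lin b) \<subseteq> ?J"
      unfolding gen2_def by (auto intro!: is_idealD(2,3)[OF J])
    show ?thesis
    proof (cases "eval3 h (cross a b) = 0")
      case True
      then have "h ^ 1 \<in> ?J" using form_vanishes_gen2[OF ab h(1)] gen by auto
      then show ?thesis unfolding ideal_radical_def by blast
    next
      case False
      then obtain G where G: "G \<in> {P, Q, R}" "eval3 G (cross a b) \<noteq> 0" using van[OF ab] by auto
      then have "G \<in> forms e" "G \<in> ?I" using F gen3_gens[where P = P and Q = Q and R = R] by auto
      then have "G \<in> ?J" by (simp add: adjoin_superset)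
      define x y where "x = eval3 G (cross a b)" and "y = eval3 h (cross a b)"
      have "const3 (x ^ m) * h ^ e - const3 (y ^ e) * G ^ m \<in> forms (m * e)"
        using forms_power[OF h(1), of e] forms_power[OF \<open>G \<in> forms e\<close>, of m]
        by (intro forms_diff forms_cmult) (simp_all add: mult.commute)
      moreover have "eval3 (const3 (x ^ m) * h ^ e - const3 (y ^ e) * G ^ m) (cross a b) = 0"
        by (simp add: q eval_simps) (simp add: x_def y_def q)
      ultimately have in_J: "const3 (x ^ m) * h ^ e - const3 (y ^ e) * G ^ m \<in> ?J"
        using form_vanishes_gen2[OF ab] gen by blast
        have "const3 (y ^ e) * G ^ m = (const3 (y ^ e) * G ^ (m - 1)) * G"
          using h(2) by (cases m) simp_all
        then have "const3 (y ^ e) * G ^ m \<in> ?J" using is_idealD(3)[OF J \<open>G \<in> ?J\<close>] by metis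
        then have "const3 (x ^ m) * h ^ e \<in> ?J" using in_J is_idealD(2)[OF J] by (metis diff_add_cancel)
        then have "const3 (inverse (x ^ m)) * (const3 (x ^ m) * h ^ e) \<in> ?J" by (rule is_idealD(3)[OF J])
        then have "h ^ e \<in> ?J" using G(2) by (simp add: const3_inverse x_def)
        then show ?thesis by (auto simp: ideal_radical_def)
    qed
  qed
  have line: "h \<in> ideal_radical (adjoin ?I (lin a))" if a: "a \<noteq> (0, 0, 0)" for a
  proof -
    let ?J = "adjoin ?I (lin a)"
    have J: "is_ideal ?J" by (intro is_ideal_adjoin is_ideal_gen3)
    have "\<not> lin a dvd 1" using prime_lin[OF a] by (auto simp: prime_elem_def)
    then obtain G where G: "G \<in> {P, Q, R}" "\<not> lin a dvd G" using cop by (auto simp: coprime3_def)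
    then have "G \<in> forms e" "G \<in> ?J" using F gen3_gens[where P = P and Q = Q and R = R] by (auto intro: adjoin_superset)
    from form_factor_mod_lin[OF a this(1) G(2)] obtain k vs where vs: "k \<noteq> 0"
      "\<And>v. v \<in> set vs \<Longrightarrow> cross a v \<noteq> (0, 0, 0)" "lin a dvd G - const3 k * (\<Prod>v\<leftarrow>vs. lin v)" by metis
    have k: "h \<in> ideal_radical (adjoin ?J (const3 k))" by (rule ideal_radical_adjoin_const[OF J vs(1)])
    have "h \<in> ideal_radical (adjoin ?J (const3 k * (\<Prod>v\<leftarrow>vs. lin v)))"
      using point vs(2) by (intro ideal_radical_adjoin_prod_list J k) auto
    moreover have "const3 k * (\<Prod>v\<leftarrow>vs. lin v) \<in> ?J"
    proof -
      obtain q where "G - const3 k * (\<Prod>v\<leftarrow>vs. lin v) = lin a * q" using vs(3) by (rule dvdE)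
      then have "const3 k * (\<Prod>v\<leftarrow>vs. lin v) = G - lin a * q" by (simp add: algebra_simps)
      then show ?thesis using \<open>G \<in> ?J\<close> adjoin_self[OF is_ideal_gen3] is_idealD[OF J] by metis
    qed
    ultimately show ?thesis using adjoin_absorb[OF J] by simp
  qed
  obtain k vs where vs: "k \<noteq> 0" "(0, 0, 0) \<notin> set vs" "const3 k * (\<Prod>v\<leftarrow>vs. lin v) \<in> ?I"
    using elimination_form[OF F cop] by blast
  have k: "h \<in> ideal_radical (adjoin ?I (const3 k))"
    by (rule ideal_radical_adjoin_const[OF is_ideal_gen3 vs(1)])
  have "h \<in> ideal_radical (adjoin ?I (const3 k * (\<Prod>v\<leftarrow>vs. lin v)))"
    by (rule ideal_radical_adjoin_prod_list[OF is_ideal_gen3 k], rule line) (use vs(2) in metis)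
  then show ?thesis using adjoin_absorb[OF is_ideal_gen3 vs(3)] by simp
qed


section \<open>Koszul relations\<close>

text \<open>
  The Koszul relations of an arbitrary triple: the cross products of \<open>(P, Q, R)\<close> with \<open>(w, -v, u)\<close>.
\<close>

definition kos :: "ternary \<Rightarrow> ternary \<Rightarrow> ternary \<Rightarrow> (ternary \<times> ternary \<times> ternary) set" where
  "kos P Q R = {(u * Q + v * R, - u * P + w * R, - v * P - w * Q) | u v w. True}"

lemma kosI: "x = u * Q + v * R \<Longrightarrow> y = - u * P + w * R \<Longrightarrow> z = - v * P - w * Q \<Longrightarrow> (x, y, z) \<in> kos P Q R"
  by (auto simp: kos_def)

lemma kosE:
  assumes "(x, y, z) \<in> kos P Q R"
  obtains u v w where "x = u * Q + v * R" "y = - u * P + w * R" "z = - v * P - w * Q"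
  using assms by (auto simp: kos_def)

lemma kos_0: "(0, 0, 0) \<in> kos P Q R"
  by (rule kosI[of _ 0 _ 0 _ _ _ 0]) auto

lemma kos_add:
  assumes "(x, y, z) \<in> kos P Q R" "(x', y', z') \<in> kos P Q R"
  shows "(x + x', y + y', z + z') \<in> kos P Q R"
proof -
  obtain u v w where *: "x = u * Q + v * R" "y = - u * P + w * R" "z = - v * P - w * Q"
    using assms(1) by (rule kosE)
  obtain u' v' w' where **: "x' = u' * Q + v' * R" "y' = - u' * P + w' * R" "z' = - v' * P - w' * Q"
    using assms(2) by (rule kosE)
  show ?thesis unfolding * **
    by (intro kosI[of _ "u + u'" _ "v + v'" _ _ _ "w + w'"]) (simp_all add: algebra_simps)
qed

lemma kos_mult:
  assumes "(x, y, z) \<in> kos P Q R"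
  shows "(g * x, g * y, g * z) \<in> kos P Q R"
proof -
  obtain u v w where *: "x = u * Q + v * R" "y = - u * P + w * R" "z = - v * P - w * Q"
    using assms(1) by (rule kosE)
  show ?thesis unfolding *
    by (intro kosI[of _ "g * u" _ "g * v" _ _ _ "g * w"]) (simp_all add: algebra_simps)
qed

definition colon :: "ternary \<Rightarrow> ternary \<Rightarrow> ternary \<Rightarrow> ternary \<Rightarrow> ternary \<Rightarrow> ternary \<Rightarrow> ternary set" where
  "colon P Q R x y z = {g. (g * x, g * y, g * z) \<in> kos P Q R}"

lemma is_ideal_colon: "is_ideal (colon P Q R x y z)"
  unfolding is_ideal_def colon_def
  using kos_0 kos_add kos_mult by (auto simp: distrib_right mult.assoc)

text \<open>
  The ideal annihilates the Koszul homology: \<open>P\<close> times a syzygy is Koszul with coefficients taken from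
  the syzygy itself, and likewise for \<open>Q\<close> and \<open>R\<close>.
\<close>

lemma gen3_subset_colon:
  assumes "x * P + y * Q + z * R = 0"
  shows "gen3 P Q R \<subseteq> colon P Q R x y z"
proof -
  have "P * x = (x * P + y * Q + z * R) - y * Q - z * R" "Q * y = (x * P + y * Q + z * R) - x * P - z * R"
    "R * z = (x * P + y * Q + z * R) - x * P - y * Q" by (simp_all add: mult.commute)
  then have px: "P * x = - (y * Q) - z * R" and qy: "Q * y = - (x * P) - z * R" and rz: "R * z = - (x * P) - y * Q"
    unfolding assms by simp_all
  have "(P * x, P * y, P * z) \<in> kos P Q R"
    by (rule kosI[of _ "- y" _ "- z" _ _ _ 0]) (simp_all add: px mult.commute[of P y] mult.commute[of P z])
  moreover have "(Q * x, Q * y, Q * z) \<in> kos P Q R"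
    by (rule kosI[of _ x _ 0 _ _ _ "- z"]) (simp_all add: qy mult.commute[of Q x] mult.commute[of Q z])
  moreover have "(R * x, R * y, R * z) \<in> kos P Q R"
    by (rule kosI[of _ 0 _ x _ _ _ y]) (simp_all add: rz mult.commute[of R x] mult.commute[of R y])
  ultimately have "P \<in> colon P Q R x y z" "Q \<in> colon P Q R x y z" "R \<in> colon P Q R x y z"
    by (simp_all add: colon_def)
  then show ?thesis
    unfolding gen3_def by (auto intro!: is_idealD(2,3)[OF is_ideal_colon])
qed

lemma kos_kernel:
  fixes P Q R u v w :: ternary
  assumes cop: "coprime3 P Q R" and "u * Q + v * R = 0" "- u * P + w * R = 0" "- v * P - w * Q = 0"
  shows "\<exists>h. u = h * R \<and> v = - h * Q \<and> w = h * P"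
proof -
  have "P * (- v) - Q * w = - v * P - w * Q" "P * u - R * w = - (- u * P + w * R)"
    "Q * u - R * (- v) = u * Q + v * R" by (simp_all add: mult.commute)
  then have "P * (- v) = Q * w" "P * u = R * w" "Q * u = R * (- v)"
    unfolding assms(2-4) by (simp_all add: eq_neg_iff_add_eq_0)
  from coprime3_proportional[OF cop this] obtain h where "w = h * P" "- v = h * Q" "u = h * R" by blast
  then show ?thesis by (intro exI[of _ h]) (simp add: minus_equation_iff[of v])
qed

lemma lin_cancel:
  assumes ab: "cross a b \<noteq> (0, 0, 0)" and "lin b * u = lin a * u'"
  shows "lin a dvd u"
proof -
  have "a \<noteq> (0, 0, 0)" using ab by (auto simp: cross_def split: prod.splits)
  then have "prime_elem (lin a)" by (rule prime_lin)
  moreover have "\<not> lin a dvd lin b" using lin_dvd_lin ab by blast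
  moreover have "lin a dvd lin b * u" using assms(2) by simp
  ultimately show ?thesis using prime_elem_dvd_mult_iff by blast
qed

text \<open>
  If \<open>la\<close> and \<open>lb\<close> both carry \<open>\<sigma> = (x, y, z)\<close> into the Koszul relations, the two resulting coefficient
  vectors, multiplied crosswise by \<open>lb\<close> and \<open>la\<close>, differ by an element of the kernel. The polynomial
  \<open>h\<close> is the obstruction to dividing by \<open>la\<close>.
\<close>

lemma kos_compare:
  fixes P Q R la lb x y z :: ternary
  assumes cop: "coprime3 P Q R"
    and s: "la * x = u * Q + v * R" "la * y = - u * P + w * R" "la * z = - v * P - w * Q"
    and s': "lb * x = u' * Q + v' * R" "lb * y = - u' * P + w' * R" "lb * z = - v' * P - w' * Q"
  shows "\<exists>h. lb * u - la * u' = h * R \<and> lb * v - la * v' = - h * Q \<and> lb * w - la * w' = h * P"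
proof (rule kos_kernel[OF cop])
  have "lb * (la * x) - la * (lb * x) = 0" by (simp add: ac_simps)
  then show "(lb * u - la * u') * Q + (lb * v - la * v') * R = 0"
    unfolding s s' by (simp add: algebra_simps)
  have "lb * (la * y) - la * (lb * y) = 0" by (simp add: ac_simps)
  then show "- (lb * u - la * u') * P + (lb * w - la * w') * R = 0"
    unfolding s s' by (simp add: algebra_simps)
  have "lb * (la * z) - la * (lb * z) = 0" by (simp add: ac_simps)
  then show "- (lb * v - la * v') * P - (lb * w - la * w') * Q = 0"
    unfolding s s' by (simp add: algebra_simps)
qed

text \<open>
  When \<open>h\<close> lies in the ideal of the point \<open>a \<times> b\<close>, changing the coefficients \<open>u\<close>, \<open>v\<close>, \<open>w\<close> by a
  multiple of the kernel makes them divisible by \<open>lin a\<close>.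
\<close>

lemma kos_divide:
  assumes ab: "cross a b \<noteq> (0, 0, 0)"
    and s: "lin a * x = u * Q + v * R" "lin a * y = - u * P + w * R" "lin a * z = - v * P - w * Q"
    and h: "h = r * lin a + s * lin b"
      "lin b * u - lin a * u' = h * R" "lin b * v - lin a * v' = - h * Q" "lin b * w - lin a * w' = h * P"
  shows "(x, y, z) \<in> kos P Q R"
proof -
  have "lin b * (u - s * R) = lin a * (u' + r * R)" "lin b * (v + s * Q) = lin a * (v' - r * Q)"
    "lin b * (w - s * P) = lin a * (w' + r * P)" using h by (simp_all add: algebra_simps)
  then have "lin a dvd u - s * R" "lin a dvd v + s * Q" "lin a dvd w - s * P" using lin_cancel[OF ab] by blast+
  then obtain u1 v1 w1 where "u - s * R = lin a * u1" "v + s * Q = lin a * v1" "w - s * P = lin a * w1"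
    by (elim dvdE)
  then have eq: "u = lin a * u1 + s * R" "v = lin a * v1 - s * Q" "w = lin a * w1 + s * P"
    by (simp_all add: algebra_simps)
  have "a \<noteq> (0, 0, 0)" using ab by (auto simp: cross_def split: prod.splits)
  then have nz: "lin a \<noteq> 0" by simp
  have "lin a * x = lin a * (u1 * Q + v1 * R)" "lin a * y = lin a * (- u1 * P + w1 * R)"
    "lin a * z = lin a * (- v1 * P - w1 * Q)" unfolding s eq by (simp_all add: algebra_simps)
  then have "x = u1 * Q + v1 * R" "y = - u1 * P + w1 * R" "z = - v1 * P - w1 * Q"
    using nz by (simp_all only: mult_cancel_left) auto
  then show ?thesis by (rule kosI)
qed

lemma eval_hcomp_gen2:
  assumes "f \<in> gen2 (lin a) (lin b)"
  shows "eval3 (hcomp n f) (cross a b) = 0"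
proof -
  obtain r s where f: "f = r * lin a + s * lin b" using assms by (auto simp: gen2_def)
  obtain p1 p2 p3 where p: "cross a b = (p1, p2, p3)" by (metis prod.collapse)
  have "eval3 (lin a) (p1, p2, p3) = 0" "eval3 (lin b) (p1, p2, p3) = 0"
    unfolding p[symmetric] eval_lin by (rule dot_cross_self)+
  then show ?thesis
    by (simp add: f grade_hom(3) hcomp_mult_form[OF lin_form] p eval_simps)
qed

text \<open>
  The crosswise differences show that \<open>h P\<close>, \<open>h Q\<close> and \<open>h R\<close> lie in the ideal of the point \<open>a \<times> b\<close>. As
  one of \<open>P\<close>, \<open>Q\<close>, \<open>R\<close> does not vanish there, all homogeneous components of \<open>h\<close> lie in it, and
  \<open>kos_divide\<close> applies.
\<close>

lemma kos_saturated:
  assumes F: "P \<in> forms e" "Q \<in> forms e" "R \<in> forms e" and cop: "coprime3 P Q R"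
    and ab: "cross a b \<noteq> (0, 0, 0)"
    and nv: "eval3 P (cross a b) \<noteq> 0 \<or> eval3 Q (cross a b) \<noteq> 0 \<or> eval3 R (cross a b) \<noteq> 0"
    and s: "lin a \<in> colon P Q R x y z" "lin b \<in> colon P Q R x y z"
  shows "(x, y, z) \<in> kos P Q R"
proof -
  obtain u v w where s1: "lin a * x = u * Q + v * R" "lin a * y = - u * P + w * R" "lin a * z = - v * P - w * Q"
    using s(1) unfolding colon_def mem_Collect_eq by (rule kosE)
  obtain u' v' w' where s2: "lin b * x = u' * Q + v' * R" "lin b * y = - u' * P + w' * R" "lin b * z = - v' * P - w' * Q"
    using s(2) unfolding colon_def mem_Collect_eq by (rule kosE)
  obtain h where h: "lin b * u - lin a * u' = h * R" "lin b * v - lin a * v' = - h * Q" "lin b * w - lin a * w' = h * P"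
    using kos_compare[OF cop s1 s2] by blast
  have g2: "lin b * X - lin a * Y \<in> gen2 (lin a) (lin b)" for X Y
    unfolding gen2_def by (intro CollectI exI[of _ "- Y"] exI[of _ X]) (simp add: algebra_simps)
  have "h * R \<in> gen2 (lin a) (lin b)" "h * P \<in> gen2 (lin a) (lin b)" "- (h * Q) \<in> gen2 (lin a) (lin b)"
    using g2[of u u'] g2[of v v'] g2[of w w'] unfolding h by simp_all
  then have hF: "h * R \<in> gen2 (lin a) (lin b)" "h * P \<in> gen2 (lin a) (lin b)" "h * Q \<in> gen2 (lin a) (lin b)"
    using is_idealD(5)[OF is_ideal_gen2, of "- (h * Q)" "lin a" "lin b"] by simp_all
  obtain G where G: "G \<in> forms e" "eval3 G (cross a b) \<noteq> 0" "h * G \<in> gen2 (lin a) (lin b)"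
    using nv F hF by blast
  have "hcomp n h \<in> gen2 (lin a) (lin b)" for n
  proof (rule form_vanishes_gen2[OF ab hcomp_in_forms])
    obtain p1 p2 p3 where p: "cross a b = (p1, p2, p3)" by (metis prod.collapse)
    have "eval3 (hcomp (n + e) (h * G)) (cross a b) = 0" by (rule eval_hcomp_gen2[OF G(3)])
    also have "hcomp (n + e) (h * G) = hcomp n h * G" by (simp add: hcomp_mult_form[OF G(1)])
    finally show "eval3 (hcomp n h) (cross a b) = 0" using G(2) by (simp add: p eval_simps)
  qed
  then have "(\<Sum>n\<le>degree (grade h). hcomp n h) \<in> gen2 (lin a) (lin b)" by (intro ideal_sum is_ideal_gen2)
  then obtain r s where "h = r * lin a + s * lin b" unfolding sum_hcomp[symmetric] by (auto simp: gen2_def)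
  then show ?thesis using kos_divide[OF ab s1 _ h] by blast
qed

lemma kos_saturated_radical:
  assumes F: "P \<in> forms e" "Q \<in> forms e" "R \<in> forms e" and cop: "coprime3 P Q R"
    and ab: "cross a b \<noteq> (0, 0, 0)"
    and nv: "eval3 P (cross a b) \<noteq> 0 \<or> eval3 Q (cross a b) \<noteq> 0 \<or> eval3 R (cross a b) \<noteq> 0"
    and s: "lin a \<in> ideal_radical (colon P Q R x y z)" "lin b \<in> ideal_radical (colon P Q R x y z)"
  shows "(x, y, z) \<in> kos P Q R"
proof -
  have "(x, y, z) \<in> kos P Q R"
    if "lin a ^ m \<in> colon P Q R x y z" "lin b ^ n \<in> colon P Q R x y z" for m n x y z
    using that
  proof (induction "m + n" arbitrary: m n x y z rule: less_induct)
    case less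
    show ?case
    proof (cases "m = 0 \<or> n = 0")
      case True
      then show ?thesis using less.prems by (auto simp: colon_def)
    next
      case False
      then obtain m' n' where mn: "m = Suc m'" "n = Suc n'" by (metis not0_implies_Suc)
      have shift: "g \<in> colon P Q R (l * x) (l * y) (l * z) \<longleftrightarrow> g * l \<in> colon P Q R x y z" for g l
        by (simp add: colon_def mult.assoc)
      have "(lin a * x, lin a * y, lin a * z) \<in> kos P Q R"
        using less.hyps[of m' n "lin a * x" "lin a * y" "lin a * z"] less.prems
        by (simp add: mn shift is_idealD(4)[OF is_ideal_colon] power_Suc2 del: power_Suc)
      moreover have "(lin b * x, lin b * y, lin b * z) \<in> kos P Q R"
        using less.hyps[of m n' "lin b * x" "lin b * y" "lin b * z"] less.prems
        by (simp add: mn shift is_idealD(4)[OF is_ideal_colon] power_Suc2 del: power_Suc)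
      ultimately show ?thesis
        by (intro kos_saturated[OF F cop ab nv]) (simp_all add: colon_def)
    qed
  qed
  then show ?thesis using s by (auto simp: ideal_radical_def)
qed

lemma coprime3_of_no_common_zero:
  assumes F: "P \<in> forms e" "Q \<in> forms e" "R \<in> forms e"
    and nz: "\<And>p. p \<noteq> (0, 0, 0) \<Longrightarrow> eval3 P p = 0 \<Longrightarrow> eval3 Q p = 0 \<Longrightarrow> eval3 R p = 0 \<Longrightarrow> False"
  shows "coprime3 P Q R"
proof -
  have "P \<noteq> 0 \<or> Q \<noteq> 0 \<or> R \<noteq> 0" using nz[of "(1, 0, 0)"] by (auto simp: eval_simps)
  then show ?thesis using common_zero_of_common_factor[OF F] nz by blast
qed

text \<open>
  Without common zeros, all linear forms lie in the radical of the ideal, so powers of two of them carry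
  a syzygy into the Koszul relations, which are saturated.
\<close>

theorem smooth_syzygies_koszul:
  assumes F: "P \<in> forms e" "Q \<in> forms e" "R \<in> forms e"
    and nz: "\<And>p. p \<noteq> (0, 0, 0) \<Longrightarrow> eval3 P p = 0 \<Longrightarrow> eval3 Q p = 0 \<Longrightarrow> eval3 R p = 0 \<Longrightarrow> False"
    and s: "x * P + y * Q + z * R = 0"
  shows "(x, y, z) \<in> kos P Q R"
proof -
  have cop: "coprime3 P Q R" by (rule coprime3_of_no_common_zero[OF F nz])
  have c: "cross (1, 0, 0) (0, 1, 0) = (0, 0, 1 :: complex)" by (simp add: cross_def)
  have "lin v \<in> ideal_radical (colon P Q R x y z)" for v
  proof -
    have "lin v \<in> ideal_radical (gen3 P Q R)"
      by (rule nullstellensatz[OF F cop lin_form]) (use nz in auto)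
    then show ?thesis using ideal_radical_mono[OF gen3_subset_colon[OF s]] by blast
  qed
  then show ?thesis
    using nz[of "(0, 0, 1)"] c
    by (intro kos_saturated_radical[OF F cop, of "(1, 0, 0)" "(0, 1, 0)"]) auto
qed

lemma form_mult_low_degree: "h * G \<in> forms n \<Longrightarrow> G \<in> forms e \<Longrightarrow> n < e \<Longrightarrow> h * G = 0"
  using hcomp_mult_form[of G e h n] hcomp_form[of "h * G" n n] by simp

lemma kos_homogeneous:
  assumes F: "P \<in> forms e" "Q \<in> forms e" "R \<in> forms e"
    and "(x, y, z) \<in> kos P Q R" "x \<in> forms n" "y \<in> forms n" "z \<in> forms n"
  obtains "x = 0" "y = 0" "z = 0" "n < e"
    | u v w where "e \<le> n" "u \<in> forms (n - e)" "v \<in> forms (n - e)" "w \<in> forms (n - e)"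
      "x = u * Q + v * R" "y = - u * P + w * R" "z = - v * P - w * Q"
proof -
  obtain u v w where uvw: "x = u * Q + v * R" "y = - u * P + w * R" "z = - v * P - w * Q"
    using assms(4) by (rule kosE)
  have h: "x = hcomp n (u * Q + v * R)" "y = hcomp n (- u * P + w * R)" "z = hcomp n (- v * P - w * Q)"
    unfolding uvw[symmetric] using assms(5-7) by (simp_all add: hcomp_form)
  show thesis
  proof (cases "n < e")
    case True
    then show ?thesis using h by (intro that(1)) (simp_all add: grade_hom(3,5,6) hcomp_mult_form[OF F(1)]
       hcomp_mult_form[OF F(2)] hcomp_mult_form[OF F(3)])
  next
    case False
    then show ?thesis using h
      by (intro that(2)[of "hcomp (n - e) u" "hcomp (n - e) v" "hcomp (n - e) w"])
         (simp_all add: hcomp_in_forms grade_hom(3,5,6) hcomp_mult_form[OF F(1)]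
       hcomp_mult_form[OF F(2)] hcomp_mult_form[OF F(3)])
  qed
qed

section \<open>One ordinary double point\<close>

text \<open>
  A nilpotent version of Nakayama's lemma. Multiplication by \<open>L\<close> turns \<open>la\<close> and \<open>lb\<close> into elements of
  \<open>(la, lb)\<^sup>2\<close> modulo \<open>J\<close>. After enough multiplications one is in a power of \<open>(la, lb)\<close> that lies in
  \<open>J\<close>.
\<close>

lemma node_saturation:
  assumes J: "is_ideal J" and pow: "la ^ n \<in> J" "lb ^ n \<in> J"
    and G: "L * la + (r * la * la + s * la * lb + t * lb * lb) \<in> J"
      "L * lb + (r' * la * la + s' * la * lb + t' * lb * lb) \<in> J"
  shows "\<exists>M. L ^ M * la \<in> J \<and> L ^ M * lb \<in> J"
proof -
  \<comment> \<open>\<open>k\<close> counts how far the degree in \<open>la\<close>, \<open>lb\<close> is below \<open>2 n + 1\<close>, where one exponent is at least \<open>n\<close>.\<close>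
  have claim: "L ^ k * (la ^ i * lb ^ j) \<in> J" if "i + j + k = 2 * n + 1" "i + j > 0" for i j k
    using that
  proof (induction k arbitrary: i j)
    case 0
    then have "n \<le> i \<or> n \<le> j" by linarith
    then have "la ^ i \<in> J \<or> lb ^ j \<in> J"
    proof
      assume "n \<le> i"
      then have "la ^ i = la ^ (i - n) * la ^ n" by (simp flip: power_add)
      then show ?thesis using is_idealD(3)[OF J pow(1)] by simp
    next
      assume "n \<le> j"
      then have "lb ^ j = lb ^ (j - n) * lb ^ n" by (simp flip: power_add)
      then show ?thesis using is_idealD(3)[OF J pow(2)] by simp
    qed
    then show ?case using is_idealD(3,4)[OF J] by auto
  next
    case (Suc k)
    show ?case
    proof (cases i)
      case (Suc i')
      have ih: "L ^ k * (la ^ Suc i * lb ^ j) \<in> J" "L ^ k * (la ^ i * lb ^ Suc j) \<in> J" "L ^ k * (la ^ i' * lb ^ Suc (Suc j)) \<in> J"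
        using Suc.prems \<open>i = Suc i'\<close> by (intro Suc.IH; simp)+
      have "L ^ Suc k * (la ^ i * lb ^ j)
        = (L ^ k * (la ^ i' * lb ^ j)) * (L * la + (r * la * la + s * la * lb + t * lb * lb))
         - r * (L ^ k * (la ^ Suc i * lb ^ j)) - s * (L ^ k * (la ^ i * lb ^ Suc j)) - t * (L ^ k * (la ^ i' * lb ^ Suc (Suc j)))"
        by (simp add: \<open>i = Suc i'\<close> algebra_simps)
      also have "\<dots> \<in> J" by (intro is_idealD(3,6)[OF J] G ih)
      finally show ?thesis .
    next
      case 0
      then obtain j' where j: "j = Suc j'" using Suc.prems by (cases j) auto
      have ih: "L ^ k * (la ^ 2 * lb ^ j') \<in> J" "L ^ k * (la ^ 1 * lb ^ Suc j') \<in> J" "L ^ k * (la ^ 0 * lb ^ Suc (Suc j')) \<in> J"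
        using Suc.prems 0 j by (intro Suc.IH; simp)+
      have "L ^ Suc k * (la ^ i * lb ^ j)
        = (L ^ k * lb ^ j') * (L * lb + (r' * la * la + s' * la * lb + t' * lb * lb))
         - r' * (L ^ k * (la ^ 2 * lb ^ j')) - s' * (L ^ k * (la ^ 1 * lb ^ Suc j')) - t' * (L ^ k * (la ^ 0 * lb ^ Suc (Suc j')))"
        by (simp add: 0 j power2_eq_square algebra_simps)
      also have "\<dots> \<in> J" by (intro is_idealD(3,6)[OF J] G ih)
      finally show ?thesis .
    qed
  qed
  show ?thesis using claim[of 1 0 "2 * n"] claim[of 0 1 "2 * n"] by (intro exI[of _ "2 * n"]) simp
qed

text \<open>
  The triple has no common zero besides \<open>a \<times> b\<close>, and the two elements of the ideal have the linear parts
  \<open>lin a\<close> and \<open>lin b\<close> there. So \<open>lin a\<close> and \<open>lin b\<close> are in the saturation of the ideal and carry every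
  syzygy into the Koszul relations. The obstruction \<open>h\<close> of \<open>kos_compare\<close> is multiplied by \<open>P\<close>, \<open>Q\<close>,
  \<open>R\<close> to forms of degree \<open>j + 2 - e < e\<close>, so it vanishes.
\<close>

theorem node_syzygies_koszul:
  assumes F: "P \<in> forms e" "Q \<in> forms e" "R \<in> forms e" and cop: "coprime3 P Q R"
    and c: "dot c (cross a b) = 1"
    and zero: "\<And>p. p \<noteq> (0, 0, 0) \<Longrightarrow> eval3 P p = 0 \<Longrightarrow> eval3 Q p = 0 \<Longrightarrow> eval3 R p = 0 \<Longrightarrow> dot a p = 0 \<and> dot b p = 0"
    and G: "lin c ^ (e - 1) * lin a + (r * lin a * lin a + s * lin a * lin b + t * lin b * lin b) \<in> gen3 P Q R"
      "lin c ^ (e - 1) * lin b + (r' * lin a * lin a + s' * lin a * lin b + t' * lin b * lin b) \<in> gen3 P Q R"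
    and syz: "x * P + y * Q + z * R = 0" and deg: "x \<in> forms j" "y \<in> forms j" "z \<in> forms j" "j + 2 < 2 * e"
  shows "(x, y, z) \<in> kos P Q R"
proof -
  have dot0: "dot v (0, 0, 0) = 0" for v by (cases v) (simp add: dot_def)
  have ab: "cross a b \<noteq> (0, 0, 0)" using c dot0[of c] by auto
  \<comment> \<open>The point \<open>b \<times> c\<close> lies off the line \<open>a\<close>, so it is not a common zero and can serve for saturation.\<close>
  have abc: "dot a (cross b c) = 1" using c by (cases a; cases b; cases c) (simp add: dot_def cross_def algebra_simps)
  then have bc: "cross b c \<noteq> (0, 0, 0)" using dot0[of a] by auto
  have rad: "lin a \<in> ideal_radical (gen3 P Q R)" "lin b \<in> ideal_radical (gen3 P Q R)"
    using zero by (intro nullstellensatz[OF F cop lin_form]; simp add: eval_lin)+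
  then obtain m n where mn: "lin a ^ m \<in> gen3 P Q R" "lin b ^ n \<in> gen3 P Q R" by (auto simp: ideal_radical_def)
  have "lin a ^ (m + n) \<in> gen3 P Q R" "lin b ^ (m + n) \<in> gen3 P Q R"
    unfolding power_add using is_idealD(4)[OF is_ideal_gen3 mn(1)] is_idealD(3)[OF is_ideal_gen3 mn(2)] by auto
  then obtain M where M: "(lin c ^ (e - 1)) ^ M * lin a \<in> gen3 P Q R" "(lin c ^ (e - 1)) ^ M * lin b \<in> gen3 P Q R"
    using node_saturation[OF is_ideal_gen3 _ _ G] by blast
  have *: "(l * x, l * y, l * z) \<in> kos P Q R" if l: "(lin c ^ (e - 1)) ^ M * l \<in> gen3 P Q R" for l
  proof (rule kos_saturated_radical[OF F cop bc])
    show "eval3 P (cross b c) \<noteq> 0 \<or> eval3 Q (cross b c) \<noteq> 0 \<or> eval3 R (cross b c) \<noteq> 0"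
      using zero[OF bc] abc by auto
    have "(l * x) * P + (l * y) * Q + (l * z) * R = l * (x * P + y * Q + z * R)" by (simp add: algebra_simps)
    then have "gen3 P Q R \<subseteq> colon P Q R (l * x) (l * y) (l * z)" using syz by (intro gen3_subset_colon) simp
    then show "lin b \<in> ideal_radical (colon P Q R (l * x) (l * y) (l * z))" using rad ideal_radical_mono by blast
    have "(lin c ^ (e - 1)) ^ M * l \<in> colon P Q R x y z" using l gen3_subset_colon[OF syz] by blast
    then have "lin c ^ ((e - 1) * M) \<in> colon P Q R (l * x) (l * y) (l * z)"
      by (simp add: colon_def power_mult mult.assoc)
    then show "lin c \<in> ideal_radical (colon P Q R (l * x) (l * y) (l * z))" by (auto simp: ideal_radical_def)
  qed
  have forms: "lin v * f \<in> forms (Suc j)" if "f \<in> forms j" for v f using forms_mult[OF lin_form that, of v] by simp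
  have nz: "lin a \<noteq> 0" using abc by (auto simp: dot_def split: prod.splits)
  show ?thesis
  proof (rule kos_homogeneous[OF F *[OF M(1)] forms forms forms])
    assume "lin a * x = 0" "lin a * y = 0" "lin a * z = 0"
    then show ?thesis using nz kos_0 by simp
  next
    fix u v w assume u: "e \<le> Suc j" "u \<in> forms (Suc j - e)" "v \<in> forms (Suc j - e)" "w \<in> forms (Suc j - e)"
      and s1: "lin a * x = u * Q + v * R" "lin a * y = - u * P + w * R" "lin a * z = - v * P - w * Q"
    show ?thesis
    proof (rule kos_homogeneous[OF F *[OF M(2)] forms forms forms])
      assume "Suc j < e"
      then show ?thesis using u by simp
    next
      fix u' v' w' assume u': "u' \<in> forms (Suc j - e)" "v' \<in> forms (Suc j - e)" "w' \<in> forms (Suc j - e)"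
        and s2: "lin b * x = u' * Q + v' * R" "lin b * y = - u' * P + w' * R" "lin b * z = - v' * P - w' * Q"
      obtain h where h: "lin b * u - lin a * u' = h * R" "lin b * v - lin a * v' = - h * Q" "lin b * w - lin a * w' = h * P"
        using kos_compare[OF cop s1 s2] by blast
      have f: "lin b * X - lin a * Y \<in> forms (Suc (Suc j - e))" if "X \<in> forms (Suc j - e)" "Y \<in> forms (Suc j - e)" for X Y
        using forms_mult[OF lin_form that(1)] forms_mult[OF lin_form that(2)] by (intro forms_diff) simp_all
      have "h * R \<in> forms (Suc (Suc j - e))" "- h * Q \<in> forms (Suc (Suc j - e))" "h * P \<in> forms (Suc (Suc j - e))"
        unfolding h[symmetric] by (intro f u u')+
      then have "h * R = 0" "- h * Q = 0" "h * P = 0"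
        using deg(4) u(1) F by (intro form_mult_low_degree[of _ _ "Suc (Suc j - e)" e]; simp)+
      then have h0: "lin b * u - lin a * u' = 0 * R" "lin b * v - lin a * v' = - 0 * Q" "lin b * w - lin a * w' = 0 * P"
        using h by simp_all
      show ?thesis by (rule kos_divide[OF ab s1 _ h0, of 0 0]) simp
    qed (use deg in auto)
  qed (use deg in auto)
qed

section \<open>The syzygy of a singular point\<close>

lemma form_in_gen2:
  assumes "f \<in> forms e" "f \<in> gen2 (lin a) (lin b)" "e > 0"
  obtains A B where "A \<in> forms (e - 1)" "B \<in> forms (e - 1)" "f = lin a * A + lin b * B"
proof -
  obtain r s where f: "f = r * lin a + s * lin b" using assms(2) by (auto simp: gen2_def)
  have "f = hcomp e f" using assms(1) by (simp add: hcomp_form)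
  also have "\<dots> = lin a * hcomp (e - 1) r + lin b * hcomp (e - 1) s"
    using assms(3) by (simp add: f grade_hom(3) hcomp_mult_form[OF lin_form] mult.commute)
  finally show ?thesis using that hcomp_in_forms by blast
qed

lemma ex_cross_eq:
  assumes "p \<noteq> (0, 0, 0)"
  shows "\<exists>a b. cross a b = p"
proof -
  obtain x y z where p: "p = (x, y, z)" by (metis prod.collapse)
  consider "x \<noteq> 0" | "y \<noteq> 0" | "z \<noteq> 0" using assms p by auto
  then show ?thesis
  proof cases
    case 1
    then have "cross (- y, x, 0) (- z / x, 0, 1) = p" by (simp add: cross_def p)
    then show ?thesis by blast
  next
    case 2
    then have "cross (y, - x, 0) (0, z / y, - 1) = p" by (simp add: cross_def p)
    then show ?thesis by blast
  next
    case 3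
    then have "cross (z, 0, - x) (0, 1, - y / z) = p" by (simp add: cross_def p)
    then show ?thesis by blast
  qed
qed

text \<open>
  All three forms vanish at \<open>p = a \<times> b\<close>, so \<open>F = lin a A + lin b B\<close>, and \<open>A \<times> B\<close> is a syzygy since
  \<open>F\<close> is a combination of \<open>A\<close> and \<open>B\<close>. Note \<open>lin a (A \<times> B) = F \<times> B\<close> and \<open>lin b (A \<times> B) = A \<times> F\<close>.
  If \<open>A \<times> B\<close> were \<open>U \<times> F\<close>, then \<open>B + lin a U\<close> and \<open>A - lin b U\<close> would be multiples of \<open>F\<close> of smaller
  degree, that is 0, and \<open>F = lin a lin b U - lin b lin a U = 0\<close>.
\<close>

theorem singular_point_syzygy:
  assumes F: "P \<in> forms e" "Q \<in> forms e" "R \<in> forms e" and "e \<ge> 2" and cop: "coprime3 P Q R"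
    and p: "p \<noteq> (0, 0, 0)" "eval3 P p = 0" "eval3 Q p = 0" "eval3 R p = 0"
  shows "\<exists>x\<in>forms (2 * e - 2). \<exists>y\<in>forms (2 * e - 2). \<exists>z\<in>forms (2 * e - 2).
    x * P + y * Q + z * R = 0 \<and> (x, y, z) \<notin> kos P Q R"
proof -
  obtain a b where ab: "cross a b = p" using ex_cross_eq[OF p(1)] by blast
  have "G \<in> gen2 (lin a) (lin b)" if "G \<in> forms e" "eval3 G p = 0" for G
    using form_vanishes_gen2[of a b G e] that p(1) by (simp add: ab)
  then have "P \<in> gen2 (lin a) (lin b)" "Q \<in> gen2 (lin a) (lin b)" "R \<in> gen2 (lin a) (lin b)" using F p by blast+
  moreover have "e > 0" using assms(4) by simp
  ultimately obtain A1 B1 A2 B2 A3 B3 where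
    A: "A1 \<in> forms (e - 1)" "A2 \<in> forms (e - 1)" "A3 \<in> forms (e - 1)" and
    B: "B1 \<in> forms (e - 1)" "B2 \<in> forms (e - 1)" "B3 \<in> forms (e - 1)" and
    eq: "P = lin a * A1 + lin b * B1" "Q = lin a * A2 + lin b * B2" "R = lin a * A3 + lin b * B3"
    by (elim form_in_gen2[OF F(1)] form_in_gen2[OF F(2)] form_in_gen2[OF F(3)]) blast
  define x where "x = A2 * B3 - A3 * B2"
  define y where "y = A3 * B1 - A1 * B3"
  define z where "z = A1 * B2 - A2 * B1"
  have prod2: "g * h \<in> forms (2 * e - 2)" if "g \<in> forms (e - 1)" "h \<in> forms (e - 1)" for g h
  proof -
    have "e - 1 + (e - 1) = 2 * e - 2" by simp
    then show ?thesis using forms_mult[OF that] by simp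
  qed
  have deg: "x \<in> forms (2 * e - 2)" "y \<in> forms (2 * e - 2)" "z \<in> forms (2 * e - 2)"
    unfolding x_def y_def z_def by (intro forms_diff prod2 A B)+
  have syz: "x * P + y * Q + z * R = 0"
    unfolding eq x_def y_def z_def by (simp add: algebra_simps)
  have "(x, y, z) \<notin> kos P Q R"
  proof
    assume "(x, y, z) \<in> kos P Q R"
    then obtain u v w where
      u: "u \<in> forms (e - 2)" "v \<in> forms (e - 2)" "w \<in> forms (e - 2)" and
      uvw: "x = u * Q + v * R" "y = - u * P + w * R" "z = - v * P - w * Q"
    proof (rule kos_homogeneous[OF F _ deg])
      assume "2 * e - 2 < e"
      then show ?thesis using assms(4) by simp
    next
      have "2 * e - 2 - e = e - 2" by simp
      then show "u \<in> forms (2 * e - 2 - e) \<Longrightarrow> v \<in> forms (2 * e - 2 - e) \<Longrightarrow> w \<in> forms (2 * e - 2 - e) \<Longrightarrow>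
        x = u * Q + v * R \<Longrightarrow> y = - u * P + w * R \<Longrightarrow> z = - v * P - w * Q \<Longrightarrow> thesis" for u v w
        using that by simp
    qed
    have small: "\<exists>h. X = h * P \<and> Y = h * Q \<and> Z = h * R \<Longrightarrow> X \<in> forms (e - 1) \<Longrightarrow> Y \<in> forms (e - 1) \<Longrightarrow>
      Z \<in> forms (e - 1) \<Longrightarrow> X = 0 \<and> Y = 0 \<and> Z = 0" for X Y Z
      using form_mult_low_degree[of _ _ "e - 1" e] F \<open>e > 0\<close> by auto
    have lf: "lin l * g \<in> forms (e - 1)" if "g \<in> forms (e - 2)" for l g
    proof -
      have "1 + (e - 2) = e - 1" using assms(4) by simp
      then show ?thesis using forms_mult[OF lin_form that, of l] by simp
    qed
    \<comment> \<open>With \<open>U = (-w, v, -u)\<close> this is \<open>B + lin a U = 0\<close>, and the next step is \<open>A - lin b U = 0\<close>.\<close>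
    have B': "B1 - lin a * w = 0 \<and> B2 + lin a * v = 0 \<and> B3 - lin a * u = 0"
    proof (rule small[OF coprime3_proportional[OF cop]])
      have x': "lin a * x = Q * B3 - R * B2" and y': "lin a * y = R * B1 - P * B3" and z': "lin a * z = P * B2 - Q * B1"
        unfolding x_def y_def z_def eq by (simp_all add: algebra_simps)
      show "P * (B2 + lin a * v) = Q * (B1 - lin a * w)"
        using z' unfolding uvw by (simp add: algebra_simps)
      show "P * (B3 - lin a * u) = R * (B1 - lin a * w)"
        using y' unfolding uvw by (simp add: algebra_simps)
      show "Q * (B3 - lin a * u) = R * (B2 + lin a * v)"
        using x' unfolding uvw by (simp add: algebra_simps)
    qed (intro forms_diff forms_add lf B u)+
    have A': "A1 + lin b * w = 0 \<and> A2 - lin b * v = 0 \<and> A3 + lin b * u = 0"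
    proof (rule small[OF coprime3_proportional[OF cop]])
      have x': "lin b * x = A2 * R - A3 * Q" and y': "lin b * y = A3 * P - A1 * R" and z': "lin b * z = A1 * Q - A2 * P"
        unfolding x_def y_def z_def eq by (simp_all add: algebra_simps)
      show "P * (A2 - lin b * v) = Q * (A1 + lin b * w)"
        using z' unfolding uvw by (simp add: algebra_simps)
      show "P * (A3 + lin b * u) = R * (A1 + lin b * w)"
        using y' unfolding uvw by (simp add: algebra_simps)
      show "Q * (A3 + lin b * u) = R * (A2 - lin b * v)"
        using x' unfolding uvw by (simp add: algebra_simps)
    qed (intro forms_diff forms_add lf A u)+
    have "B1 = lin a * w" "B2 = - lin a * v" "B3 = lin a * u" "A1 = - lin b * w" "A2 = lin b * v" "A3 = - lin b * u"
      using A' B' by (simp_all add: eq_neg_iff_add_eq_0)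
    then have "P = 0" "Q = 0" "R = 0" unfolding eq by simp_all
    then show False using cop unfolding coprime3_def by (metis dvd_0_right not_is_unit_0)
  qed
  then show ?thesis using deg syz by blast
qed


section \<open>Dimension count\<close>

lemma (in vector_space) span_Int_of_disjoint_independent:
  assumes ind: "independent C" and "A \<subseteq> C" "B \<subseteq> C" "A \<inter> B = {}" and v: "v \<in> span A" "v \<in> span B"
  shows "v = 0"
proof -
  have eq: "representation A v = representation B v"
    using representation_extend[OF ind v(1) assms(2)] representation_extend[OF ind v(2) assms(3)] by simp
  have "representation A v b = 0" for b
  proof (rule ccontr)
    assume "representation A v b \<noteq> 0"
    then have "b \<in> A" "b \<in> B" using representation_ne_zero eq by metis+
    then show False using assms(4) by blast
  qed
  moreover have "independent A" using ind assms(2) by (auto intro: dependent_mono)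
  then have "(\<Sum>b | representation A v b \<noteq> 0. scale (representation A v b) b) = v"
    using v(1) by (rule sum_nonzero_representation_eq)
  ultimately show "v = 0" by simp
qed

lemma (in vector_space) subspace_eq_of_dim_eq:
  assumes "subspace A" "subspace B" "A \<subseteq> B" "finite T" "B \<subseteq> span T" "dim A = dim B"
  shows "A = B"
proof -
  obtain K where K: "K \<subseteq> A" "independent K" "A \<subseteq> span K" "card K = dim A" by (rule basis_exists)
  have "K \<subseteq> B" using K(1) assms(3) by blast
  then obtain C where C: "K \<subseteq> C" "C \<subseteq> B" "independent C" "B \<subseteq> span C"
    using K(2) by (rule maximal_independent_subset_extend)
  have "finite C" using independent_span_bound[OF assms(4) C(3)] C(2) assms(5) by blast
  moreover have "card C = card K" using basis_card_eq_dim[OF C(2,4,3)] K(4) assms(6) by simp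
  ultimately have "K = C" using C(1) card_subset_eq by metis
  then have "B \<subseteq> span K" using C(4) by simp
  also have "span K \<subseteq> A" using span_minimal[OF K(1) assms(1)] .
  finally show ?thesis using assms(3) by blast
qed

lemma (in vector_space_pair) rank_nullity_subspace:
  assumes f: "Vector_Spaces.linear s1 s2 f" and V: "vs1.subspace V" "finite T" "V \<subseteq> vs1.span T"
  shows "vs2.dim (f ` V) + vs1.dim {v \<in> V. f v = 0} = vs1.dim V"
proof -
  define N where "N = {v \<in> V. f v = 0}"
  have N: "vs1.subspace N"
  proof -
    have "N = V \<inter> {v. f v = 0}" by (auto simp: N_def)
    then show ?thesis using vs1.subspace_inter[OF V(1) linear_subspace_kernel[OF f]] by simp
  qed
  obtain K where K: "K \<subseteq> N" "vs1.independent K" "N \<subseteq> vs1.span K" "card K = vs1.dim N" by (rule vs1.basis_exists)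
  have "K \<subseteq> V" using K(1) by (auto simp: N_def)
  then obtain C where C: "K \<subseteq> C" "C \<subseteq> V" "vs1.independent C" "V \<subseteq> vs1.span C"
    using K(2) by (rule vs1.maximal_independent_subset_extend)
  have fin: "finite C" using vs1.independent_span_bound[OF V(2) C(3)] C(2) V(3) by blast
  let ?B = "C - K"
  have indB: "vs1.independent ?B" using C(3) by (auto intro: vs1.dependent_mono)
  have spB: "vs1.span ?B \<subseteq> V" using C(2) V(1) by (intro vs1.span_minimal) auto
  have inj: "inj_on f (vs1.span ?B)"
  proof (rule inj_onI)
    fix x y assume xy: "x \<in> vs1.span ?B" "y \<in> vs1.span ?B" "f x = f y"
    have d: "x - y \<in> vs1.span ?B" using xy by (intro vs1.span_diff)
    moreover have "f (x - y) = 0" using xy(3) by (simp add: linear_diff[OF f])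
    ultimately have "x - y \<in> N" using spB by (auto simp: N_def)
    then have "x - y = 0"
      using vs1.span_Int_of_disjoint_independent[OF C(3), of K ?B "x - y"] d K(3) C(1) by blast
    then show "x = y" by simp
  qed
  have "vs2.independent (f ` ?B)" using linear_independent_injective_image[OF f indB inj] .
  moreover have "f ` ?B \<subseteq> f ` V" using C(2) by blast
  moreover have "f ` V \<subseteq> vs2.span (f ` ?B)"
  proof -
    have "f ` C \<subseteq> vs2.span (f ` ?B)"
    proof
      fix y assume "y \<in> f ` C"
      then obtain x where x: "x \<in> C" "y = f x" by blast
      show "y \<in> vs2.span (f ` ?B)"
      proof (cases "x \<in> K")
        case True
        then have "y = 0" using K(1) x by (auto simp: N_def)
        then show ?thesis by (simp add: vs2.span_zero)
      next
        case False
        then show ?thesis using x by (intro vs2.span_base) auto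
      qed
    qed
    then have "vs2.span (f ` C) \<subseteq> vs2.span (f ` ?B)" by (intro vs2.span_minimal vs2.subspace_span)
    moreover have "f ` V \<subseteq> vs2.span (f ` C)" using C(4) linear_span_image[OF f] by auto
    ultimately show ?thesis by blast
  qed
  ultimately have "card (f ` ?B) = vs2.dim (f ` V)" by (intro vs2.basis_card_eq_dim)
  moreover have "card (f ` ?B) = card ?B"
    using inj vs1.span_superset by (intro card_image) (rule inj_on_subset)
  moreover have "card C = vs1.dim V" using vs1.basis_card_eq_dim[OF C(2,4,3)] .
  moreover have "card ?B + card K = card C"
    using fin C(1) by (metis card_Diff_subset card_mono finite_subset le_add_diff_inverse2)
  ultimately show ?thesis using K(4) by (simp add: N_def)
qed

definition scale1 :: "complex \<Rightarrow> ternary \<Rightarrow> ternary" where "scale1 c f = const3 c * f"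
definition scale3 :: "complex \<Rightarrow> ternary \<times> ternary \<times> ternary \<Rightarrow> ternary \<times> ternary \<times> ternary" where
  "scale3 c = (\<lambda>(x, y, z). (const3 c * x, const3 c * y, const3 c * z))"

interpretation vs1: vector_space scale1
  by standard (simp_all add: scale1_def const3_hom algebra_simps)

interpretation vs3: vector_space scale3
  by standard (auto simp: scale3_def const3_hom algebra_simps)

interpretation vp31: vector_space_pair scale3 scale1 ..
interpretation vp33: vector_space_pair scale3 scale3 ..
interpretation vp13: vector_space_pair scale1 scale3 ..
interpretation vp11: vector_space_pair scale1 scale1 ..

text \<open>
  A basis of \<open>V \<inter> W\<close> extends to a basis of \<open>V\<close>. The added elements are independent modulo \<open>W\<close>, and any
  family in \<open>V\<close> independent modulo \<open>W\<close> stays independent together with a basis of \<open>V \<inter> W\<close>.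
\<close>

lemma quot_dim_eq:
  assumes V: "vs1.subspace V" "finite T" "V \<subseteq> vs1.span T" and W: "vs1.subspace W"
  shows "quot_dim const3 V W = enat (vs1.dim V - vs1.dim (V \<inter> W))"
proof -
  have VW: "vs1.subspace (V \<inter> W)" using V(1) W by (rule vs1.subspace_inter)
  obtain K where K: "K \<subseteq> V \<inter> W" "vs1.independent K" "V \<inter> W \<subseteq> vs1.span K" "card K = vs1.dim (V \<inter> W)"
    by (rule vs1.basis_exists)
  have "K \<subseteq> V" using K(1) by blast
  then obtain C where C: "K \<subseteq> C" "C \<subseteq> V" "vs1.independent C" "V \<subseteq> vs1.span C"
    using K(2) by (rule vs1.maximal_independent_subset_extend)
  have fin: "finite C" using vs1.independent_span_bound[OF V(2) C(3)] C(2) V(3) by blast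
  have cardC: "card C = vs1.dim V" using vs1.basis_card_eq_dim[OF C(2,4,3)] .
  have finK: "finite K" using fin C(1) finite_subset by blast
  let ?adm = "\<lambda>B. finite B \<and> B \<subseteq> V \<and> (\<forall>c. (\<Sum>b\<in>B. const3 (c b) * b) \<in> W \<longrightarrow> (\<forall>b\<in>B. c b = 0))"
  have adm: "?adm (C - K)"
  proof (intro conjI allI impI)
    fix c assume *: "(\<Sum>b\<in>C - K. const3 (c b) * b) \<in> W"
    let ?s = "\<Sum>b\<in>C - K. scale1 (c b) b"
    have 1: "?s \<in> vs1.span (C - K)" by (intro vs1.span_sum vs1.span_scale vs1.span_base)
    have "vs1.span (C - K) \<subseteq> V" using C(2) V(1) by (intro vs1.span_minimal) auto
    then have "?s \<in> vs1.span K" using 1 * K(3) by (auto simp: scale1_def)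
    then have "?s = 0"
      using vs1.span_Int_of_disjoint_independent[OF C(3), of K "C - K" ?s] 1 C(1) by blast
    moreover have "vs1.independent (C - K)" using C(3) by (auto intro: vs1.dependent_mono)
    ultimately show "\<forall>b\<in>C - K. c b = 0" using vs1.dependent_finite[of "C - K"] fin by blast
  qed (use fin C(2) in auto)
  have card: "card (C - K) = vs1.dim V - vs1.dim (V \<inter> W)"
    using C(1) finK cardC K(4) by (simp add: card_Diff_subset)
  have bound: "card B \<le> vs1.dim V - vs1.dim (V \<inter> W)" if B: "?adm B" for B
  proof -
    have disj: "K \<inter> B = {}"
    proof (rule ccontr)
      assume "K \<inter> B \<noteq> {}"
      then obtain b where b: "b \<in> K" "b \<in> B" by blast
      define d where "d x = (if x = b then 1 else 0 :: complex)" for x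
      \<comment> \<open>An element of \<open>K\<close> lies in \<open>W\<close>, so it cannot be part of a family that is independent modulo \<open>W\<close>.\<close>
      have "(\<Sum>x\<in>B. const3 (d x) * x) = (\<Sum>x\<in>B. if x = b then x else 0)"
        by (intro sum.cong) (auto simp: const3_hom d_def)
      also have "\<dots> = b" using B b by simp
      finally have "(\<Sum>x\<in>B. const3 (d x) * x) \<in> W" using b K(1) by auto
      with B have "\<forall>x\<in>B. d x = 0" by blast
      then show False using b by (auto simp: d_def)
    qed
    have "vs1.independent (K \<union> B)"
    proof
      assume "vs1.dependent (K \<union> B)"
      then obtain u where u: "\<exists>v\<in>K \<union> B. u v \<noteq> 0" "(\<Sum>v\<in>K \<union> B. scale1 (u v) v) = 0"
        using vs1.dependent_finite[of "K \<union> B"] finK B by blast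
      have sum: "(\<Sum>v\<in>K. scale1 (u v) v) + (\<Sum>v\<in>B. scale1 (u v) v) = 0"
        using u(2) sum.union_disjoint[OF finK conjunct1[OF B] disj, of "\<lambda>v. scale1 (u v) v"] by (rule trans[OF sym, rotated])
      have "- (\<Sum>v\<in>K. scale1 (u v) v) \<in> W"
        using K(1) W by (intro vs1.subspace_neg vs1.subspace_sum vs1.subspace_scale) auto
      moreover have "- (\<Sum>v\<in>K. scale1 (u v) v) = (\<Sum>v\<in>B. scale1 (u v) v)" using sum by (simp add: minus_unique)
      ultimately have "(\<Sum>b\<in>B. const3 (u b) * b) \<in> W" by (simp add: scale1_def)
      then have zB: "\<forall>b\<in>B. u b = 0" using B by blast
      then have "(\<Sum>v\<in>B. scale1 (u v) v) = 0" by (intro sum.neutral) auto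
      then have "(\<Sum>v\<in>K. scale1 (u v) v) = 0" using sum by simp
      then have "\<forall>v\<in>K. u v = 0" using K(2) vs1.dependent_finite[OF finK] by blast
      then show False using zB u(1) by blast
    qed
    moreover have "K \<union> B \<subseteq> vs1.span C" using B K(1) C(4) by blast
    ultimately have "card (K \<union> B) \<le> card C" using vs1.independent_span_bound[OF fin] by blast
    moreover have "card (K \<union> B) = card K + card B" using card_Un_disjoint[OF finK conjunct1[OF B] disj] .
    ultimately show ?thesis using K(4) cardC by linarith
  qed
  show ?thesis
    unfolding quot_dim_def
  proof (rule antisym)
    show "Sup {enat (card B) |B. ?adm B} \<le> enat (vs1.dim V - vs1.dim (V \<inter> W))"
    proof (rule Sup_least)
      fix x assume "x \<in> {enat (card B) |B. ?adm B}"
      then obtain B where "x = enat (card B)" "?adm B" by blast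
      then show "x \<le> enat (vs1.dim V - vs1.dim (V \<inter> W))" using bound by (simp only: enat_ord_simps)
    qed
    show "enat (vs1.dim V - vs1.dim (V \<inter> W)) \<le> Sup {enat (card B) |B. ?adm B}"
    proof (rule Sup_upper)
      show "enat (vs1.dim V - vs1.dim (V \<inter> W)) \<in> {enat (card B) |B. ?adm B}"
        unfolding card[symmetric] using adm by blast
    qed
  qed
qed

lemma linear_mult: "Vector_Spaces.linear scale1 scale1 (\<lambda>f. g * f)"
  unfolding Vector_Spaces.linear_iff by (auto simp: vs1.vector_space_axioms scale1_def algebra_simps)

lemma subspace_forms: "vs1.subspace (forms n)"
  by (simp add: vs1.subspace_def forms_add scale1_def forms_cmult)

lemma forms_finite_span: "\<exists>T. finite T \<and> forms n \<subseteq> vs1.span T"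
proof (induction n)
  case 0
  have "const3 c \<in> vs1.span {1}" for c
    using vs1.span_scale[OF vs1.span_base[of 1 "{1}"], of c] by (simp add: scale1_def)
  then show ?case by (intro exI[of _ "{1}"]) (auto simp: forms_0_iff)
next
  case (Suc n)
  then obtain T where T: "finite T" "forms n \<subseteq> vs1.span T" by blast
  let ?T = "(\<lambda>f. varX * f) ` T \<union> (\<lambda>f. varY * f) ` T \<union> (\<lambda>f. varZ * f) ` T"
  have *: "g * f \<in> vs1.span ?T" if "f \<in> forms n" "g \<in> {varX, varY, varZ}" for f g
  proof -
    have "g * f \<in> vs1.span ((\<lambda>f. g * f) ` T)"
      using that(1) T(2) vp11.linear_span_image[OF linear_mult, of g T] by auto
    moreover have "(\<lambda>f. g * f) ` T \<subseteq> ?T" using that(2) by auto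
    ultimately show ?thesis using vs1.span_mono by blast
  qed
  have "f \<in> vs1.span ?T" if f: "f \<in> forms (Suc n)" for f
  proof -
    obtain f1 f2 f3 where "f1 \<in> forms n" "f2 \<in> forms n" "f3 \<in> forms n"
      "f = varX * f1 + varY * f2 + varZ * f3" using f by (rule forms_pos_decomp)
    then show ?thesis using * by (auto intro!: vs1.span_add)
  qed
  then show ?case using T(1) by (intro exI[of _ ?T]) auto
qed

abbreviation forms3 :: "nat \<Rightarrow> (ternary \<times> ternary \<times> ternary) set" where
  "forms3 n \<equiv> forms n \<times> forms n \<times> forms n"

lemma subspace_forms3: "vs3.subspace (forms3 n)"
  by (auto simp: vs3.subspace_def zero_prod_def forms_add scale3_def forms_cmult)

lemma forms3_finite_span: "\<exists>T. finite T \<and> forms3 n \<subseteq> vs3.span T"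
proof -
  obtain T where T: "finite T" "forms n \<subseteq> vs1.span T" using forms_finite_span by blast
  have l: "Vector_Spaces.linear scale1 scale3 (\<lambda>f. (f, 0, 0))" "Vector_Spaces.linear scale1 scale3 (\<lambda>f. (0, f, 0))"
    "Vector_Spaces.linear scale1 scale3 (\<lambda>f. (0, 0, f))"
    unfolding Vector_Spaces.linear_iff by (auto simp: vs1.vector_space_axioms vs3.vector_space_axioms scale1_def scale3_def)
  let ?T = "(\<lambda>f. (f, 0, 0)) ` T \<union> (\<lambda>f. (0, f, 0)) ` T \<union> (\<lambda>f. (0, 0, f)) ` T"
  have "(x, y, z) \<in> vs3.span ?T" if "x \<in> forms n" "y \<in> forms n" "z \<in> forms n" for x y z
  proof -
    have "(x, 0, 0) \<in> vs3.span ?T"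
      using that(1) T(2) vp13.linear_span_image[OF l(1), of T] vs3.span_mono[of "(\<lambda>f. (f, 0, 0)) ` T" ?T] by blast
    moreover have "(0, y, 0) \<in> vs3.span ?T"
      using that(2) T(2) vp13.linear_span_image[OF l(2), of T] vs3.span_mono[of "(\<lambda>f. (0, f, 0)) ` T" ?T] by blast
    moreover have "(0, 0, z) \<in> vs3.span ?T"
      using that(3) T(2) vp13.linear_span_image[OF l(3), of T] vs3.span_mono[of "(\<lambda>f. (0, 0, f)) ` T" ?T] by blast
    ultimately have "(x, 0, 0) + (0, y, 0) + (0, 0, z) \<in> vs3.span ?T" by (intro vs3.span_add)
    then show ?thesis by simp
  qed
  then show ?thesis using T(1) by (intro exI[of _ ?T]) auto
qed

definition syz :: "ternary \<Rightarrow> ternary \<Rightarrow> ternary \<Rightarrow> nat \<Rightarrow> (ternary \<times> ternary \<times> ternary) set" where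
  "syz P Q R n = {(x, y, z). x \<in> forms n \<and> y \<in> forms n \<and> z \<in> forms n \<and> x * P + y * Q + z * R = 0}"

lemma subspace_syz: "vs3.subspace (syz P Q R n)"
proof -
  have "scale3 c (x, y, z) \<in> syz P Q R n" if "(x, y, z) \<in> syz P Q R n" for c x y z
  proof -
    have "const3 c * x * P + const3 c * y * Q + const3 c * z * R = const3 c * (x * P + y * Q + z * R)"
      by (simp add: algebra_simps)
    then show ?thesis using that by (auto simp: syz_def scale3_def forms_cmult)
  qed
  moreover have "(x + x', y + y', z + z') \<in> syz P Q R n" if "(x, y, z) \<in> syz P Q R n" "(x', y', z') \<in> syz P Q R n"
    for x y z x' y' z'
  proof -
    have "(x + x') * P + (y + y') * Q + (z + z') * R = (x * P + y * Q + z * R) + (x' * P + y' * Q + z' * R)"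
      by (simp add: algebra_simps)
    then show ?thesis using that by (auto simp: syz_def forms_add)
  qed
  moreover have "(0, 0, 0) \<in> syz P Q R n" by (simp add: syz_def)
  ultimately show ?thesis by (auto simp: vs3.subspace_def zero_prod_def)
qed

lemma subspace_gen3: "vs1.subspace (gen3 P Q R)"
  using is_ideal_gen3[of P Q R] by (auto simp: vs1.subspace_def scale1_def is_idealD)

lemma subspace_kos: "vs3.subspace (kos P Q R)"
  using kos_0 kos_add kos_mult by (auto simp: vs3.subspace_def scale3_def zero_prod_def)

lemma gen3_form:
  assumes F: "P \<in> forms e" "Q \<in> forms e" "R \<in> forms e" and "g \<in> gen3 P Q R" "g \<in> forms n"
  obtains "g = 0" "n < e"
    | a b c where "e \<le> n" "a \<in> forms (n - e)" "b \<in> forms (n - e)" "c \<in> forms (n - e)" "g = a * P + b * Q + c * R"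
proof -
  obtain a b c where g: "g = a * P + b * Q + c * R" using assms(4) by (auto simp: gen3_def)
  then have h: "g = hcomp n (a * P + b * Q + c * R)" using assms(5) by (simp add: hcomp_form)
  show thesis
  proof (cases "n < e")
    case True
    then show ?thesis using h by (intro that(1)) (simp_all add: grade_hom(3) hcomp_mult_form[OF F(1)]
       hcomp_mult_form[OF F(2)] hcomp_mult_form[OF F(3)])
  next
    case False
    then show ?thesis using h
      by (intro that(2)[of "hcomp (n - e) a" "hcomp (n - e) b" "hcomp (n - e) c"])
         (simp_all add: hcomp_in_forms grade_hom(3) hcomp_mult_form[OF F(1)]
       hcomp_mult_form[OF F(2)] hcomp_mult_form[OF F(3)])
  qed
qed

lemma dim_ideal_plus_dim_syz:
  assumes F: "P \<in> forms e" "Q \<in> forms e" "R \<in> forms e"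
  shows "vs1.dim (forms (n + e) \<inter> gen3 P Q R) + vs3.dim (syz P Q R n) = vs3.dim (forms3 n)"
proof -
  define \<phi> where "\<phi> = (\<lambda>(x, y, z). x * P + y * Q + z * R)"
  have l: "Vector_Spaces.linear scale3 scale1 \<phi>"
    unfolding Vector_Spaces.linear_iff by (auto simp: vs1.vector_space_axioms vs3.vector_space_axioms scale1_def scale3_def \<phi>_def algebra_simps)
  have "\<phi> ` forms3 n = forms (n + e) \<inter> gen3 P Q R"
  proof
    show "\<phi> ` forms3 n \<subseteq> forms (n + e) \<inter> gen3 P Q R"
      using F by (auto simp: \<phi>_def gen3_def intro!: forms_add forms_mult)
    show "forms (n + e) \<inter> gen3 P Q R \<subseteq> \<phi> ` forms3 n"
    proof
      fix g assume g: "g \<in> forms (n + e) \<inter> gen3 P Q R"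
      then have "g \<in> gen3 P Q R" "g \<in> forms (n + e)" by auto
      then show "g \<in> \<phi> ` forms3 n"
      proof (rule gen3_form[OF F])
        fix a b c assume "a \<in> forms (n + e - e)" "b \<in> forms (n + e - e)" "c \<in> forms (n + e - e)" "g = a * P + b * Q + c * R"
        then show ?thesis by (intro image_eqI[of _ _ "(a, b, c)"]) (simp_all add: \<phi>_def)
      qed simp
    qed
  qed
  moreover have "{v \<in> forms3 n. \<phi> v = 0} = syz P Q R n"
    by (auto simp: \<phi>_def syz_def)
  moreover obtain T where "finite T" "forms3 n \<subseteq> vs3.span T" using forms3_finite_span by blast
  then have "vs1.dim (\<phi> ` forms3 n) + vs3.dim {v \<in> forms3 n. \<phi> v = 0} = vs3.dim (forms3 n)"
    by (rule vp31.rank_nullity_subspace[OF l subspace_forms3])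
  ultimately show ?thesis by simp
qed

lemma coprime3_nonzero: "coprime3 P Q (R :: ternary) \<Longrightarrow> P \<noteq> 0 \<or> Q \<noteq> 0 \<or> R \<noteq> 0"
  unfolding coprime3_def by (metis dvd_0_right not_is_unit_0)

text \<open>
  The Koszul relations of degree \<open>n\<close> are the image of the triples of degree \<open>n - e\<close>, with a kernel that
  consists of the multiples of \<open>(R, -Q, P)\<close> by forms of degree \<open>n - 2e\<close>. What matters is that the right
  side does not mention \<open>P\<close>, \<open>Q\<close>, \<open>R\<close>.
\<close>

lemma dim_kos:
  assumes F: "P \<in> forms e" "Q \<in> forms e" "R \<in> forms e" and cop: "coprime3 P Q R"
  shows "vs3.dim (kos P Q R \<inter> forms3 n) = (if n < e then 0 else vs3.dim (forms3 (n - e))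
     - (if n < 2 * e then 0 else vs1.dim (forms (n - 2 * e))))"
proof (cases "n < e")
  case True
  have "kos P Q R \<inter> forms3 n \<subseteq> {0}"
  proof safe
    fix x y z assume "(x, y, z) \<in> kos P Q R" "x \<in> forms n" "y \<in> forms n" "z \<in> forms n"
    then show "(x, y, z) = 0"
      by (rule kos_homogeneous[OF F]) (use True in \<open>auto simp: zero_prod_def\<close>)
  qed
  then have "kos P Q R \<inter> forms3 n \<subseteq> vs3.span {}" by (simp add: vs3.span_empty)
  then show ?thesis using vs3.dim_le_card[of _ "{}"] True by fastforce
next
  case False
  define \<psi> where "\<psi> = (\<lambda>(u, v, w). (u * Q + v * R, - u * P + w * R, - v * P - w * Q))"
  have l: "Vector_Spaces.linear scale3 scale3 \<psi>"
    unfolding Vector_Spaces.linear_iff by (auto simp: vs3.vector_space_axioms scale3_def \<psi>_def algebra_simps)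
  have img: "\<psi> ` forms3 (n - e) = kos P Q R \<inter> forms3 n"
  proof
    have "u * G \<in> forms n" if "u \<in> forms (n - e)" "G \<in> forms e" for u G
      using forms_mult[OF that] False by simp
    then show "\<psi> ` forms3 (n - e) \<subseteq> kos P Q R \<inter> forms3 n"
    proof -
      have "\<psi> (u, v, w) \<in> kos P Q R" for u v w
        unfolding \<psi>_def by (auto simp: kos_def)
      moreover have "\<psi> (u, v, w) \<in> forms3 n" if "u \<in> forms (n - e)" "v \<in> forms (n - e)" "w \<in> forms (n - e)" for u v w
        using F that \<open>\<And>u G. u \<in> forms (n - e) \<Longrightarrow> G \<in> forms e \<Longrightarrow> u * G \<in> forms n\<close>
        by (simp add: \<psi>_def forms_add forms_diff forms_uminus)
      ultimately show ?thesis by blast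
    qed
    show "kos P Q R \<inter> forms3 n \<subseteq> \<psi> ` forms3 (n - e)"
    proof safe
      fix x y z assume "(x, y, z) \<in> kos P Q R" "x \<in> forms n" "y \<in> forms n" "z \<in> forms n"
      then show "(x, y, z) \<in> \<psi> ` forms3 (n - e)"
      proof (rule kos_homogeneous[OF F])
        fix u v w assume "u \<in> forms (n - e)" "v \<in> forms (n - e)" "w \<in> forms (n - e)"
          "x = u * Q + v * R" "y = - u * P + w * R" "z = - v * P - w * Q"
        then show ?thesis by (intro image_eqI[of _ _ "(u, v, w)"]) (simp_all add: \<psi>_def)
      qed (use False in auto)
    qed
  qed
  define \<chi> where "\<chi> h = (h * R, - (h * Q), h * P)" for h
  have lx: "Vector_Spaces.linear scale1 scale3 \<chi>"
    unfolding Vector_Spaces.linear_iff by (simp add: vs1.vector_space_axioms vs3.vector_space_axioms scale1_def scale3_def \<chi>_def distrib_right mult.assoc)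
  have nz: "P \<noteq> 0 \<or> Q \<noteq> 0 \<or> R \<noteq> 0" using cop by (rule coprime3_nonzero)
  have ker: "{v \<in> forms3 (n - e). \<psi> v = 0} = (if n < 2 * e then {0} else \<chi> ` forms (n - 2 * e))"
  proof -
    have 1: "v \<in> (if n < 2 * e then {0} else \<chi> ` forms (n - 2 * e))" if v: "v \<in> forms3 (n - e)" "\<psi> v = 0" for v
    proof -
      obtain a b c where abc: "v = (a, b, c)" by (metis prod.collapse)
      then have "a * Q + b * R = 0" "- a * P + c * R = 0" "- b * P - c * Q = 0"
        using v(2) by (simp_all add: \<psi>_def zero_prod_def)
      from kos_kernel[OF cop this] obtain h where h: "a = h * R" "b = - h * Q" "c = h * P" by blast
      have af: "a \<in> forms (n - e)" "- b \<in> forms (n - e)" "c \<in> forms (n - e)" using v(1) abc forms_uminus by auto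
      show ?thesis
      proof (cases "n < 2 * e")
        case True
        then have "n - e < e" using False by linarith
        then have "h * R = 0" "h * Q = 0" "h * P = 0"
          using form_mult_low_degree[of h R "n - e" e] form_mult_low_degree[of h Q "n - e" e]
            form_mult_low_degree[of h P "n - e" e] F af h by auto
        then show ?thesis using True h abc by (simp add: zero_prod_def)
      next
        case F2: False
        then have ne: "n - e - e = n - 2 * e" "e \<le> n - e" by auto
        have "h' * G = hcomp (n - e) (h' * G) " if "h' * G \<in> forms (n - e)" for h' G :: ternary
          using that by (simp add: hcomp_form)
        then have "h * G = hcomp (n - 2 * e) h * G" if "h * G \<in> forms (n - e)" "G \<in> forms e" for G
          using that ne by (metis hcomp_mult_form leD)
        then have "v = \<chi> (hcomp (n - 2 * e) h)" using h abc af F by (simp add: \<chi>_def)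
        then show ?thesis using F2 hcomp_in_forms by auto
      qed
    qed
    have 2: "v \<in> forms3 (n - e) \<and> \<psi> v = 0" if v: "v \<in> (if n < 2 * e then {0} else \<chi> ` forms (n - 2 * e))" for v
    proof (cases "n < 2 * e")
      case True
      then show ?thesis using v by (auto simp: zero_prod_def \<psi>_def)
    next
      case F2: False
      then obtain h where h: "h \<in> forms (n - 2 * e)" "v = \<chi> h" using v by auto
      have "h * G \<in> forms (n - e)" if "G \<in> forms e" for G
      proof -
        have "n - 2 * e + e = n - e" using F2 by simp
        then show ?thesis using forms_mult[OF h(1) that] by simp
      qed
      then show ?thesis using F h(2) by (auto simp: \<chi>_def \<psi>_def zero_prod_def forms_uminus algebra_simps)
    qed
    show ?thesis using 1 2 by blast
  qed
  have dimker: "vs3.dim {v \<in> forms3 (n - e). \<psi> v = 0} = (if n < 2 * e then 0 else vs1.dim (forms (n - 2 * e)))"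
  proof (cases "n < 2 * e")
    case True
    have "{0} \<subseteq> vs3.span {}" by (simp add: vs3.span_empty)
    from vs3.dim_le_card[OF this] show ?thesis using True by (simp add: ker)
  next
    case F2: False
    have "{h \<in> forms (n - 2 * e). \<chi> h = 0} \<subseteq> vs1.span {}"
      using nz by (auto simp: \<chi>_def zero_prod_def vs1.span_empty)
    from vs1.dim_le_card[OF this] have "vs1.dim {h \<in> forms (n - 2 * e). \<chi> h = 0} = 0" by simp
    moreover obtain T where "finite T" "forms (n - 2 * e) \<subseteq> vs1.span T" using forms_finite_span by blast
    ultimately show ?thesis
      using vp13.rank_nullity_subspace[OF lx subspace_forms, of T "n - 2 * e"] F2 by (simp add: ker)
  qed
  obtain T where T: "finite T" "forms3 (n - e) \<subseteq> vs3.span T" using forms3_finite_span by blast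
  show ?thesis
    using vp33.rank_nullity_subspace[OF l subspace_forms3 T] unfolding dimker img if_not_P[OF False]
    by (metis add_diff_cancel_right')
qed

lemma kos_subset_syz: "kos P Q R \<inter> forms3 n \<subseteq> syz P Q R n"
  by (auto simp: kos_def syz_def algebra_simps)

text \<open>
  Both quotients have the dimension of all forms, minus that of all triples of degree \<open>n\<close>, plus that
  of the syzygies of degree \<open>n\<close>. For the second triple the syzygies are the Koszul relations, whose
  dimension is the same for both triples.
\<close>

theorem quot_dim_eq_iff_syz_koszul:
  assumes F: "P \<in> forms e" "Q \<in> forms e" "R \<in> forms e" and cop: "coprime3 P Q R"
    and F': "P' \<in> forms e" "Q' \<in> forms e" "R' \<in> forms e" and cop': "coprime3 P' Q' R'"
    and smooth: "syz P' Q' R' n \<subseteq> kos P' Q' R'"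
  shows "quot_dim const3 (forms (n + e)) (gen3 P Q R) = quot_dim const3 (forms (n + e)) (gen3 P' Q' R')
    \<longleftrightarrow> syz P Q R n \<subseteq> kos P Q R"
proof -
  obtain T where T: "finite T" "forms (n + e) \<subseteq> vs1.span T" using forms_finite_span by blast
  obtain T3 where T3: "finite T3" "forms3 n \<subseteq> vs3.span T3" using forms3_finite_span by blast
  have qd: "quot_dim const3 (forms (n + e)) (gen3 P Q R) = enat (vs1.dim (forms (n + e)) - vs1.dim (forms (n + e) \<inter> gen3 P Q R))"
    for P Q R by (rule quot_dim_eq[OF subspace_forms T subspace_gen3])
  have le: "vs1.dim (forms (n + e) \<inter> gen3 P Q R) \<le> vs1.dim (forms (n + e))" for P Q R
  proof -
    obtain B where B: "B \<subseteq> forms (n + e)" "vs1.independent B" "forms (n + e) \<subseteq> vs1.span B"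
      "card B = vs1.dim (forms (n + e))" by (rule vs1.basis_exists)
    have "finite B" using vs1.independent_span_bound[OF T(1) B(2)] B(1) T(2) by blast
    then show ?thesis using vs1.dim_le_card[of "forms (n + e) \<inter> gen3 P Q R" B] B(3,4) by auto
  qed
  have in3: "syz P Q R n \<subseteq> forms3 n" for P Q R by (auto simp: syz_def)
  have eq': "syz P' Q' R' n = kos P' Q' R' \<inter> forms3 n" using kos_subset_syz smooth in3 by blast
  have "quot_dim const3 (forms (n + e)) (gen3 P Q R) = quot_dim const3 (forms (n + e)) (gen3 P' Q' R')
    \<longleftrightarrow> vs1.dim (forms (n + e) \<inter> gen3 P Q R) = vs1.dim (forms (n + e) \<inter> gen3 P' Q' R')"
    unfolding qd using le[of P Q R] le[of P' Q' R'] by auto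
  also have "\<dots> \<longleftrightarrow> vs3.dim (syz P Q R n) = vs3.dim (syz P' Q' R' n)"
    using dim_ideal_plus_dim_syz[OF F, of n] dim_ideal_plus_dim_syz[OF F', of n] by linarith
  also have "vs3.dim (syz P' Q' R' n) = vs3.dim (kos P Q R \<inter> forms3 n)"
    unfolding eq' dim_kos[OF F cop] dim_kos[OF F' cop'] by simp
  also have "vs3.dim (syz P Q R n) = vs3.dim (kos P Q R \<inter> forms3 n) \<longleftrightarrow> syz P Q R n \<subseteq> kos P Q R"
  proof
    assume eq: "vs3.dim (syz P Q R n) = vs3.dim (kos P Q R \<inter> forms3 n)"
    have "syz P Q R n \<subseteq> vs3.span T3" using T3(2) in3 by blast
    from vs3.subspace_eq_of_dim_eq[OF vs3.subspace_inter[OF subspace_kos subspace_forms3] subspace_syz kos_subset_syz T3(1) this eq[symmetric]]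
    show "syz P Q R n \<subseteq> kos P Q R" by blast
  next
    assume "syz P Q R n \<subseteq> kos P Q R"
    then have "syz P Q R n = kos P Q R \<inter> forms3 n" using kos_subset_syz in3 by blast
    then show "vs3.dim (syz P Q R n) = vs3.dim (kos P Q R \<inter> forms3 n)" by simp
  qed
  finally show ?thesis .
qed

lemma quot_dim_low_degree:
  assumes F: "P \<in> forms e" "Q \<in> forms e" "R \<in> forms e" and "n < e"
  shows "quot_dim const3 (forms n) (gen3 P Q R) = quot_dim const3 (forms n) {0}"
proof -
  obtain T where T: "finite T" "forms n \<subseteq> vs1.span T" using forms_finite_span by blast
  have "forms n \<inter> gen3 P Q R = forms n \<inter> {0}"
  proof -
    have "g = 0" if "g \<in> gen3 P Q R" "g \<in> forms n" for g
      using that by (rule gen3_form[OF F]) (use assms(4) in auto)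
    then show ?thesis using is_idealD(1)[OF is_ideal_gen3, of P Q R] by auto
  qed
  then show ?thesis
    using quot_dim_eq[OF subspace_forms T subspace_gen3, of P Q R] quot_dim_eq[OF subspace_forms T vs1.subspace_single_0] by simp
qed


section \<open>The three invariants of a curve\<close>

text \<open>
  The points of \<open>P2\<close> are normalised vectors, while the algebra produces arbitrary nonzero ones.
\<close>

lemma P2_representative:
  assumes "p \<noteq> (0, 0, 0)"
  obtains s a b c where "s \<noteq> 0" "(a, b, c) \<in> P2" "p = (s * a, s * b, s * c)"
proof -
  obtain x y z where p: "p = (x, y, z)" by (metis prod.collapse)
  show ?thesis
  proof (cases "x = 0")
    case False
    then show ?thesis by (intro that[of x 1 "y / x" "z / x"]) (auto simp: P2_def p)
  next
    case x: True
    show ?thesis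
    proof (cases "y = 0")
      case False
      then show ?thesis using x by (intro that[of y 0 1 "z / y"]) (auto simp: P2_def p)
    next
      case True
      then show ?thesis using x assms by (intro that[of z 0 0 1]) (auto simp: P2_def p)
    qed
  qed
qed

lemma P2_nonzero: "p \<in> P2 \<Longrightarrow> p \<noteq> (0, 0, 0)"
  by (auto simp: P2_def)

lemma eval_scale: "f \<in> forms n \<Longrightarrow> eval3 f (s * a, s * b, s * c) = s ^ n * eval3 f (a, b, c)"
  by (rule subst3_scale[OF unital_hom_id])

lemma eval_euler:
  assumes "f \<in> forms d" "d > 0" "eval3 (dx f) p = 0" "eval3 (dy f) p = 0" "eval3 (dz f) p = 0"
  shows "eval3 f p = 0"
proof -
  obtain x y z where p: "p = (x, y, z)" by (metis prod.collapse)
  have "eval3 (const3 (of_nat d) * f) p = 0"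
    unfolding euler[OF assms(1), symmetric] using assms(3-5) by (simp add: p eval_simps)
  then show ?thesis using assms(2) by (simp add: p eval_simps)
qed

lemma common_zero_in_sing:
  assumes f: "f \<in> forms d" "d > 0" and p: "p \<noteq> (0, 0, 0)"
    "eval3 (dx f) p = 0" "eval3 (dy f) p = 0" "eval3 (dz f) p = 0"
  obtains s a b c where "s \<noteq> 0" "(a, b, c) \<in> sing f" "p = (s * a, s * b, s * c)"
proof -
  obtain s a b c where s: "s \<noteq> 0" "(a, b, c) \<in> P2" "p = (s * a, s * b, s * c)"
    using p(1) by (rule P2_representative)
  have "eval3 (dx f) (a, b, c) = 0" "eval3 (dy f) (a, b, c) = 0" "eval3 (dz f) (a, b, c) = 0"
    using p(2-4) s(1,3) forms_d[OF f(1), THEN eval_scale] by simp_all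
  then have "(a, b, c) \<in> sing f"
    using s(2) eval_euler[OF f] by (simp add: sing_def zeros_def)
  with s show ?thesis using that by blast
qed

lemma smooth_form_partials:
  assumes "smooth_form d f" "d \<ge> 2"
  shows "coprime3 (dx f) (dy f) (dz f)" "syz (dx f) (dy f) (dz f) n \<subseteq> kos (dx f) (dy f) (dz f)"
proof -
  have f: "f \<in> forms d" "sing f = {}" using assms(1) by (auto simp: smooth_form_def)
  have nz: False if "p \<noteq> (0, 0, 0)" "eval3 (dx f) p = 0" "eval3 (dy f) p = 0" "eval3 (dz f) p = 0" for p
    using common_zero_in_sing[OF f(1) _ that] assms(2) f(2) by force
  show "coprime3 (dx f) (dy f) (dz f)"
    by (rule coprime3_of_no_common_zero[OF forms_d[OF f(1)]]) (use nz in auto)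
  have "(x, y, z) \<in> kos (dx f) (dy f) (dz f)" if "x * dx f + y * dy f + z * dz f = 0" for x y z
    by (rule smooth_syzygies_koszul[OF forms_d[OF f(1)] _ that]) (use nz in blast)
  then show "syz (dx f) (dy f) (dz f) n \<subseteq> kos (dx f) (dy f) (dz f)"
    unfolding syz_def by blast
qed

abbreviation syzygies :: "ternary \<Rightarrow> nat \<Rightarrow> (ternary \<times> ternary \<times> ternary) set" where
  "syzygies f \<equiv> syz (dx f) (dy f) (dz f)"

lemma koszul_kos: "koszul f = kos (dx f) (dy f) (dz f)"
  by (simp add: koszul_def kos_def)

lemma jacobian_gen3: "jacobian_ideal f = gen3 (dx f) (dy f) (dz f)"
  by (simp add: jacobian_ideal_def gen3_def)

lemma mdr_syz: "mdr f = Inf {enat r | r. \<exists>t\<in>syzygies f r. t \<noteq> (0, 0, 0)}"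
  unfolding mdr_def AR_def syz_def by (rule arg_cong[of _ _ Inf]) auto

lemma mdr_e_syz: "mdr_e f = Inf {enat r | r. \<not> syzygies f r \<subseteq> koszul f}"
  unfolding mdr_e_def AR_def syz_def by (rule arg_cong[of _ _ Inf]) blast

lemma mdr_e_le: "\<not> syzygies f r \<subseteq> koszul f \<Longrightarrow> mdr_e f \<le> enat r"
  unfolding mdr_e_syz by (rule Inf_lower) blast

lemma mdr_le: "t \<in> syzygies f r \<Longrightarrow> t \<noteq> (0, 0, 0) \<Longrightarrow> mdr f \<le> enat r"
  unfolding mdr_syz by (rule Inf_lower) blast

lemma mdr_e_ge: "(\<And>r. r < m \<Longrightarrow> syzygies f r \<subseteq> koszul f) \<Longrightarrow> enat m \<le> mdr_e f"
  unfolding mdr_e_syz by (rule Inf_greatest) (force simp: not_less[symmetric])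

lemma mdr_ge: "(\<And>r t. r < m \<Longrightarrow> t \<in> syzygies f r \<Longrightarrow> t = (0, 0, 0)) \<Longrightarrow> enat m \<le> mdr f"
  unfolding mdr_syz by (rule Inf_greatest) (force simp: not_less[symmetric])

lemma enat_Inf_attained:
  assumes "Inf A = enat m"
  shows "enat m \<in> A"
proof -
  have "A \<noteq> {}" using assms by (auto simp: top_enat_def)
  then obtain k where "k \<in> A" by blast
  then have "Inf A \<in> A" by (rule wellorder_InfI)
  then show ?thesis by (simp add: assms)
qed

lemma mdr_e_attained:
  assumes "mdr_e f = enat m"
  shows "\<not> syzygies f m \<subseteq> koszul f" "\<And>r. r < m \<Longrightarrow> syzygies f r \<subseteq> koszul f"
proof -
  show "\<not> syzygies f m \<subseteq> koszul f" using enat_Inf_attained[OF assms[unfolded mdr_e_syz]] by auto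
  show "syzygies f r \<subseteq> koszul f" if "r < m" for r
    using mdr_e_le[of f r] assms that by force
qed

lemma mdr_attained: "mdr f = enat m \<Longrightarrow> \<exists>t\<in>syzygies f m. t \<noteq> (0, 0, 0)"
  unfolding mdr_syz by (drule enat_Inf_attained) auto

text \<open>
  The entries of a Koszul relation are combinations of partial derivatives, which have degree \<open>d - 1\<close>.
\<close>

lemma koszul_low_degree:
  assumes f: "f \<in> forms d" and "t \<in> syzygies f r" "t \<in> koszul f" "r < d - 1"
  shows "t = (0, 0, 0)"
proof -
  obtain x y z where t: "t = (x, y, z)" by (metis prod.collapse)
  have "(x, y, z) \<in> kos (dx f) (dy f) (dz f)" "x \<in> forms r" "y \<in> forms r" "z \<in> forms r"
    using assms(2,3) by (auto simp: t syz_def koszul_kos)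
  then show ?thesis
    by (rule kos_homogeneous[OF forms_d[OF f]]) (use assms(4) t in auto)
qed

lemma mdr_le_mdr_e: "mdr f \<le> mdr_e f"
proof (cases "mdr_e f")
  case (enat m)
  then obtain t where "t \<in> syzygies f m" "t \<notin> koszul f" using mdr_e_attained(1) by blast
  moreover from this(2) have "t \<noteq> (0, 0, 0)" using kos_0 by (auto simp: koszul_kos)
  ultimately show ?thesis using enat mdr_le by metis
qed simp

lemma mdr_eq_mdr_e:
  assumes "f \<in> forms d" "mdr f < enat (d - 1)"
  shows "mdr f = mdr_e f"
proof -
  obtain m where m: "mdr f = enat m" "m < d - 1" using assms(2) by (cases "mdr f") auto
  then obtain t where "t \<in> syzygies f m" "t \<noteq> (0, 0, 0)" using mdr_attained by blast
  then have "\<not> syzygies f m \<subseteq> koszul f" using koszul_low_degree[OF assms(1)] m(2) by blast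
  then have "mdr_e f \<le> mdr f" using m(1) mdr_e_le by metis
  then show ?thesis using mdr_le_mdr_e antisym by blast
qed

text \<open>
  In degrees \<open>k < d - 1\<close> the Jacobian ideal is zero. In degree \<open>n + (d - 1)\<close> the Milnor algebras of
  \<open>f\<close> and \<open>fs\<close> differ in dimension exactly if \<open>f\<close> has a syzygy of degree \<open>n\<close> that is not Koszul, and
  \<open>mdr_e\<close> is the first such \<open>n\<close>.
\<close>

lemma ct_eq:
  assumes f: "f \<in> forms d" "d \<ge> 2" and cop: "coprime3 (dx f) (dy f) (dz f)"
    and fs: "smooth_form d fs" and m: "mdr_e f = enat m"
  shows "ct fs f = enat (m + (d - 2))"
proof -
  have fs': "fs \<in> forms d" using fs by (simp add: smooth_form_def)
  let ?e = "d - 1"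
  have eq: "milnor_dim f (n + ?e) = milnor_dim fs (n + ?e) \<longleftrightarrow> syzygies f n \<subseteq> koszul f" for n
    unfolding milnor_dim_def jacobian_gen3 koszul_kos
    by (rule quot_dim_eq_iff_syz_koszul[OF forms_d[OF f(1)] cop forms_d[OF fs'] smooth_form_partials[OF fs f(2)]])
  have low: "milnor_dim f k = milnor_dim fs k" if "k < ?e" for k
    unfolding milnor_dim_def jacobian_gen3
      quot_dim_low_degree[OF forms_d[OF f(1)] that] quot_dim_low_degree[OF forms_d[OF fs'] that] ..
  have "milnor_dim f k = milnor_dim fs k" if "k < m + ?e" for k
    using low[of k] eq[of "k - ?e"] mdr_e_attained(2)[OF m, of "k - ?e"] that by (cases "k < ?e") auto
  moreover have "milnor_dim f (m + ?e) \<noteq> milnor_dim fs (m + ?e)" using eq mdr_e_attained(1)[OF m] by blast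
  ultimately have set: "(\<forall>k\<le>q. milnor_dim f k = milnor_dim fs k) \<longleftrightarrow> q < m + ?e" for q
    by (metis le_less_trans linorder_not_less)
  show ?thesis
    unfolding ct_def set
  proof (rule antisym)
    show "Sup {enat q |q. q < m + ?e} \<le> enat (m + (d - 2))"
      using f(2) by (intro Sup_least) auto
    show "enat (m + (d - 2)) \<le> Sup {enat q |q. q < m + ?e}"
      using f(2) by (intro Sup_upper) auto
  qed
qed

section \<open>Line arrangements\<close>

lemma forms_prod: "finite A \<Longrightarrow> (\<And>i. i \<in> A \<Longrightarrow> F i \<in> forms 1) \<Longrightarrow> (\<Prod>i\<in>A. F i) \<in> forms (card A)"
proof (induction A rule: finite_induct)
  case empty
  then show ?case using forms_const3[of 1] by (simp add: const3_hom)
next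
  case (insert x A)
  then show ?case using forms_mult[of "F x" 1 "\<Prod>i\<in>A. F i" "card A"] by simp
qed

lemma lin_inj: "lin a = lin b \<longleftrightarrow> a = b"
proof
  assume "lin a = lin b"
  then have "dot a p = dot b p" for p by (metis eval_lin)
  from this[of "(1, 0, 0)"] this[of "(0, 1, 0)"] this[of "(0, 0, 1)"] show "a = b"
    by (cases a; cases b) (simp add: dot_def)
qed simp

lemma cross_multiple:
  assumes "cross x y = (0, 0, 0)" "y \<noteq> (0, 0, 0)"
  shows "\<exists>s. \<forall>u. dot u x = s * dot u y"
proof -
  have "cross y x = (0, 0, 0)" using assms(1) by (cases x; cases y) (simp add: cross_def mult.commute)
  then obtain s where s: "lin x = const3 s * lin y" using cross_eq_0_imp_multiple assms(2) by blast
  have "dot u x = s * dot u y" for u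
  proof -
    have "eval3 (lin x) u = s * eval3 (lin y) u" unfolding s by (cases u) (simp add: eval_simps)
    then show ?thesis by (cases u; cases x; cases y) (simp add: eval_lin dot_def algebra_simps)
  qed
  then show ?thesis by blast
qed

lemma cross_cross:
  assumes "dot u A = 0" "dot w A = 0"
  shows "cross A (cross u w) = (0, 0, 0)"
proof -
  obtain u1 u2 u3 w1 w2 w3 a1 a2 a3 where [simp]: "u = (u1, u2, u3)" "w = (w1, w2, w3)" "A = (a1, a2, a3)"
    by (metis prod.collapse)
  have "cross A (cross u w) = (u1 * dot w A - w1 * dot u A, u2 * dot w A - w2 * dot u A, u3 * dot w A - w3 * dot u A)"
    by (simp add: cross_def dot_def algebra_simps)
  then show ?thesis unfolding assms by simp
qed

text \<open>
  The coefficient vectors \<open>v i\<close> of the lines are fixed once so that incidences become vector algebra: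
  the lines \<open>i\<close> and \<open>j\<close> meet in \<open>cross (v i) (v j)\<close>.
\<close>

locale lines =
  fixes d :: nat and l :: "nat \<Rightarrow> ternary" and v :: "nat \<Rightarrow> vec3" and f :: ternary
  assumes arr: "line_arrangement d l" and d: "d \<ge> 2" and f_def: "f = (\<Prod>i<d. l i)"
    and l_lin: "\<And>i. i < d \<Longrightarrow> l i = lin (v i)"
begin

lemma v_nz: "i < d \<Longrightarrow> v i \<noteq> (0, 0, 0)"
  using arr l_lin by (force simp: line_arrangement_def)

lemma l_prime: "i < d \<Longrightarrow> prime_elem (l i)"
  using prime_lin v_nz l_lin by simp

lemma cross_nz:
  assumes "i < d" "j < d" "i \<noteq> j"
  shows "cross (v i) (v j) \<noteq> (0, 0, 0)"
proof
  assume "cross (v i) (v j) = (0, 0, 0)"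
  then obtain k where k: "lin (v j) = const3 k * lin (v i)"
    using cross_eq_0_imp_multiple v_nz[OF assms(1)] by blast
  then have "k \<noteq> 0" using v_nz[OF assms(2)] by (auto simp: const3_hom)
  have "eval3 (lin (v j)) p = k * eval3 (lin (v i)) p" for p
    unfolding k by (cases p) (simp add: eval_simps)
  then have "zeros (l i) = zeros (l j)"
    using \<open>k \<noteq> 0\<close> by (auto simp: zeros_def l_lin assms)
  then show False using arr assms by (auto simp: line_arrangement_def inj_on_def)
qed

lemma l_not_dvd: "i < d \<Longrightarrow> j < d \<Longrightarrow> i \<noteq> j \<Longrightarrow> \<not> l i dvd l j"
  using lin_dvd_lin cross_nz l_lin by metis

lemma l_coprime: "i < d \<Longrightarrow> j < d \<Longrightarrow> i \<noteq> j \<Longrightarrow> coprime (l i) (l j)"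
  using l_not_dvd l_prime prime_elem_imp_coprime by blast

lemma f_form: "f \<in> forms d"
  using forms_prod[of "{..<d}" l] arr by (simp add: f_def line_arrangement_def)

lemma f_nz: "f \<noteq> 0"
  using arr by (simp add: f_def line_arrangement_def)

lemma f_squarefree: "squarefree f"
  unfolding f_def using l_coprime l_prime squarefree_prime_elem
  by (intro squarefree_prod_coprime) auto

lemma f_coprime3: "coprime3 (dx f) (dy f) (dz f)"
  using coprime3_partials f_form f_nz f_squarefree d by simp

text \<open>
  The derivative \<open>D\<close> in the direction of the intersection point of the lines 0 and 1 annihilates both
  equations. Write \<open>f = l 0 * l 1 * h\<close>. Then \<open>h D f = (D h) f\<close>, and by Euler's formula \<open>h D - (D h / d) E\<close>
  annihilates \<open>f\<close>, where \<open>E\<close> is the Euler field. It is nonzero since a constant field is not a multiple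
  of \<open>E\<close>.
\<close>

lemma mdr_bound: "mdr f \<le> enat (d - 2)"
proof -
  let ?h = "\<Prod>i\<in>{2..<d}. l i"
  obtain p1 p2 p3 where p: "cross (v 0) (v 1) = (p1, p2, p3)" by (metis prod.collapse)
  define D where "D g = const3 p1 * dx g + const3 p2 * dy g + const3 p3 * dz g" for g
  have D: "deriv_op D"
    by (auto simp: deriv_op_def D_def d_simps algebra_simps)
  have D_lin: "D (lin u) = const3 (dot u (p1, p2, p3))" for u
    by (cases u) (simp add: D_def lin_def d_simps dot_def const3_hom algebra_simps)
  have "D (l 0) = 0" "D (l 1) = 0"
    using l_lin[of 0] l_lin[of 1] d D_lin[of "v 0"] D_lin[of "v 1"] dot_cross_self[where a = "v 0" and b = "v 1"]
    unfolding p by simp_all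
  moreover have f: "f = l 0 * (l 1 * ?h)"
  proof -
    have "{..<d} = insert 0 (insert 1 {2..<d})" using d by auto
    then show ?thesis unfolding f_def by simp
  qed
  ultimately have Df: "D f = l 0 * l 1 * D ?h" by (simp add: deriv_opD[OF D])
  have h: "?h \<in> forms (d - 2)" using forms_prod[of "{2..<d}" l] arr by (simp add: line_arrangement_def)
  have "?h \<noteq> 0" using f_nz f by auto
  define K where "K = const3 (inverse (of_nat d)) * D ?h"
  have K: "K * u \<in> forms (d - 2)" if "u \<in> forms 1" for u
  proof (cases "d = 2")
    case True
    then have "D ?h = 0" by (simp add: deriv_opD[OF D])
    then show ?thesis by (simp add: K_def)
  next
    case False
    have "D ?h \<in> forms (d - 2 - 1)" unfolding D_def using forms_d[OF h] by (intro forms_add forms_cmult)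
    then have "K \<in> forms (d - 2 - 1)" unfolding K_def by (rule forms_cmult)
    moreover have "d - 2 - 1 + 1 = d - 2" using d False by simp
    ultimately show ?thesis using forms_mult[OF _ that] by metis
  qed
  define x y z where "x = const3 p1 * ?h - K * varX" and "y = const3 p2 * ?h - K * varY" and "z = const3 p3 * ?h - K * varZ"
  have "x * dx f + y * dy f + z * dz f = ?h * D f - K * (varX * dx f + varY * dy f + varZ * dz f)"
    by (simp add: x_def y_def z_def D_def algebra_simps)
  also have "K * (varX * dx f + varY * dy f + varZ * dz f) = D ?h * f"
    unfolding euler[OF f_form] K_def using d const3_inverse[of "of_nat d" "D ?h * f"] by (simp add: ac_simps)
  also have "?h * D f - D ?h * f = 0" unfolding Df by (simp add: f)
  finally have syz: "(x, y, z) \<in> syzygies f (d - 2)"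
    using h K forms_vars by (simp add: syz_def x_def y_def z_def forms_diff forms_cmult)
  have "(x, y, z) \<noteq> (0, 0, 0)"
  proof
    assume "(x, y, z) = (0, 0, 0)"
    then have e: "const3 p1 * ?h = K * varX" "const3 p2 * ?h = K * varY" "const3 p3 * ?h = K * varZ"
      by (simp_all add: x_def y_def z_def)
    have "?h * (const3 p1 * varY) = K * varX * varY" "?h * (const3 p2 * varX) = K * varX * varY"
      "?h * (const3 p1 * varZ) = K * varX * varZ" "?h * (const3 p3 * varX) = K * varX * varZ"
      by (simp_all only: e[symmetric] mult_ac) (simp_all only: e mult_ac)
    then have "const3 p1 * varY = const3 p2 * varX" "const3 p1 * varZ = const3 p3 * varX"
      using \<open>?h \<noteq> 0\<close> by (metis mult_left_cancel)+
    then have "lin (0, p1, 0) = lin (p2, 0, 0)" "lin (0, 0, p1) = lin (p3, 0, 0)"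
      by (simp_all add: lin_def const3_hom)
    then show False using cross_nz[of 0 1] d p by (simp add: lin_inj)
  qed
  then show ?thesis using mdr_le[OF syz] by blast
qed

lemma mdr_eq: "mdr f = mdr_e f"
proof (rule mdr_eq_mdr_e[OF f_form])
  have "enat (d - 2) < enat (d - 1)" using d by simp
  then show "mdr f < enat (d - 1)" using mdr_bound by (rule le_less_trans[rotated])
qed

text \<open>
  A derivation that annihilates \<open>f\<close> is tangent to each of the lines.
\<close>

lemma deriv_dvd:
  assumes "deriv_op D" "D f = 0" "i < d"
  shows "l i dvd D (l i)"
proof -
  let ?g = "\<Prod>j\<in>{..<d} - {i}. l j"
  have f: "f = l i * ?g" unfolding f_def using assms(3) by (simp add: prod.remove)
  have "D (l i) * ?g = - (l i * D ?g)"
    using assms(2) unfolding f deriv_opD(2)[OF assms(1)] by (simp add: eq_neg_iff_add_eq_0)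
  then have "l i dvd D (l i) * ?g" by simp
  moreover have "\<not> l i dvd ?g"
  proof
    assume "l i dvd ?g"
    moreover have "coprime (l i) ?g" using l_coprime[OF assms(3)] by (intro prod_coprime_right) auto
    ultimately have "l i dvd 1" by (meson coprime_common_divisor dvd_refl)
    then show False using l_prime[OF assms(3)] by (simp add: prime_elem_def)
  qed
  ultimately show ?thesis using prime_elem_dvd_mult_iff[OF l_prime[OF assms(3)]] by blast
qed

lemma dvd_of_all_lines:
  assumes "\<And>i. i < d \<Longrightarrow> l i dvd W"
  shows "f dvd W"
proof -
  have "(\<Prod>i\<in>A. l i) dvd W" if "finite A" "A \<subseteq> {..<d}" for A
    using that
  proof (induction A rule: finite_induct)
    case (insert i A)
    have "coprime (l i) (\<Prod>i\<in>A. l i)"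
      using insert by (intro prod_coprime_right l_coprime) auto
    then show ?case using insert assms[of i] by (simp add: divides_mult)
  qed simp
  then show ?thesis by (simp add: f_def)
qed

text \<open>
  The \<open>d - 1\<close> double points on the line \<open>i\<close> are distinct because no three lines are concurrent. A form of
  smaller degree that does not vanish on the line has fewer zeros there.
\<close>

lemma generic_dvd:
  assumes gen: "generic_arrangement d l" and W: "W \<in> forms n" "n < d - 1" and i: "i < d"
    and van: "\<And>j. j < d \<Longrightarrow> j \<noteq> i \<Longrightarrow> eval3 W (cross (v i) (v j)) = 0"
  shows "l i dvd W"
proof (rule ccontr)
  assume "\<not> l i dvd W"
  then have "\<not> lin (v i) dvd W" using l_lin i by simp
  from form_factor_mod_lin[OF v_nz[OF i] W(1) this] obtain k vs where vs: "k \<noteq> 0" "length vs = n"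
    "\<And>w. w \<in> set vs \<Longrightarrow> cross (v i) w \<noteq> (0, 0, 0)" "lin (v i) dvd W - const3 k * (\<Prod>w\<leftarrow>vs. lin w)" by metis
  have ex: "\<exists>w\<in>set vs. dot w (cross (v i) (v j)) = 0" if j: "j < d" "j \<noteq> i" for j
  proof -
    obtain q1 q2 q3 where q: "cross (v i) (v j) = (q1, q2, q3)" by (metis prod.collapse)
    have "eval3 (W - const3 k * (\<Prod>w\<leftarrow>vs. lin w)) (q1, q2, q3) = 0"
      by (rule eval_zero_of_dvd[OF vs(4)]) (simp add: eval_lin dot_cross_self flip: q)
    then have "eval3 (\<Prod>w\<leftarrow>vs. lin w) (q1, q2, q3) = 0"
      using van[OF j] vs(1) by (simp add: q eval_simps)
    then show ?thesis unfolding eval_prod_list eval_lin q by (auto simp: prod_list_zero_iff)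
  qed
  \<comment> \<open>Two of the double points on the line must be the zero of the same factor.\<close>
  define w where "w j = (SOME w. w \<in> set vs \<and> dot w (cross (v i) (v j)) = 0)" for j
  have w: "w j \<in> set vs" "dot (w j) (cross (v i) (v j)) = 0" if "j < d" "j \<noteq> i" for j
    using someI_ex[of "\<lambda>w. w \<in> set vs \<and> dot w (cross (v i) (v j)) = 0"] ex[OF that] unfolding w_def by blast+
  have "card (set vs) < card ({..<d} - {i})"
    using card_length[of vs] vs(2) W(2) i by (simp add: card_Diff_subset)
  then have "card (w ` ({..<d} - {i})) < card ({..<d} - {i})"
    using card_mono[of "set vs" "w ` ({..<d} - {i})"] w(1) by force
  then have "\<not> inj_on w ({..<d} - {i})" by (rule pigeonhole)
  then obtain j m where jm: "j < d" "j \<noteq> i" "m < d" "m \<noteq> i" "j \<noteq> m" "w j = w m" by (auto simp: inj_on_def)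
  let ?c = "cross (v i) (w j)"
  have c: "?c \<noteq> (0, 0, 0)" using vs(3) w(1) jm by blast
  have on_c: "\<exists>s. \<forall>u. dot u (cross (v i) (v x)) = s * dot u ?c" if "x < d" "x \<noteq> i" "w x = w j" for x
    using that w(2)[of x] c by (intro cross_multiple cross_cross) (auto simp: dot_cross_self)
  obtain s where s: "\<And>u. dot u (cross (v i) (v j)) = s * dot u ?c" using on_c[of j] jm by blast
  obtain t where t: "\<And>u. dot u (cross (v i) (v m)) = t * dot u ?c" using on_c[of m] jm by metis
  have "t \<noteq> 0" using t ex_dot_1[OF cross_nz[OF i, of m]] jm by auto
  moreover have "t * dot (v m) ?c = 0" unfolding t[symmetric] by (rule dot_cross_self)
  ultimately have "dot (v m) (cross (v i) (v j)) = 0" unfolding s by simp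
  moreover obtain r a b c where r: "r \<noteq> 0" "(a, b, c) \<in> P2" "cross (v i) (v j) = (r * a, r * b, r * c)"
    using cross_nz[OF i, of j] jm by (metis P2_representative)
  moreover have "(a, b, c) \<in> zeros (l x)" if "x < d" "dot (v x) (cross (v i) (v j)) = 0" for x
  proof -
    have "r * eval3 (lin (v x)) (a, b, c) = 0"
      using that(2) eval_scale[OF lin_form, of "v x" r a b c] by (simp add: r(3) eval_lin)
    then show ?thesis using r that(1) by (simp add: zeros_def l_lin)
  qed
  moreover have "dot (v i) (cross (v i) (v j)) = 0" "dot (v j) (cross (v i) (v j)) = 0" by (rule dot_cross_self)+
  ultimately have "(a, b, c) \<in> zeros (l i) \<inter> zeros (l j) \<inter> zeros (l m)"
    using i jm by blast
  then show False using gen i jm unfolding generic_arrangement_def by blast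
qed

text \<open>
  At a double point the vector \<open>(a, b, c)\<close> is annihilated by the equations of two lines, since the
  corresponding field is tangent to both, so it is proportional to the point. Hence
  \<open>(a, b, c) \<times> (x, y, z)\<close> vanishes at all double points, and by \<open>generic_dvd\<close> it is divisible by \<open>f\<close>,
  whose degree is too large.
\<close>

lemma generic_syzygies:
  assumes gen: "generic_arrangement d l" and t: "t \<in> syzygies f r" "r < d - 2"
  shows "t = (0, 0, 0)"
proof -
  obtain a b c where abc: "t = (a, b, c)" by (metis prod.collapse)
  have af: "a \<in> forms r" "b \<in> forms r" "c \<in> forms r" and s: "a * dx f + b * dy f + c * dz f = 0"
    using t(1) by (auto simp: abc syz_def)
  define D where "D g = a * dx g + b * dy g + c * dz g" for g
  have D: "deriv_op D" by (auto simp: deriv_op_def D_def d_simps algebra_simps)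
  have A0: "dot (v i) (eval3 a p, eval3 b p, eval3 c p) = 0" if "i < d" "dot (v i) p = 0" for i p
  proof -
    obtain x y z where v: "v i = (x, y, z)" by (metis prod.collapse)
    have "D (lin (v i)) = const3 x * a + const3 y * b + const3 z * c"
      by (simp add: D_def lin_def v d_simps algebra_simps)
    moreover have "D f = 0" using s by (simp add: D_def)
    then have "lin (v i) dvd D (lin (v i))" using deriv_dvd[OF D _ that(1)] l_lin[OF that(1)] by simp
    then have "eval3 (D (lin (v i))) p = 0" by (rule eval_zero_of_dvd) (simp add: eval_lin that(2))
    ultimately show ?thesis by (cases p) (simp add: v dot_def eval_simps)
  qed
  define W1 W2 W3 where "W1 = b * varZ - c * varY" and "W2 = c * varX - a * varZ" and "W3 = a * varY - b * varX"
  have Wf: "W1 \<in> forms (r + 1)" "W2 \<in> forms (r + 1)" "W3 \<in> forms (r + 1)"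
    unfolding W1_def W2_def W3_def by (intro forms_diff forms_mult af forms_vars)+
  have W0: "eval3 W1 p = 0 \<and> eval3 W2 p = 0 \<and> eval3 W3 p = 0" if "i < d" "j < d" "p = cross (v i) (v j)" for i j p
  proof -
    obtain x y z where p: "p = (x, y, z)" by (metis prod.collapse)
    have "cross (eval3 a p, eval3 b p, eval3 c p) p = (0, 0, 0)"
      unfolding that(3) using that dot_cross_self by (intro cross_cross A0) auto
    then show ?thesis by (simp add: W1_def W2_def W3_def p eval_simps cross_def)
  qed
  have W: "W = 0" if "W \<in> {W1, W2, W3}" for W
  proof -
    have "W \<in> forms (r + 1)" using that Wf by auto
    then have "l i dvd W" if "i < d" for i
      using W0[OF that _ refl] \<open>W \<in> {W1, W2, W3}\<close> t(2) that by (intro generic_dvd[OF gen, of W "r + 1"]) auto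
    then have "f dvd W" by (rule dvd_of_all_lines)
    then obtain h where h: "W = h * f" by (metis dvdE mult.commute)
    have "r + 1 < d" using t(2) by linarith
    then show ?thesis
      using form_mult_low_degree[OF _ f_form, of h "r + 1"] \<open>W \<in> forms (r + 1)\<close> unfolding h by blast
  qed
  have cop: "coprime3 varX varY varZ"
  proof (rule ccontr)
    assume "\<not> coprime3 varX varY varZ"
    moreover have "varX \<noteq> 0" by (simp add: varX_def)
    ultimately have "\<exists>p. p \<noteq> (0, 0, 0) \<and> eval3 varX p = 0 \<and> eval3 varY p = 0 \<and> eval3 varZ p = 0"
      using common_zero_of_common_factor[OF forms_vars] by blast
    then show False by (auto simp: eval_simps)
  qed
  have "varX * b = varY * a" "varX * c = varZ * a" "varY * c = varZ * b"
    using W[of W1] W[of W2] W[of W3] by (simp_all add: W1_def W2_def W3_def mult.commute)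
  from coprime3_proportional[OF cop this] obtain h where h: "a = h * varX" "b = h * varY" "c = h * varZ" by blast
  have "h * (varX * dx f + varY * dy f + varZ * dz f) = 0" using s unfolding h by (simp add: algebra_simps)
  then have "h = 0" unfolding euler[OF f_form] using f_nz d by simp
  then show ?thesis by (simp add: abc h)
qed

lemma generic_mdr: "generic_arrangement d l \<Longrightarrow> mdr f = enat (d - 2)"
  using mdr_bound mdr_ge[of "d - 2" f] generic_syzygies by (intro antisym) blast+

end

theorem arrangement_invariants:
  assumes "d \<ge> 2" "line_arrangement d l" "f = (\<Prod>i<d. l i)"
  shows "mdr f = mdr_e f" "mdr_e f \<le> enat (d - 2)" "smooth_form d fs \<Longrightarrow> ct fs f \<le> enat (2 * (d - 2))"
    "generic_arrangement d l \<Longrightarrow> mdr f = enat (d - 2)"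
    "generic_arrangement d l \<Longrightarrow> smooth_form d fs \<Longrightarrow> ct fs f = enat (2 * (d - 2))"
proof -
  have "\<exists>w. l i = lin w" if "i < d" for i
    using assms(2) that forms_1_iff by (auto simp: line_arrangement_def)
  then obtain v where "\<And>i. i < d \<Longrightarrow> l i = lin (v i)" by metis
  then interpret lines d l v f using assms by unfold_locales
  show "mdr f = mdr_e f" by (rule mdr_eq)
  then show le: "mdr_e f \<le> enat (d - 2)" using mdr_bound by simp
  then obtain m where m: "mdr_e f = enat m" "m \<le> d - 2" by (cases "mdr_e f") auto
  have ct: "ct fs f = enat (m + (d - 2))" if "smooth_form d fs"
    by (rule ct_eq[OF f_form d f_coprime3 that m(1)])
  show "smooth_form d fs \<Longrightarrow> ct fs f \<le> enat (2 * (d - 2))" using ct m(2) by simp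
  show "generic_arrangement d l \<Longrightarrow> mdr f = enat (d - 2)" by (rule generic_mdr)
  then show "generic_arrangement d l \<Longrightarrow> smooth_form d fs \<Longrightarrow> ct fs f = enat (2 * (d - 2))"
    using ct m(1) mdr_eq by simp
qed


section \<open>Curves with total Tjurina number one\<close>

abbreviation locU :: binary_fps where "locU \<equiv> fps_const fps_X"
abbreviation locV :: binary_fps where "locV \<equiv> fps_X"

text \<open>
  Only the 1-jets of local power series matter for the Tjurina number 1.
\<close>

abbreviation jet0 :: "binary_fps \<Rightarrow> complex" where "jet0 g \<equiv> g $ 0 $ 0"
abbreviation jetU :: "binary_fps \<Rightarrow> complex" where "jetU g \<equiv> g $ 0 $ 1"
abbreviation jetV :: "binary_fps \<Rightarrow> complex" where "jetV g \<equiv> g $ 1 $ 0"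

lemma jet_mult:
  "jet0 (g * h) = jet0 g * jet0 h"
  "jetU (g * h) = jetU g * jet0 h + jet0 g * jetU h"
  "jetV (g * h) = jetV g * jet0 h + jet0 g * jetV h"
  by (simp_all add: fps_mult_nth fps_mult_nth_1 algebra_simps)

lemma jet_basic:
  "jet0 1 = 1" "jet0 (const2 z) = z" "jetU (const2 z) = 0" "jetV (const2 z) = 0"
  "jet0 locU = 0" "jetU locU = 1" "jetV locU = 0" "jet0 locV = 0" "jetU locV = 0" "jetV locV = 1"
  by (simp_all add: const2_def)

lemma jet_deriv: "jet0 (du g) = jetU g" "jet0 (dv g) = jetV g"
  by (simp_all add: du_def dv_def)

lemma unital_hom_const2: "unital_hom const2"
  unfolding const2_def[abs_def] by (rule unital_hom_comp[OF unital_hom_const_fps unital_hom_const_fps])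

lemma unital_hom_jet0: "unital_hom jet0"
  by (simp add: unital_hom_def jet_mult)

lemma deriv_op_du: "deriv_op du"
  unfolding deriv_op_def du_def
proof (intro conjI allI)
  fix f g :: binary_fps
  show "Abs_fps (\<lambda>j. fps_deriv ((f + g) $ j)) = Abs_fps (\<lambda>j. fps_deriv (f $ j)) + Abs_fps (\<lambda>j. fps_deriv (g $ j))"
    by (rule fps_ext) simp
  show "Abs_fps (\<lambda>j. fps_deriv ((f * g) $ j)) = Abs_fps (\<lambda>j. fps_deriv (f $ j)) * g + f * Abs_fps (\<lambda>j. fps_deriv (g $ j))"
  proof (rule fps_ext)
    fix n
    have "fps_deriv (\<Sum>i=0..n. f $ i * g $ (n - i)) = (\<Sum>i=0..n. fps_deriv (f $ i * g $ (n - i)))"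
      by (rule fps_deriv_sum)
    then show "Abs_fps (\<lambda>j. fps_deriv ((f * g) $ j)) $ n
      = (Abs_fps (\<lambda>j. fps_deriv (f $ j)) * g + f * Abs_fps (\<lambda>j. fps_deriv (g $ j))) $ n"
      by (simp add: fps_mult_nth sum.distrib add.commute)
  qed
qed

lemma deriv_op_dv: "deriv_op dv"
  by (simp add: deriv_op_def dv_def algebra_simps)

lemma du_dv_basic:
  "du (const2 z) = 0" "dv (const2 z) = 0" "du 1 = 0" "dv 1 = 0" "du locU = 1" "dv locU = 0" "du locV = 0" "dv locV = 1"
  by (auto simp: du_def dv_def const2_def fps_eq_iff fps_X_def)

text \<open>
  \<open>\<kappa>\<close> and \<open>\<mu>\<close> are the two derivations at the point \<open>a \<times> b\<close> dual to the local coordinates \<open>lin a\<close> and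
  \<open>lin b\<close>: the statement is the Taylor expansion of a form at a zero up to second order terms.
\<close>

lemma tangent_expansion:
  fixes \<kappa> \<mu> :: "ternary \<Rightarrow> complex"
  assumes c: "dot c (cross a b) = 1" and F: "F \<in> forms e" "e > 0" "eval3 F (cross a b) = 0"
    and add: "\<And>g h. \<kappa> (g + h) = \<kappa> g + \<kappa> h" "\<And>g h. \<mu> (g + h) = \<mu> g + \<mu> h"
    and mult: "\<And>g h. \<kappa> (g * h) = \<kappa> g * eval3 h (cross a b) + eval3 g (cross a b) * \<kappa> h"
      "\<And>g h. \<mu> (g * h) = \<mu> g * eval3 h (cross a b) + eval3 g (cross a b) * \<mu> h"
    and gens: "\<kappa> (lin a) = 1" "\<kappa> (lin b) = 0" "\<mu> (lin a) = 0" "\<mu> (lin b) = 1"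
  shows "\<exists>r s t. F = lin c ^ (e - 1) * (const3 (\<kappa> F) * lin a + const3 (\<mu> F) * lin b)
    + (r * lin a * lin a + s * lin a * lin b + t * lin b * lin b)"
proof -
  have "cross a b \<noteq> (0, 0, 0)" using c by (cases c) (auto simp: dot_def)
  from form_in_gen2[OF F(1) form_vanishes_gen2[OF this F(1,3)] F(2)]
  obtain A B where AB: "A \<in> forms (e - 1)" "B \<in> forms (e - 1)" "F = lin a * A + lin b * B" by blast
  have \<kappa>\<mu>: "\<kappa> F = eval3 A (cross a b)" "\<mu> F = eval3 B (cross a b)"
    unfolding AB(3) by (simp_all add: add mult gens eval_lin dot_cross_self)
  obtain r s where A: "A - const3 (\<kappa> F) * lin c ^ (e - 1) = r * lin a + s * lin b"
    using form_mod_point[OF c AB(1)] unfolding \<kappa>\<mu> gen2_def by blast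
  obtain r' s' where B: "B - const3 (\<mu> F) * lin c ^ (e - 1) = r' * lin a + s' * lin b"
    using form_mod_point[OF c AB(2)] unfolding \<kappa>\<mu> gen2_def by blast
  have "F = lin a * (A - const3 (\<kappa> F) * lin c ^ (e - 1)) + lin b * (B - const3 (\<mu> F) * lin c ^ (e - 1))
     + lin c ^ (e - 1) * (const3 (\<kappa> F) * lin a + const3 (\<mu> F) * lin b)"
    by (subst (1) AB(3)) (simp add: algebra_simps)
  also have "\<dots> = lin c ^ (e - 1) * (const3 (\<kappa> F) * lin a + const3 (\<mu> F) * lin b)
     + (r * lin a * lin a + (s + r') * lin a * lin b + s' * lin b * lin b)"
    unfolding A B by (simp add: algebra_simps)
  finally show ?thesis by blast
qed

text \<open>
  Compare the 1-jets in the representations of the local coordinates \<open>u\<close>, \<open>v\<close> by the local equation and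
  its derivatives. The local equation itself has zero 1-jet, so \<open>u\<close> and \<open>v\<close> have the 1-jets of constant
  linear combinations of the derivatives. The same combinations of the partial derivatives \<open>G\<close>, \<open>H\<close> of
  \<open>f\<close> are forms in the ideal with prescribed linear parts.
\<close>

lemma node_of_chart:
  fixes t1 t2 t3 :: binary_fps
  defines "\<phi> \<equiv> \<lambda>h. subst3 const2 h (t1, t2, t3)"
  assumes c: "dot c (cross a b) = 1" and t: "cross a b = (jet0 t1, jet0 t2, jet0 t3)"
    and ab: "\<phi> (lin a) = locU \<and> \<phi> (lin b) = locV \<or> \<phi> (lin a) = locV \<and> \<phi> (lin b) = locU"
    and GH: "G \<in> J" "H \<in> J" "is_ideal J" "G \<in> forms e" "H \<in> forms e" "e > 0"
    and D: "du (\<phi> f) = \<phi> G" "dv (\<phi> f) = \<phi> H"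
    and sing: "eval3 f (cross a b) = 0" "eval3 G (cross a b) = 0" "eval3 H (cross a b) = 0"
    and U: "locU = x * \<phi> f + y * du (\<phi> f) + z * dv (\<phi> f)"
    and V: "locV = x' * \<phi> f + y' * du (\<phi> f) + z' * dv (\<phi> f)"
  shows "(\<exists>r s t. lin c ^ (e - 1) * lin a + (r * lin a * lin a + s * lin a * lin b + t * lin b * lin b) \<in> J) \<and>
    (\<exists>r s t. lin c ^ (e - 1) * lin b + (r * lin a * lin a + s * lin a * lin b + t * lin b * lin b) \<in> J)"
proof -
  have hom: "unital_hom \<phi>" unfolding \<phi>_def by (rule unital_hom_subst3[OF unital_hom_const2])
  note \<phi> = unital_homD[OF hom]
  have jet0_\<phi>: "jet0 (\<phi> h) = eval3 h (cross a b)" for h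
  proof -
    have "jet0 (\<phi> h) = subst3 (\<lambda>x. jet0 (const2 x)) h (jet0 t1, jet0 t2, jet0 t3)"
      unfolding \<phi>_def by (rule hom_subst3[OF unital_hom_const2 unital_hom_jet0])
    then show ?thesis by (simp add: jet_basic t)
  qed
  have \<phi>_const: "\<phi> (const3 k) = const2 k" for k
    unfolding \<phi>_def by (rule subst3_gens(1)[OF unital_hom_const2])
  have f0: "jet0 (\<phi> f) = 0" "jetU (\<phi> f) = 0" "jetV (\<phi> f) = 0"
    using jet0_\<phi>[of f] jet0_\<phi>[of G] jet0_\<phi>[of H] sing jet_deriv[of "\<phi> f"] by (simp_all add: D)
  have GH0: "jet0 (\<phi> G) = 0" "jet0 (\<phi> H) = 0" using jet0_\<phi> sing by simp_all
  define jets where "jets F = (jetU (\<phi> F), jetV (\<phi> F))" for F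
  have ex: "\<exists>F. F \<in> J \<and> F \<in> forms e \<and> eval3 F (cross a b) = 0 \<and> jets F = (jetU w, jetV w)"
    if w: "w = x * \<phi> f + y * du (\<phi> f) + z * dv (\<phi> f)" for w x y z
  proof -
    define F where "F = const3 (jet0 y) * G + const3 (jet0 z) * H"
    have "jetU w = jet0 y * jetU (\<phi> G) + jet0 z * jetU (\<phi> H)" "jetV w = jet0 y * jetV (\<phi> G) + jet0 z * jetV (\<phi> H)"
      unfolding w D by (simp_all only: fps_add_nth jet_mult f0 GH0) simp_all
    then have "jets F = (jetU w, jetV w)"
      by (simp only: jets_def F_def \<phi> \<phi>_const fps_add_nth jet_mult jet_basic) simp
    moreover have "F \<in> J" "F \<in> forms e"
      unfolding F_def using GH by (auto intro!: is_idealD(2,3) forms_add forms_cmult)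
    moreover have "eval3 F (cross a b) = 0"
      unfolding F_def using sing by (cases "cross a b") (simp add: eval_simps)
    ultimately show ?thesis by blast
  qed
  obtain F where F: "F \<in> J" "F \<in> forms e" "eval3 F (cross a b) = 0" "jets F = (1, 0)"
    using ex[OF U] by (auto simp: jet_basic)
  obtain F' where F': "F' \<in> J" "F' \<in> forms e" "eval3 F' (cross a b) = 0" "jets F' = (0, 1)"
    using ex[OF V] by (auto simp: jet_basic)
  have add: "jetU (\<phi> (g + h)) = jetU (\<phi> g) + jetU (\<phi> h)" "jetV (\<phi> (g + h)) = jetV (\<phi> g) + jetV (\<phi> h)" for g h
    by (simp_all add: \<phi>)
  have mult: "jetU (\<phi> (g * h)) = jetU (\<phi> g) * eval3 h (cross a b) + eval3 g (cross a b) * jetU (\<phi> h)"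
    "jetV (\<phi> (g * h)) = jetV (\<phi> g) * eval3 h (cross a b) + eval3 g (cross a b) * jetV (\<phi> h)" for g h
    unfolding \<phi>(4) jet_mult jet0_\<phi> by (rule refl)+
  from ab show ?thesis
  proof
    assume ab: "\<phi> (lin a) = locU \<and> \<phi> (lin b) = locV"
    have gens: "jetU (\<phi> (lin a)) = 1" "jetU (\<phi> (lin b)) = 0" "jetV (\<phi> (lin a)) = 0" "jetV (\<phi> (lin b)) = 1"
      using ab jet_basic by simp_all
    note E = tangent_expansion[where \<kappa> = "\<lambda>h. jetU (\<phi> h)" and \<mu> = "\<lambda>h. jetV (\<phi> h)", OF c _ GH(6) _ add mult gens]
    show ?thesis using E[OF F(2,3)] E[OF F'(2,3)] F(1,4) F'(1,4)
      by (simp add: jets_def const3_hom) metis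
  next
    assume ab: "\<phi> (lin a) = locV \<and> \<phi> (lin b) = locU"
    have gens: "jetV (\<phi> (lin a)) = 1" "jetV (\<phi> (lin b)) = 0" "jetU (\<phi> (lin a)) = 0" "jetU (\<phi> (lin b)) = 1"
      using ab jet_basic by simp_all
    note E = tangent_expansion[where \<kappa> = "\<lambda>h. jetV (\<phi> h)" and \<mu> = "\<lambda>h. jetU (\<phi> h)", OF c _ GH(6) _ add(2,1) mult(2,1) gens]
    show ?thesis using E[OF F(2,3)] E[OF F'(2,3)] F(1,4) F'(1,4)
      by (simp add: jets_def const3_hom) metis
  qed
qed

definition tjurina_ideal :: "binary_fps \<Rightarrow> binary_fps set" where
  "tjurina_ideal g = {a * g + b * du g + c * dv g | a b c.
     a \<in> convergent_series \<and> b \<in> convergent_series \<and> c \<in> convergent_series}"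

lemma jet0_tjurina_ideal:
  assumes "jet0 g = 0" "jetU g = 0" "jetV g = 0" "h \<in> tjurina_ideal g"
  shows "jet0 h = 0"
  using assms by (auto simp: tjurina_ideal_def jet_mult jet_deriv)

lemma convergent_basic: "1 \<in> convergent_series" "locU \<in> convergent_series" "locV \<in> convergent_series"
proof -
  have "norm (1 $ j $ i :: complex) \<le> 1 * 1 ^ (i + j)" "norm (locU $ j $ i) \<le> 1 * 1 ^ (i + j)"
    "norm (locV $ j $ i) \<le> 1 * 1 ^ (i + j)" for i j :: nat
    by (auto simp: fps_X_def)
  then show "1 \<in> convergent_series" "locU \<in> convergent_series" "locV \<in> convergent_series"
    unfolding convergent_series_def by blast+
qed

lemma quot_dim_ge:
  assumes "finite B" "B \<subseteq> V" "\<And>c. (\<Sum>b\<in>B. e (c b) * b) \<in> W \<Longrightarrow> \<forall>b\<in>B. c b = 0"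
  shows "enat (card B) \<le> quot_dim e V W"
  unfolding quot_dim_def using assms by (intro Sup_upper) blast

lemma tjurina_dim_ge_1:
  assumes "jet0 g = 0" "jetU g = 0" "jetV g = 0"
  shows "quot_dim const2 convergent_series (tjurina_ideal g) \<ge> 1"
proof -
  have "enat (card {1 :: binary_fps}) \<le> quot_dim const2 convergent_series (tjurina_ideal g)"
    using jet0_tjurina_ideal[OF assms] convergent_basic(1)
    by (intro quot_dim_ge) (force simp: jet_mult jet_basic)+
  then show ?thesis by (simp add: one_enat_def)
qed

text \<open>
  If the quotient has dimension 1, then 1 and \<open>w\<close> are dependent modulo the ideal. As the ideal consists
  of series without constant term, the coefficient of 1 in the dependence vanishes, and \<open>w\<close> lies in the
  ideal.
\<close>

lemma tjurina_dim_1_parameter: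
  assumes g: "jet0 g = 0" "jetU g = 0" "jetV g = 0"
    and 1: "quot_dim const2 convergent_series (tjurina_ideal g) = 1"
    and w: "w \<in> convergent_series" "jet0 w = 0" "w \<noteq> 0"
  shows "\<exists>x y z. w = x * g + y * du g + z * dv g"
proof -
  have "w \<noteq> 1" using w(2) by auto
  have "\<not> enat (card {1, w}) \<le> quot_dim const2 convergent_series (tjurina_ideal g)"
    unfolding 1 using \<open>w \<noteq> 1\<close> by (simp add: one_enat_def)
  then obtain k where k: "(\<Sum>b\<in>{1, w}. const2 (k b) * b) \<in> tjurina_ideal g" "\<not> (\<forall>b\<in>{1, w}. k b = 0)"
    using quot_dim_ge[of "{1, w}" convergent_series const2 "tjurina_ideal g"] w(1) convergent_basic(1) by blast
  have s: "const2 (k 1) + const2 (k w) * w \<in> tjurina_ideal g" using k(1) \<open>w \<noteq> 1\<close> by simp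
  then have "k 1 = 0" using jet0_tjurina_ideal[OF g s] w(2) by (simp add: jet_mult jet_basic)
  then have kw: "k w \<noteq> 0" using k(2) by auto
  have "const2 (k w) * w \<in> tjurina_ideal g" using s \<open>k 1 = 0\<close> unital_homD(1)[OF unital_hom_const2] by simp
  then obtain x y z where "const2 (k w) * w = x * g + y * du g + z * dv g" by (auto simp: tjurina_ideal_def)
  then have "const2 (inverse (k w)) * (const2 (k w) * w) = const2 (inverse (k w)) * (x * g + y * du g + z * dv g)" by simp
  moreover have "const2 (inverse (k w)) * (const2 (k w) * w) = w"
    using kw by (simp add: mult.assoc[symmetric] unital_homD(2)[OF unital_hom_const2] flip: unital_homD(4)[OF unital_hom_const2])
  ultimately have "w = const2 (inverse (k w)) * x * g + const2 (inverse (k w)) * y * du g + const2 (inverse (k w)) * z * dv g"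
    by (simp add: algebra_simps)
  then show ?thesis by blast
qed

text \<open>
  The linear forms \<open>a\<close>, \<open>b\<close>, \<open>c\<close> correspond to the local coordinates and the constant 1. The order of the
  coordinates is left open so that \<open>cross a b\<close> is \<open>p\<close> itself and not its negative in all three charts.
\<close>

definition local_chart :: "vec3 \<Rightarrow> binary_fps \<times> binary_fps \<times> binary_fps \<Rightarrow> vec3 \<Rightarrow> vec3 \<Rightarrow> vec3 \<Rightarrow>
    (ternary \<Rightarrow> ternary) \<Rightarrow> (ternary \<Rightarrow> ternary) \<Rightarrow> bool" where
  "local_chart p t a b c D1 D2 \<longleftrightarrow>
     (\<forall>f. local_eq f p = subst3 const2 f t) \<and> cross a b = p \<and> dot c p = 1 \<and>
     p = (jet0 (fst t), jet0 (fst (snd t)), jet0 (snd (snd t))) \<and>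
     (subst3 const2 (lin a) t = locU \<and> subst3 const2 (lin b) t = locV \<or>
      subst3 const2 (lin a) t = locV \<and> subst3 const2 (lin b) t = locU) \<and>
     D1 \<in> {dx, dy, dz} \<and> D2 \<in> {dx, dy, dz} \<and>
     (\<forall>f. du (subst3 const2 f t) = subst3 const2 (D1 f) t \<and> dv (subst3 const2 f t) = subst3 const2 (D2 f) t)"

lemma chart_exists:
  assumes p: "p \<in> P2"
  obtains t1 t2 t3 a b c D1 D2 where "local_chart p (t1, t2, t3) a b c D1 D2"
proof -
  note chain = chain_rule[OF unital_hom_const2 deriv_op_du du_dv_basic(1)] chain_rule[OF unital_hom_const2 deriv_op_dv du_dv_basic(2)]
  note D = deriv_opD(1)[OF deriv_op_du] deriv_opD(1)[OF deriv_op_dv] du_dv_basic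
  note s = subst3_simps[OF unital_hom_const2] unital_homD[OF unital_hom_const2]
  from p consider (1) b c where "p = (1, b, c)" | (2) c where "p = (0, 1, c)" | (3) "p = (0, 0, 1)"
    by (auto simp: P2_def)
  then show ?thesis
  proof cases
    case 1
    show ?thesis
      by (rule that[of 1 "const2 b + locU" "const2 c + locV" "(- b, 1, 0)" "(- c, 0, 1)" "(1, 0, 0)" dy dz])
         (simp_all add: 1 local_chart_def local_eq_def cross_def dot_def jet_basic lin_def s chain D)
  next
    case 2
    show ?thesis
      by (rule that[of locU 1 "const2 c + locV" "(0, - c, 1)" "(1, 0, 0)" "(0, 1, 0)" dx dz])
         (simp_all add: 2 local_chart_def local_eq_def cross_def dot_def jet_basic lin_def s chain D)
  next
    case 3
    show ?thesis
      by (rule that[of locU locV 1 "(1, 0, 0)" "(0, 1, 0)" "(0, 0, 1)" dx dy])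
         (simp_all add: 3 local_chart_def local_eq_def cross_def dot_def jet_basic lin_def s chain D)
  qed
qed

lemma local_chartD:
  assumes "local_chart p t a b c D1 D2"
  shows "local_eq f p = subst3 const2 f t" "cross a b = p" "dot c (cross a b) = 1"
    "cross a b = (jet0 (fst t), jet0 (fst (snd t)), jet0 (snd (snd t)))"
    "subst3 const2 (lin a) t = locU \<and> subst3 const2 (lin b) t = locV \<or>
     subst3 const2 (lin a) t = locV \<and> subst3 const2 (lin b) t = locU"
    "D1 \<in> {dx, dy, dz}" "D2 \<in> {dx, dy, dz}"
    "du (subst3 const2 f t) = subst3 const2 (D1 f) t" "dv (subst3 const2 f t) = subst3 const2 (D2 f) t"
proof -
  have "cross a b = p" using assms unfolding local_chart_def by blast
  then show "cross a b = p" "dot c (cross a b) = 1"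
    "cross a b = (jet0 (fst t), jet0 (fst (snd t)), jet0 (snd (snd t)))"
    using assms unfolding local_chart_def by metis+
qed (use assms in \<open>unfold local_chart_def, blast+\<close>)

lemma tjurina_alt: "tjurina f p = quot_dim const2 convergent_series (tjurina_ideal (local_eq f p))"
  by (simp add: tjurina_def tjurina_ideal_def Let_def)

lemma local_eq_jets:
  assumes p: "p \<in> sing f"
  shows "jet0 (local_eq f p) = 0" "jetU (local_eq f p) = 0" "jetV (local_eq f p) = 0"
proof -
  have P2: "p \<in> P2" and f0: "eval3 f p = 0" "eval3 (dx f) p = 0" "eval3 (dy f) p = 0" "eval3 (dz f) p = 0"
    using p by (auto simp: sing_def zeros_def)
  obtain t1 t2 t3 a b c D1 D2 where "local_chart p (t1, t2, t3) a b c D1 D2"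
    using P2 by (rule chart_exists)
  note ch = local_chartD[OF this, unfolded fst_conv snd_conv]
  have j: "jet0 (subst3 const2 h (t1, t2, t3)) = eval3 h p" for h
    using hom_subst3[OF unital_hom_const2 unital_hom_jet0, of h t1 t2 t3] ch(2,4) by (simp add: jet_basic)
  show "jet0 (local_eq f p) = 0" "jetU (local_eq f p) = 0" "jetV (local_eq f p) = 0"
    unfolding ch(1) jet_deriv[symmetric] ch(8,9) j using ch(6,7) f0 by auto
qed

text \<open>
  Every singular point contributes at least 1.
\<close>

lemma total_tjurina_1:
  assumes "total_tjurina f = 1"
  obtains p where "sing f = {p}" "tjurina f p = 1"
proof -
  have fin: "finite (sing f)" using assms unfolding total_tjurina_def by (metis sum.infinite zero_neq_one)
  have "sing f \<noteq> {}" using assms unfolding total_tjurina_def by auto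
  then obtain p where p: "p \<in> sing f" by blast
  have ge: "tjurina f q \<ge> 1" if "q \<in> sing f" for q
    unfolding tjurina_alt by (rule tjurina_dim_ge_1[OF local_eq_jets[OF that]])
  have "sing f = {p}"
  proof (rule ccontr)
    assume "sing f \<noteq> {p}"
    then obtain q where q: "q \<in> sing f" "q \<noteq> p" using p by blast
    have "1 + 1 \<le> tjurina f p + tjurina f q" using ge p q by (intro add_mono) auto
    also have "\<dots> = (\<Sum>x\<in>{p, q}. tjurina f x)" using q by simp
    also have "\<dots> \<le> (\<Sum>x\<in>sing f. tjurina f x)" using fin p q by (intro sum_mono2) auto
    also have "\<dots> = 1" using assms by (simp add: total_tjurina_def)
    finally show False by (simp add: one_enat_def)
  qed
  then show ?thesis using that assms by (simp add: total_tjurina_def)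
qed

text \<open>
  The unique singular point is an ordinary double point in the sense that the local partial derivatives
  have independent linear parts, which is what \<open>node_syzygies_koszul\<close> requires.
\<close>

theorem tjurina_1_syzygies_koszul:
  assumes f: "f \<in> forms d" "d \<ge> 2" and cop: "coprime3 (dx f) (dy f) (dz f)"
    and tau: "total_tjurina f = 1" and r: "r < 2 * (d - 2)"
  shows "syzygies f r \<subseteq> koszul f"
proof -
  obtain p where p: "sing f = {p}" "tjurina f p = 1" using tau by (rule total_tjurina_1)
  then have P2: "p \<in> P2" and f0: "eval3 f p = 0" "eval3 (dx f) p = 0" "eval3 (dy f) p = 0" "eval3 (dz f) p = 0"
    by (auto simp: sing_def zeros_def)
  obtain t1 t2 t3 a b c D1 D2 where "local_chart p (t1, t2, t3) a b c D1 D2"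
    using P2 by (rule chart_exists)
  note ch = local_chartD[OF this, unfolded fst_conv snd_conv]
  have "p \<in> sing f" using p by simp
  note par = tjurina_dim_1_parameter[OF local_eq_jets[OF this] p(2)[unfolded tjurina_alt]]
  have UV: "locU \<noteq> 0" "locV \<noteq> 0" using jet_basic(6,10) by (metis fps_zero_nth zero_neq_one)+
  obtain x y z where U: "locU = x * local_eq f p + y * du (local_eq f p) + z * dv (local_eq f p)"
    using par[OF convergent_basic(2) jet_basic(5) UV(1)] by blast
  obtain x' y' z' where V: "locV = x' * local_eq f p + y' * du (local_eq f p) + z' * dv (local_eq f p)"
    using par[OF convergent_basic(3) jet_basic(8) UV(2)] by blast
  let ?J = "gen3 (dx f) (dy f) (dz f)"
  have D: "D f \<in> ?J" "D f \<in> forms (d - 1)" "eval3 (D f) (cross a b) = 0" if "D \<in> {dx, dy, dz}" for D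
    using that gen3_gens[where P = "dx f" and Q = "dy f" and R = "dz f"] forms_d[OF f(1)] f0 ch(2) by auto
  have e: "d - 1 > 0" using f(2) by simp
  obtain r1 s1 q1 r2 s2 q2 where
    G: "lin c ^ (d - 1 - 1) * lin a + (r1 * lin a * lin a + s1 * lin a * lin b + q1 * lin b * lin b) \<in> ?J"
      "lin c ^ (d - 1 - 1) * lin b + (r2 * lin a * lin a + s2 * lin a * lin b + q2 * lin b * lin b) \<in> ?J"
    using node_of_chart[OF ch(3,4,5) D(1)[OF ch(6)] D(1)[OF ch(7)] is_ideal_gen3 D(2)[OF ch(6)] D(2)[OF ch(7)] e
      ch(8,9) _ D(3)[OF ch(6)] D(3)[OF ch(7)] U[unfolded ch(1)] V[unfolded ch(1)]] f0(1) ch(2) by blast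
  have zero: "dot a q = 0 \<and> dot b q = 0"
    if q: "q \<noteq> (0, 0, 0)" "eval3 (dx f) q = 0" "eval3 (dy f) q = 0" "eval3 (dz f) q = 0" for q
  proof -
    have "d > 0" using f(2) by simp
    obtain s x y z where s: "(x, y, z) \<in> sing f" "q = (s * x, s * y, s * z)"
      by (rule common_zero_in_sing[OF f(1) \<open>d > 0\<close> q])
    have "eval3 (lin u) q = s * dot u p" for u
      using eval_scale[OF lin_form, of u s x y z] s p(1) by (simp add: eval_lin)
    then show ?thesis using dot_cross_self[where a = a and b = b] ch(2) by (simp add: eval_lin)
  qed
  have "r + 2 < 2 * (d - 1)" using r by linarith
  then show ?thesis
    using node_syzygies_koszul[OF forms_d[OF f(1)] cop ch(3) zero G]
    unfolding koszul_kos syz_def by blast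
qed

theorem singular_curve_invariants:
  assumes d: "d \<ge> 3" and f: "f \<in> forms d" "f \<noteq> 0" "squarefree f" "sing f \<noteq> {}"
  shows "mdr f \<le> enat (d - 1)" "mdr_e f \<le> enat (2 * (d - 2))"
    "smooth_form d fs \<Longrightarrow> ct fs f \<le> enat (3 * (d - 2))"
    "total_tjurina f = 1 \<Longrightarrow> mdr f = enat (d - 1)" "total_tjurina f = 1 \<Longrightarrow> mdr_e f = enat (2 * (d - 2))"
    "total_tjurina f = 1 \<Longrightarrow> smooth_form d fs \<Longrightarrow> ct fs f = enat (3 * (d - 2))"
proof -
  have cop: "coprime3 (dx f) (dy f) (dz f)" using coprime3_partials f d by simp
  note F = forms_d[OF f(1)]
  show mdr: "mdr f \<le> enat (d - 1)"
  proof (cases "dx f = 0 \<and> dy f = 0")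
    case True
    have "dz f \<noteq> 0" using coprime3_nonzero[OF cop] True by blast
    moreover have "(dz f, 0, 0) \<in> syzygies f (d - 1)" using True F by (simp add: syz_def)
    ultimately show ?thesis by (intro mdr_le[of "(dz f, 0, 0)"]) auto
  next
    case False
    have "(dy f, - dx f, 0) \<in> syzygies f (d - 1)" using F by (simp add: syz_def forms_uminus mult.commute)
    then show ?thesis using False by (intro mdr_le[of "(dy f, - dx f, 0)"]) auto
  qed
  obtain p where p: "p \<in> sing f" using f(4) by blast
  have "\<not> syzygies f (2 * (d - 1) - 2) \<subseteq> koszul f"
  proof -
    have "p \<noteq> (0, 0, 0)" "eval3 (dx f) p = 0" "eval3 (dy f) p = 0" "eval3 (dz f) p = 0"
      using p P2_nonzero[of p] by (auto simp: sing_def zeros_def)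
    moreover have "2 \<le> d - 1" using d by simp
    ultimately show ?thesis
      using singular_point_syzygy[OF F _ cop, of p] unfolding syz_def koszul_kos by blast
  qed
  moreover have "2 * (d - 1) - 2 = 2 * (d - 2)" using d by simp
  ultimately show mdr_e: "mdr_e f \<le> enat (2 * (d - 2))" using mdr_e_le by metis
  then obtain m where m: "mdr_e f = enat m" "m \<le> 2 * (d - 2)" by (cases "mdr_e f") auto
  have ct: "ct fs f = enat (m + (d - 2))" if "smooth_form d fs"
    using ct_eq[OF f(1) _ cop that m(1)] d by simp
  then show "smooth_form d fs \<Longrightarrow> ct fs f \<le> enat (3 * (d - 2))" using m(2) by simp
  assume tau: "total_tjurina f = 1"
  have "enat (2 * (d - 2)) \<le> mdr_e f"
    using tjurina_1_syzygies_koszul[OF f(1) _ cop tau] d by (intro mdr_e_ge) auto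
  then show eq: "mdr_e f = enat (2 * (d - 2))" using mdr_e by (rule antisym[rotated])
  show "mdr f = enat (d - 1)"
  proof (rule ccontr)
    assume "mdr f \<noteq> enat (d - 1)"
    then have lt: "mdr f < enat (d - 1)" using mdr by simp
    then have "mdr f = enat (2 * (d - 2))" using mdr_eq_mdr_e[OF f(1)] eq by simp
    then show False using lt d by simp
  qed
  show "smooth_form d fs \<Longrightarrow> ct fs f = enat (3 * (d - 2))" using ct m(1) eq by simp
qed

section \<open>Singular curves and line arrangements\<close>

theorem corollary2p7:
  shows "(\<forall>(d::nat) f. d \<ge> 3 \<and> f \<in> forms d \<and> f \<noteq> 0 \<and> squarefree f \<and> sing f \<noteq> {} \<longrightarrow>
            mdr f \<le> enat (d - 1) \<and> mdr_e f \<le> enat (2 * (d - 2)) \<and>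
            (\<forall>fs. smooth_form d fs \<longrightarrow> ct fs f \<le> enat (3 * (d - 2))) \<and>
            (total_tjurina f = 1 \<longrightarrow>
               mdr f = enat (d - 1) \<and> mdr_e f = enat (2 * (d - 2)) \<and>
               (\<forall>fs. smooth_form d fs \<longrightarrow> ct fs f = enat (3 * (d - 2)))))
       \<and> (\<forall>(d::nat) l f. d \<ge> 2 \<and> line_arrangement d l \<and> f = (\<Prod>i<d. l i) \<longrightarrow>
            mdr f = mdr_e f \<and> mdr_e f \<le> enat (d - 2) \<and>
            (\<forall>fs. smooth_form d fs \<longrightarrow> ct fs f \<le> enat (2 * (d - 2))) \<and>
            (generic_arrangement d l \<longrightarrow>
               mdr f = enat (d - 2) \<and> mdr_e f = enat (d - 2) \<and>
               (\<forall>fs. smooth_form d fs \<longrightarrow> ct fs f = enat (2 * (d - 2)))))"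
proof (intro conjI allI impI; elim conjE)
  fix d :: nat and f fs :: ternary
  assume h: "3 \<le> d" "f \<in> forms d" "f \<noteq> 0" "squarefree f" "sing f \<noteq> {}"
  note inv = singular_curve_invariants[OF h]
  show "mdr f \<le> enat (d - 1)" "mdr_e f \<le> enat (2 * (d - 2))" by (rule inv(1), rule inv(2))
  show "ct fs f \<le> enat (3 * (d - 2))" if "smooth_form d fs" using that by (rule inv(3))
  assume tau: "total_tjurina f = 1"
  show "mdr f = enat (d - 1)" "mdr_e f = enat (2 * (d - 2))" using tau by (rule inv(4), rule inv(5))
  show "ct fs f = enat (3 * (d - 2))" if "smooth_form d fs" using tau that by (rule inv(6))
next
  fix d :: nat and l and f fs :: ternary
  assume h: "2 \<le> d" "line_arrangement d l" "f = (\<Prod>i<d. l i)"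
  note inv = arrangement_invariants[OF h]
  show eq: "mdr f = mdr_e f" "mdr_e f \<le> enat (d - 2)" by (rule inv(1), rule inv(2))
  show "ct fs f \<le> enat (2 * (d - 2))" if "smooth_form d fs" using that by (rule inv(3))
  assume gen: "generic_arrangement d l"
  show m: "mdr f = enat (d - 2)" using gen by (rule inv(4))
  show "mdr_e f = enat (d - 2)" using m eq(1) by simp
  show "ct fs f = enat (2 * (d - 2))" if "smooth_form d fs" using gen that by (rule inv(5))
qed

end
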